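(* Let $f,g$ satisfy the regularity assumption (R) of the context, and let $P\in C^2(\mathbb{R}^d,\mathbb{R})$ have uniformly bounded first and second derivatives. Then there exists a constant $C$, independent of $N$ (equivalently of $\Delta t=T/N$), such that for all $N\ge1$ $$\mathbb{V}\Big[\tfrac12\big(P(X^f_{\mathrm{ave}})+P(X^a_{\mathrm{ave}})\big)-P(X^c_{\mathrm{ave}})\Big]\le C\,\Delta t^2 ,$$ where $\mathbb{V}$ denotes variance.
   Context: Let $d,D\ge 1$ be integers and $T>0$. On a complete probability space with a filtration $\{\mathcal F_t\}_{t\ge0}$ satisfying the usual conditions, let $w=(w_1,\dots,w_D)$ be a $D$-dimensional Brownian motion with respect to $\{\mathcal F_t\}$ with correlation matrix $\Omega=(\Omega_{jk})$, i.e. for $s<t$ the increment $w(t)-w(s)$ is independent of $\mathcal F_s$ and is centred Gaussian with covariance matrix $(t-s)\Omega$, $\Omega_{jj}=1$. Let $x_0\in\mathbb{R}^d$ be deterministic, $f\in C^2(\mathbb{R}^d,\mathbb{R}^d)$, $g\in C^2(\mathbb{R}^d,\mathbb{R}^{d\times D})$ (the drift and diffusion coefficients of the SDE $\mathrm{d}x(t)=f(x(t))\,\mathrm{d}t+g(x(t))\,\mathrm{d}w(t)$, $x(0)=x_0$). Put $$h_{ijk}(x)=\tfrac12\sum_{l=1}^d g_{lk}(x)\frac{\partial g_{ij}}{\partial x_l}(x),\quad 1\le i\le d,\ 1\le j,k\le D.$$ Assumption (R): there is a constant bounding, uniformly over $\mathbb{R}^d$ and over all indices, the absolute values of all first partial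 derivatives of all $f_i$, $g_{ij}$, $h_{ijk}$ and all second partial derivatives of all $f_i$, $g_{ij}$. For an integer $N\ge1$ let $\Delta t=T/N$, $t_n=n\Delta t$, $t_{n+1/2}=(n+\tfrac12)\Delta t$, $\Delta w_n=w(t_{n+1})-w(t_n)$, $\delta w_n=w(t_{n+1/2})-w(t_n)$, $\delta w_{n+1/2}=w(t_{n+1})-w(t_{n+1/2})$. For a state $X\in\mathbb{R}^d$, a step $\tau>0$ and an increment $v\in\mathbb{R}^D$ define $\Phi(X,\tau,v)\in\mathbb{R}^d$ by $$\Phi_i(X,\tau,v)=X_i+f_i(X)\tau+\sum_{j=1}^D g_{ij}(X)v_j+\sum_{j,k=1}^D h_{ijk}(X)\,(v_jv_k-\Omega_{jk}\tau).$$ Coarse path: $X^c_0=x_0$, $X^c_{n+1}=\Phi(X^c_n,\Delta t,\Delta w_n)$. Fine path: $X^f_0=x_0$, $X^f_{n+1/2}=\Phi(X^f_n,\Delta t/2,\delta w_n)$, $X^f_{n+1}=\Phi(X^f_{n+1/2},\Delta t/2,\delta w_{n+1/2})$. Antithetic path: $X^a_0=x_0$, $X^a_{n+1/2}=\Phi(X^a_n,\Delta t/2,\delta w_{n+1/2})$, $X^a_{n+1}=\Phi(X^a_{n+1/2},\Delta t/2,\delta w_n)$. Here $0\le n\le N-1$. Averages (time averages of piecewise linear interpolants): $$X^c_{\mathrm{ave}}=\frac1N\sum_{n=0}^{N-1}\tfrac12(X^c_n+X^c_{n+1}),\qquad X^{f}_{\mathrm{ave}}=\frac1N\sum_{n=0}^{N-1}\tfrac14(X^{f}_n+2X^{f}_{n+1/2}+X^{f}_{n+1}),$$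 and $X^a_{\mathrm{ave}}$ is defined from $X^a$ by the same formula as $X^f_{\mathrm{ave}}$ from $X^f$. *)

theory Defs
  imports "HOL-Probability.Probability"
begin

definition partial :: "'d::finite \<Rightarrow> (real^'d \<Rightarrow> real) \<Rightarrow> real^'d \<Rightarrow> real" where
  "partial l u x = deriv (\<lambda>s. u (x + s *\<^sub>R axis l 1)) 0"

definition C1_fun :: "(real^'d::finite \<Rightarrow> real) \<Rightarrow> bool" where
  "C1_fun u \<longleftrightarrow> (\<forall>x. u differentiable (at x)) \<and> (\<forall>l. continuous_on UNIV (partial l u))"

definition C2_fun :: "(real^'d::finite \<Rightarrow> real) \<Rightarrow> bool" where
  "C2_fun u \<longleftrightarrow> C1_fun u \<and> (\<forall>l. C1_fun (partial l u))"

definition normal_law :: "real \<Rightarrow> real \<Rightarrow> real measure" where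
  "normal_law m v =
     (if v = 0 then return borel m else density lborel (\<lambda>x. ennreal (normal_density m (sqrt v) x)))"

text \<open>The covariance matrix may be singular, so a Gaussian vector is described by its
  one-dimensional projections and not by a density.\<close>

definition centred_gaussian :: "'a measure \<Rightarrow> ('a \<Rightarrow> real^'m::finite) \<Rightarrow> real^'m^'m \<Rightarrow> bool" where
  "centred_gaussian M X S \<longleftrightarrow>
     X \<in> borel_measurable M \<and> transpose S = S \<and>
     (\<forall>u. 0 \<le> u \<bullet> (S *v u) \<and> distr M borel (\<lambda>\<omega>. u \<bullet> X \<omega>) = normal_law 0 (u \<bullet> (S *v u)))"

text \<open>Time is \<open>[0, \<infinity>)\<close>; the values of \<open>F\<close> at negative arguments are irrelevant, which is
  why the library locale is instantiated with \<open>max 0 t\<close>. Completeness of the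
  underlying space is a separate hypothesis.\<close>

definition usual_filtration :: "'a measure \<Rightarrow> (real \<Rightarrow> 'a measure) \<Rightarrow> bool" where
  "usual_filtration M F \<longleftrightarrow>
     filtration (space M) (\<lambda>t. F (max 0 t)) \<and>
     (\<forall>t\<ge>0. sets (F t) \<subseteq> sets M) \<and>
     null_sets M \<subseteq> sets (F 0) \<and>
     (\<forall>t\<ge>0. (\<Inter>s\<in>{t<..}. sets (F s)) = sets (F t))"

text \<open>That \<open>R\<close> is symmetric and positive semidefinite is part of \<open>centred_gaussian\<close>,
  so together with the unit diagonal it is a correlation matrix.\<close>

definition correlated_brownian_motion ::
  "'a measure \<Rightarrow> (real \<Rightarrow> 'a measure) \<Rightarrow> real^'m^'m \<Rightarrow> (real \<Rightarrow> 'a \<Rightarrow> real^'m::finite) \<Rightarrow> bool" where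
  "correlated_brownian_motion M F R w \<longleftrightarrow>
     (\<forall>j. R $ j $ j = 1) \<and>
     (\<forall>t\<ge>0. w t \<in> borel_measurable (F t)) \<and>
     (AE \<omega> in M. w 0 \<omega> = 0) \<and>
     (AE \<omega> in M. continuous_on {0..} (\<lambda>t. w t \<omega>)) \<and>
     (\<forall>s t. 0 \<le> s \<and> s < t \<longrightarrow>
        prob_space.indep_set M (sets (F s))
          (sets (vimage_algebra (space M) (\<lambda>\<omega>. w t \<omega> - w s \<omega>) borel)) \<and>
        centred_gaussian M (\<lambda>\<omega>. w t \<omega> - w s \<omega>) ((t - s) *\<^sub>R R))"

definition h_coeff :: "(real^'d \<Rightarrow> real^'m^'d) \<Rightarrow> 'd::finite \<Rightarrow> 'm::finite \<Rightarrow> 'm \<Rightarrow> real^'d \<Rightarrow> real" where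
  "h_coeff g i j k x = 1/2 * (\<Sum>l\<in>UNIV. g x $ l $ k * partial l (\<lambda>y. g y $ i $ j) x)"

definition bounded_derivs_R :: "(real^'d \<Rightarrow> real^'d) \<Rightarrow> (real^'d::finite \<Rightarrow> real^'m::finite^'d) \<Rightarrow> bool" where
  "bounded_derivs_R f g \<longleftrightarrow> (\<exists>K. \<forall>x.
     (\<forall>i l. \<bar>partial l (\<lambda>y. f y $ i) x\<bar> \<le> K) \<and>
     (\<forall>i j l. \<bar>partial l (\<lambda>y. g y $ i $ j) x\<bar> \<le> K) \<and>
     (\<forall>i j k l. \<bar>partial l (h_coeff g i j k) x\<bar> \<le> K) \<and>
     (\<forall>i l m. \<bar>partial m (partial l (\<lambda>y. f y $ i)) x\<bar> \<le> K) \<and>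
     (\<forall>i j l m. \<bar>partial m (partial l (\<lambda>y. g y $ i $ j)) x\<bar> \<le> K))"

definition milstein_step ::
  "(real^'d \<Rightarrow> real^'d) \<Rightarrow> (real^'d \<Rightarrow> real^'m^'d) \<Rightarrow> real^'m^'m \<Rightarrow>
   real^'d::finite \<Rightarrow> real \<Rightarrow> real^'m::finite \<Rightarrow> real^'d" where
  "milstein_step f g R X \<tau> v = (\<chi> i.
     X $ i + f X $ i * \<tau> + (\<Sum>j\<in>UNIV. g X $ i $ j * v $ j)
     + (\<Sum>j\<in>UNIV. \<Sum>k\<in>UNIV. h_coeff g i j k X * (v $ j * v $ k - R $ j $ k * \<tau>)))"

text \<open>Here \<open>\<tau>\<close> is the coarse step size. The fine and the antithetic path
  are the same two-half-step recursion; they differ in the order of the two half-step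
  increments \<open>a n\<close> and \<open>b n\<close> only.\<close>

primrec coarse_path ::
  "(real^'d \<Rightarrow> real^'d) \<Rightarrow> (real^'d \<Rightarrow> real^'m^'d) \<Rightarrow> real^'m^'m \<Rightarrow> real^'d::finite \<Rightarrow> real \<Rightarrow>
   (nat \<Rightarrow> real^'m::finite) \<Rightarrow> nat \<Rightarrow> real^'d" where
  "coarse_path f g R x0 \<tau> v 0 = x0"
| "coarse_path f g R x0 \<tau> v (Suc n) = milstein_step f g R (coarse_path f g R x0 \<tau> v n) \<tau> (v n)"

primrec halved_path ::
  "(real^'d \<Rightarrow> real^'d) \<Rightarrow> (real^'d \<Rightarrow> real^'m^'d) \<Rightarrow> real^'m^'m \<Rightarrow> real^'d::finite \<Rightarrow> real \<Rightarrow>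
   (nat \<Rightarrow> real^'m::finite) \<Rightarrow> (nat \<Rightarrow> real^'m) \<Rightarrow> nat \<Rightarrow> real^'d" where
  "halved_path f g R x0 \<tau> a b 0 = x0"
| "halved_path f g R x0 \<tau> a b (Suc n) =
     milstein_step f g R
       (milstein_step f g R (halved_path f g R x0 \<tau> a b n) (\<tau>/2) (a n)) (\<tau>/2) (b n)"

definition halved_path_mid ::
  "(real^'d \<Rightarrow> real^'d) \<Rightarrow> (real^'d \<Rightarrow> real^'m^'d) \<Rightarrow> real^'m^'m \<Rightarrow> real^'d::finite \<Rightarrow> real \<Rightarrow>
   (nat \<Rightarrow> real^'m::finite) \<Rightarrow> (nat \<Rightarrow> real^'m) \<Rightarrow> nat \<Rightarrow> real^'d" where
  "halved_path_mid f g R x0 \<tau> a b n = milstein_step f g R (halved_path f g R x0 \<tau> a b n) (\<tau>/2) (a n)"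

definition coarse_ave :: "nat \<Rightarrow> (nat \<Rightarrow> real^'d::finite) \<Rightarrow> real^'d" where
  "coarse_ave N X = (1 / real N) *\<^sub>R (\<Sum>n<N. (1/2) *\<^sub>R (X n + X (Suc n)))"

text \<open>\<open>Y n\<close> is the state at the midpoint of the \<open>n\<close>-th coarse step.\<close>

definition halved_ave :: "nat \<Rightarrow> (nat \<Rightarrow> real^'d::finite) \<Rightarrow> (nat \<Rightarrow> real^'d) \<Rightarrow> real^'d" where
  "halved_ave N X Y = (1 / real N) *\<^sub>R (\<Sum>n<N. (1/4) *\<^sub>R (X n + 2 *\<^sub>R Y n + X (Suc n)))"

definition coarse_incr :: "real \<Rightarrow> nat \<Rightarrow> (real \<Rightarrow> 'a \<Rightarrow> real^'m::finite) \<Rightarrow> 'a \<Rightarrow> nat \<Rightarrow> real^'m" where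
  "coarse_incr T N w \<omega> n = w (real (Suc n) * (T / real N)) \<omega> - w (real n * (T / real N)) \<omega>"

definition first_half_incr :: "real \<Rightarrow> nat \<Rightarrow> (real \<Rightarrow> 'a \<Rightarrow> real^'m::finite) \<Rightarrow> 'a \<Rightarrow> nat \<Rightarrow> real^'m" where
  "first_half_incr T N w \<omega> n = w ((real n + 1/2) * (T / real N)) \<omega> - w (real n * (T / real N)) \<omega>"

definition second_half_incr :: "real \<Rightarrow> nat \<Rightarrow> (real \<Rightarrow> 'a \<Rightarrow> real^'m::finite) \<Rightarrow> 'a \<Rightarrow> nat \<Rightarrow> real^'m" where
  "second_half_incr T N w \<omega> n =
     w (real (Suc n) * (T / real N)) \<omega> - w ((real n + 1/2) * (T / real N)) \<omega>"

definition Xc_ave ::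
  "(real^'d \<Rightarrow> real^'d) \<Rightarrow> (real^'d \<Rightarrow> real^'m^'d) \<Rightarrow> real^'m^'m \<Rightarrow> real^'d::finite \<Rightarrow> real \<Rightarrow> nat \<Rightarrow>
   (real \<Rightarrow> 'a \<Rightarrow> real^'m::finite) \<Rightarrow> 'a \<Rightarrow> real^'d" where
  "Xc_ave f g R x0 T N w \<omega> = coarse_ave N (coarse_path f g R x0 (T / real N) (coarse_incr T N w \<omega>))"

definition Xf_ave ::
  "(real^'d \<Rightarrow> real^'d) \<Rightarrow> (real^'d \<Rightarrow> real^'m^'d) \<Rightarrow> real^'m^'m \<Rightarrow> real^'d::finite \<Rightarrow> real \<Rightarrow> nat \<Rightarrow>
   (real \<Rightarrow> 'a \<Rightarrow> real^'m::finite) \<Rightarrow> 'a \<Rightarrow> real^'d" where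
  "Xf_ave f g R x0 T N w \<omega> =
     (let a = first_half_incr T N w \<omega>; b = second_half_incr T N w \<omega>; \<tau> = T / real N
      in halved_ave N (halved_path f g R x0 \<tau> a b) (halved_path_mid f g R x0 \<tau> a b))"

definition Xa_ave ::
  "(real^'d \<Rightarrow> real^'d) \<Rightarrow> (real^'d \<Rightarrow> real^'m^'d) \<Rightarrow> real^'m^'m \<Rightarrow> real^'d::finite \<Rightarrow> real \<Rightarrow> nat \<Rightarrow>
   (real \<Rightarrow> 'a \<Rightarrow> real^'m::finite) \<Rightarrow> 'a \<Rightarrow> real^'d" where
  "Xa_ave f g R x0 T N w \<omega> =
     (let a = second_half_incr T N w \<omega>; b = first_half_incr T N w \<omega>; \<tau> = T / real N
      in halved_ave N (halved_path f g R x0 \<tau> a b) (halved_path_mid f g R x0 \<tau> a b))"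

definition antithetic_correction ::
  "(real^'d \<Rightarrow> real) \<Rightarrow> (real^'d \<Rightarrow> real^'d) \<Rightarrow> (real^'d \<Rightarrow> real^'m^'d) \<Rightarrow> real^'m^'m \<Rightarrow>
   real^'d::finite \<Rightarrow> real \<Rightarrow> nat \<Rightarrow> (real \<Rightarrow> 'a \<Rightarrow> real^'m::finite) \<Rightarrow> 'a \<Rightarrow> real" where
  "antithetic_correction P f g R x0 T N w \<omega> =
     1/2 * (P (Xf_ave f g R x0 T N w \<omega>) + P (Xa_ave f g R x0 T N w \<omega>))
     - P (Xc_ave f g R x0 T N w \<omega>)"

end

theory Submission
  imports Defs
begin

text \<open>The variance is at most the second moment, and Taylor expansion of \<open>P\<close> at the mean of the fine and
  antithetic averages reduces this to the fourth moment of \<open>X\<^sup>f - X\<^sup>a\<close> and the second moment of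
  \<open>(X\<^sup>f + X\<^sup>a) / 2 - X\<^sup>c\<close>, both of which must be of order \<open>\<Delta>t\<^sup>2\<close>. With \<open>\<epsilon>\<^sup>2 = \<Delta>t\<close>, the function
  \<open>1 + |X\<^sup>f|\<^sup>4 + |X\<^sup>a|\<^sup>4 + |X\<^sup>f - X\<^sup>a|\<^sup>4 / \<epsilon>\<^sup>4 + |(X\<^sup>f + X\<^sup>a) / 2 - X\<^sup>c|\<^sup>2 / \<epsilon>\<^sup>4\<close>
  is a Lyapunov function of the coupled Markov chain: one step multiplies its conditional expectation by at most
  \<open>1 + C \<epsilon>\<^sup>2\<close>, so its expectation stays bounded up to time \<open>T\<close>. To see this, write each increment of the three
  quantities as a drift of relative size \<open>\<epsilon>\<^sup>2\<close> plus a centred fluctuation of relative size \<open>\<epsilon>\<close>; the Levy-area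
  terms have opposite signs in the fine and the antithetic path and cancel in the mean. All estimates of
  this kind are products of powers of \<open>\<epsilon>\<close>, of the fourth root \<open>ell\<close> of the Lyapunov function and of a random
  variable \<open>theta\<close> with bounded moments. Expectations are taken over one pair of half-step increments with the
  states held fixed.\<close>

subsection \<open>Functions with bounded partial derivatives\<close>

text \<open>The obstacle is that the scheme omits the Levy areas: each refined path is close to the
  coarse one only to order e = sqrt(dt), which alone would give a variance of order dt. Order e^2
  holds only for the mean of the two refined paths. The estimates close because all quantities share
  one homogeneity. A difference of fine and antithetic states of size \<open>e * ell\<close> enters
  the mean through quadratic Taylor remainders, hence as \<open>e ^ 2 * ell ^ 2\<close>; so the
  fourth power of the one is paired with the square of the other, and no state moment beyond the
  fourth is used, whereas the noise needs moments of every order. The two error terms need different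
  care. For the difference, a fluctuation of order e^2 is enough and follows from the triangle
  inequality. For the mean it must be of order e^3, which forces a second-order expansion of the
  fine step; there the definition of \<open>h_coeff\<close> through derivatives of \<open>g\<close>
  makes the Levy area appear explicitly. Time averages need no maximal inequality: Jensen reduces
  them to moments of single steps.\<close>

lemma has_derivative_partial:
  fixes u :: "real^'d::finite \<Rightarrow> real"
  assumes "u differentiable (at x)"
  shows "(u has_derivative (\<lambda>h. \<Sum>l\<in>UNIV. h $ l * partial l u x)) (at x)"
proof -
  obtain D where D: "(u has_derivative D) (at x)"
    using assms unfolding differentiable_def by blast
  interpret D: bounded_linear D using D by (rule has_derivative_bounded_linear)
  have partial_eq: "partial l u x = D (axis l 1)" for l
  proof -
    have "((\<lambda>s. u (x + s *\<^sub>R axis l 1)) has_derivative (\<lambda>s. D (s *\<^sub>R axis l 1))) (at 0)"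
      by (rule has_derivative_compose[of "\<lambda>s. x + s *\<^sub>R axis l 1" "\<lambda>s. s *\<^sub>R axis l 1" 0 UNIV u D])
        (auto intro!: derivative_eq_intros D)
    then have "((\<lambda>s. u (x + s *\<^sub>R axis l 1)) has_real_derivative D (axis l 1)) (at 0)"
      unfolding has_field_derivative_def
      by (rule has_derivative_eq_rhs) (simp add: fun_eq_iff D.scaleR)
    then show ?thesis
      unfolding partial_def by (rule DERIV_imp_deriv)
  qed
  have "D h = (\<Sum>l\<in>UNIV. h $ l * partial l u x)" for h
  proof -
    have "D h = D (\<Sum>l\<in>UNIV. (h $ l) *\<^sub>R axis l 1)"
      using basis_expansion[of h] by (simp add: scalar_mult_eq_scaleR)
    then show ?thesis
      by (simp add: D.sum D.scaleR partial_eq)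
  qed
  then have "D = (\<lambda>h. \<Sum>l\<in>UNIV. h $ l * partial l u x)"
    by auto
  with D show ?thesis by simp
qed

definition lipschitz_fun :: "(real^'d::finite \<Rightarrow> real) \<Rightarrow> bool" where
  "lipschitz_fun u \<longleftrightarrow> (\<exists>L\<ge>0. \<forall>x y. \<bar>u x - u y\<bar> \<le> L * norm (x - y))"

lemma onorm_partial_sum:
  fixes c :: "'d::finite \<Rightarrow> real"
  assumes "\<And>l. \<bar>c l\<bar> \<le> K"
  shows "onorm (\<lambda>h::real^'d. \<Sum>l\<in>UNIV. h $ l * c l) \<le> real CARD('d) * K"
proof (rule onorm_le)
  fix h :: "real^'d"
  have "norm (\<Sum>l\<in>UNIV. h $ l * c l) \<le> (\<Sum>l\<in>(UNIV :: 'd set). norm h * K)"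
    by (rule sum_norm_le) (auto simp: abs_mult component_le_norm_cart assms intro!: mult_mono)
  then show "norm (\<Sum>l\<in>UNIV. h $ l * c l) \<le> real CARD('d) * K * norm h"
    by (simp add: mult_ac)
qed

lemma lipschitz_fun_bounded_partials:
  fixes u :: "real^'d::finite \<Rightarrow> real"
  assumes "\<And>x. u differentiable (at x)" "\<And>x l. \<bar>partial l u x\<bar> \<le> K"
  shows "lipschitz_fun u"
proof -
  have "norm (u x - u y) \<le> real CARD('d) * K * norm (x - y)" for x y
    by (rule differentiable_bound[where S = UNIV])
      (auto intro: has_derivative_partial assms onorm_partial_sum)
  moreover have "0 \<le> K"
    using assms(2) abs_ge_zero order_trans by blast
  ultimately show ?thesis
    unfolding lipschitz_fun_def by (intro exI[of _ "real CARD('d) * K"]) auto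
qed

definition taylor_fun :: "(real^'d::finite \<Rightarrow> real) \<Rightarrow> bool" where
  "taylor_fun u \<longleftrightarrow> (\<exists>L\<ge>0. \<forall>x y.
     \<bar>u y - u x - (\<Sum>l\<in>UNIV. partial l u x * (y $ l - x $ l))\<bar> \<le> L * (norm (y - x))\<^sup>2)"

lemma taylor_fun_bounded_partials:
  fixes u :: "real^'d::finite \<Rightarrow> real"
  assumes u: "\<And>x. u differentiable (at x)"
    and lip: "\<And>l. lipschitz_fun (partial l u)"
  shows "taylor_fun u"
proof -
  obtain L where L: "\<And>l. 0 \<le> L l" "\<And>l x y. \<bar>partial l u x - partial l u y\<bar> \<le> L l * norm (x - y)"
    using lip unfolding lipschitz_fun_def by metis
  \<comment> \<open>The sum dominates every \<open>L l\<close>, so one Lipschitz constant serves all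
    directions.\<close>
  define K where "K = (\<Sum>l\<in>UNIV. L l)"
  have "L l \<le> K" for l
    unfolding K_def by (rule member_le_sum) (auto simp: L)
  then have K: "\<bar>partial l u x - partial l u y\<bar> \<le> K * norm (x - y)" for l x y
    by (rule order_trans[OF L(2) mult_right_mono]) auto
  have K0: "0 \<le> K" unfolding K_def by (simp add: L sum_nonneg)
  have "\<bar>u y - u x - (\<Sum>l\<in>UNIV. partial l u x * (y $ l - x $ l))\<bar>
      \<le> real CARD('d) * K * (norm (y - x))\<^sup>2" for x y
  proof -
    let ?D = "\<lambda>x h. \<Sum>l\<in>UNIV. h $ l * partial l u x"
    have "norm (u y - u x - ?D x (y - x)) \<le> norm (y - x) * (real CARD('d) * (K * norm (y - x)))"
    \<comment> \<open>On the ball of radius \<open>norm (y - x)\<close> the derivative varies by at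
      most a multiple of that radius; this is the second factor of the quadratic remainder.\<close>
    proof (rule differentiable_bound_linearization[where S = "cball x (norm (y - x))" and f' = ?D])
      fix t :: real assume t: "t \<in> {0..1}"
      then show "x + t *\<^sub>R (y - x) \<in> cball x (norm (y - x))"
        by (auto simp: dist_norm intro!: mult_left_le_one_le)
    next
      fix z assume "z \<in> cball x (norm (y - x))"
      then have "norm (z - x) \<le> norm (y - x)"
        by (simp add: dist_norm norm_minus_commute)
      then have le: "\<bar>partial l u z - partial l u x\<bar> \<le> K * norm (y - x)" for l
        using K[of l z x] K0 by (meson mult_left_mono order_trans)
      have "(?D z - ?D x) = (\<lambda>h. \<Sum>l\<in>UNIV. h $ l * (partial l u z - partial l u x))"
        by (auto simp: fun_eq_iff sum_subtractf right_diff_distrib)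
      then show "onorm (?D z - ?D x) \<le> real CARD('d) * (K * norm (y - x))"
        using onorm_partial_sum[OF le] by simp
    qed (auto intro: has_derivative_at_withinI has_derivative_partial u)
    then show ?thesis
      by (simp add: power2_eq_square mult_ac)
  qed
  then show ?thesis
    unfolding taylor_fun_def using K0 by (intro exI[of _ "real CARD('d) * K"]) auto
qed

text \<open>In the expansion around the midpoint the linear terms cancel, since the two
  displacements are opposite. It is applied to the coefficients along the paths and to the payoff at
  the averages.\<close>

lemma taylor_fun_midpoint:
  fixes u :: "real^'d::finite \<Rightarrow> real"
  assumes "taylor_fun u"
  shows "\<exists>L\<ge>0. \<forall>p q. \<bar>(u p + u q) / 2 - u ((1/2) *\<^sub>R (p + q))\<bar> \<le> L * (norm (p - q))\<^sup>2"
proof -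
  obtain L where L: "L \<ge> 0" "\<And>x y. \<bar>u y - u x - (\<Sum>l\<in>UNIV. partial l u x * (y $ l - x $ l))\<bar>
      \<le> L * (norm (y - x))\<^sup>2"
    using assms unfolding taylor_fun_def by blast
  have "\<bar>(u p + u q) / 2 - u ((1/2) *\<^sub>R (p + q))\<bar> \<le> L * (norm (p - q))\<^sup>2" for p q
  proof -
    let ?m = "(1/2) *\<^sub>R (p + q)"
    let ?s = "\<lambda>y. \<Sum>l\<in>UNIV. partial l u ?m * (y $ l - ?m $ l)"
    have s: "?s p + ?s q = 0"
      by (simp add: sum.distrib[symmetric] algebra_simps)
    have n: "p - ?m = (1/2) *\<^sub>R (p - q)" "q - ?m = - ((1/2) *\<^sub>R (p - q))"
      by (simp_all add: vec_eq_iff field_simps)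
    have "(norm (p - ?m))\<^sup>2 = (norm (p - q))\<^sup>2 / 4" "(norm (q - ?m))\<^sup>2 = (norm (p - q))\<^sup>2 / 4"
      unfolding n by (simp_all add: power_divide norm_minus_commute)
    then have "\<bar>u p - u ?m - ?s p\<bar> \<le> L * ((norm (p - q))\<^sup>2 / 4)"
      "\<bar>u q - u ?m - ?s q\<bar> \<le> L * ((norm (p - q))\<^sup>2 / 4)"
      using L(2)[where x = ?m and y = p] L(2)[where x = ?m and y = q] by presburger+
    moreover have "(u p + u q) / 2 - u ?m = (u p - u ?m - ?s p) / 2 + (u q - u ?m - ?s q) / 2"
      using s by (simp add: field_simps)
    moreover have "0 \<le> L * (norm (p - q))\<^sup>2"
      using L(1) by simp
    moreover have "\<bar>A / 2 + B / 2\<bar> \<le> L * r" if "\<bar>A\<bar> \<le> L * (r / 4)" "\<bar>B\<bar> \<le> L * (r / 4)" "0 \<le> L * r"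
      for A B r :: real
      using that unfolding abs_le_iff times_divide_eq_right by linarith
    ultimately show ?thesis by presburger
  qed
  then show ?thesis using L(1) by blast
qed

lemma C2_fun_differentiable:
  assumes "C2_fun u"
  shows "u differentiable (at x)" "partial l u differentiable (at x)"
  using assms unfolding C2_fun_def C1_fun_def by auto

lemma lipschitz_fun_continuous: "lipschitz_fun u \<Longrightarrow> continuous_on UNIV u"
proof -
  assume "lipschitz_fun u"
  then obtain L where L: "L \<ge> 0" "\<And>x y. \<bar>u x - u y\<bar> \<le> L * norm (x - y)"
    unfolding lipschitz_fun_def by blast
  have "L-lipschitz_on UNIV u"
    by (rule lipschitz_onI) (use L in \<open>auto simp: dist_norm\<close>)
  then show ?thesis
    by (rule lipschitz_on_continuous_on)
qed

text \<open>Every summand is at most the largest one, whose \<open>r\<close>-th power already occurs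
  on the right.\<close>

lemma power_sum_le:
  fixes x :: "'b \<Rightarrow> real"
  assumes "finite A" "A \<noteq> {}" "\<And>i. i \<in> A \<Longrightarrow> 0 \<le> x i"
  shows "(\<Sum>i\<in>A. x i) ^ r \<le> real (card A) ^ r * (\<Sum>i\<in>A. x i ^ r)"
proof -
  let ?m = "Max (x ` A)"
  have m: "?m \<in> x ` A" using assms by (intro Max_in) auto
  then obtain j where j: "j \<in> A" "?m = x j" by auto
  have "(\<Sum>i\<in>A. x i) \<le> real (card A) * x j"
    using assms by (intro sum_bounded_above) (auto simp flip: j(2))
  then have "(\<Sum>i\<in>A. x i) ^ r \<le> (real (card A) * x j) ^ r"
    by (intro power_mono) (auto intro: sum_nonneg assms)
  also have "\<dots> \<le> real (card A) ^ r * (\<Sum>i\<in>A. x i ^ r)"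
    unfolding power_mult_distrib using assms j
    by (intro mult_left_mono member_le_sum[of j A "\<lambda>i. x i ^ r"]) auto
  finally show ?thesis .
qed

subsection \<open>Gaussian increments\<close>

text \<open>The Dirac case \<open>v = 0\<close> has to be included: the sum of two coordinates with
  correlation -1 has variance zero, and such sums are used to compute the covariances.\<close>

lemma normal_law_moments:
  assumes "0 \<le> v"
  shows "has_bochner_integral (normal_law 0 v) (\<lambda>x. x) 0"
    and "has_bochner_integral (normal_law 0 v) (\<lambda>x. x\<^sup>2) v"
proof -
  have *: "has_bochner_integral (normal_law 0 v) (\<lambda>x. x) 0 \<and>
      has_bochner_integral (normal_law 0 v) (\<lambda>x. x\<^sup>2) v"
  proof (cases "v = 0")
    case True
    interpret prob_space "return borel (0::real)" by (rule prob_space_return) simp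
    show ?thesis
      using True unfolding normal_law_def has_bochner_integral_iff
      by (auto simp: integral_return AE_return intro!: integrable_const_bound[where B = 0])
  next
    case False
    then have v: "0 < v" using assms by simp
    have "has_bochner_integral (density lborel (\<lambda>x. ennreal (normal_density 0 (sqrt v) x))) (\<lambda>x. x) 0"
      using normal_moment_nz_1[of "sqrt v" 0] v by (intro has_bochner_integral_density) auto
    moreover have "has_bochner_integral (density lborel (\<lambda>x. ennreal (normal_density 0 (sqrt v) x))) (\<lambda>x. x\<^sup>2) v"
      using normal_moment_even[of "sqrt v" 0 1] v by (intro has_bochner_integral_density) auto
    ultimately show ?thesis
      using False by (simp add: normal_law_def)
  qed
  show "has_bochner_integral (normal_law 0 v) (\<lambda>x. x) 0"
    and "has_bochner_integral (normal_law 0 v) (\<lambda>x. x\<^sup>2) v"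
    using * by auto
qed

lemma normal_law_even_moment:
  assumes "0 < v"
  shows "has_bochner_integral (normal_law 0 v) (\<lambda>x. x ^ (2 * r)) (fact (2 * r) / (2 ^ r * fact r) * v ^ r)"
proof -
  have "has_bochner_integral (density lborel (\<lambda>x. ennreal (normal_density 0 (sqrt v) x))) (\<lambda>x. x ^ (2 * r))
      (fact (2 * r) / ((2 / (sqrt v)\<^sup>2) ^ r * fact r))"
    using normal_moment_even[of "sqrt v" 0 r] assms by (intro has_bochner_integral_density) auto
  then show ?thesis
    using assms by (simp add: normal_law_def power_divide field_simps)
qed

text \<open>An interface to a centred Gaussian vector with covariance \<open>s *\<^sub>R R\<close>:
  first and second moments exactly, and bounds on even coordinate moments with the correct scaling
  in \<open>s\<close>.\<close>

definition noise_law :: "real^'m^'m \<Rightarrow> real \<Rightarrow> (real^'m::finite) measure \<Rightarrow> bool" where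
  "noise_law R s \<mu> \<longleftrightarrow> prob_space \<mu> \<and> sets \<mu> = sets borel \<and>
     (\<forall>j. has_bochner_integral \<mu> (\<lambda>v. v $ j) 0) \<and>
     (\<forall>j k. has_bochner_integral \<mu> (\<lambda>v. v $ j * v $ k) (R $ j $ k * s)) \<and>
     (\<forall>j r. integrable \<mu> (\<lambda>v. (v $ j) ^ (2 * r)) \<and> (\<integral>v. (v $ j) ^ (2 * r) \<partial>\<mu>) \<le> fact (2 * r) * s ^ r)"

lemma noise_law_centred_gaussian:
  fixes X :: "'a \<Rightarrow> real^'m::finite"
  assumes "prob_space M" and G: "centred_gaussian M X (s *\<^sub>R R)"
    and diag: "\<And>j. R $ j $ j = 1" and s: "0 < s"
  shows "noise_law R s (distr M borel X)"
proof -
  interpret prob_space M by fact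
  have X[measurable]: "X \<in> borel_measurable M" and sym: "transpose (s *\<^sub>R R) = s *\<^sub>R R"
    and law: "\<And>u. 0 \<le> u \<bullet> (s *\<^sub>R R *v u)"
      "\<And>u. distr M borel (\<lambda>\<omega>. u \<bullet> X \<omega>) = normal_law 0 (u \<bullet> (s *\<^sub>R R *v u))"
    using G unfolding centred_gaussian_def by auto
  have symR: "R $ k $ j = R $ j $ k" for j k
  proof -
    have "transpose (s *\<^sub>R R) $ j $ k = (s *\<^sub>R R) $ j $ k" by (simp only: sym)
    then show ?thesis using s by (simp add: transpose_def)
  qed
  have quad: "axis j 1 \<bullet> (s *\<^sub>R R *v axis k 1) = s * R $ j $ k" for j k
    by (simp add: matrix_vector_mult_basis column_def inner_axis')
  have mom: "has_bochner_integral M (\<lambda>\<omega>. \<phi> (u \<bullet> X \<omega>)) x"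
    if "has_bochner_integral (normal_law 0 (u \<bullet> (s *\<^sub>R R *v u))) \<phi> x" and [measurable]: "\<phi> \<in> borel_measurable borel"
    for u and \<phi> :: "real \<Rightarrow> real" and x
    using that(1) unfolding law(2)[symmetric] has_bochner_integral_iff
    by (simp add: integrable_distr_eq integral_distr)
  have [simp]: "axis j 1 \<bullet> v = v $ j" for v :: "real^'m" and j
    by (simp add: inner_axis')
  have m1: "has_bochner_integral M (\<lambda>\<omega>. X \<omega> $ j) 0" for j
    using mom[OF normal_law_moments(1)[OF law(1)], of "axis j 1"] by simp
  have m2: "has_bochner_integral M (\<lambda>\<omega>. (X \<omega> $ j)\<^sup>2) s" for j
    using mom[OF normal_law_moments(2)[OF law(1)], of "axis j 1"] unfolding quad by (simp add: diag)
  have m3: "has_bochner_integral M (\<lambda>\<omega>. (X \<omega> $ j + X \<omega> $ k)\<^sup>2) (2 * s + 2 * s * R $ j $ k)" for j k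
  proof -
    have "(axis j 1 + axis k 1) \<bullet> (s *\<^sub>R R *v (axis j 1 + axis k 1)) = 2 * s + 2 * s * R $ j $ k"
      unfolding matrix_vector_right_distrib inner_add_left inner_add_right quad
      by (simp add: diag symR)
    then show ?thesis
      using mom[OF normal_law_moments(2)[OF law(1)], of "axis j 1 + axis k 1"]
      by (simp add: inner_add_left)
  qed
  \<comment> \<open>Polarisation: only one-dimensional projections are known to be Gaussian, so the
    product is obtained from the square of a sum.\<close>
  have m4: "has_bochner_integral M (\<lambda>\<omega>. X \<omega> $ j * X \<omega> $ k) (R $ j $ k * s)" for j k
  proof -
    have "has_bochner_integral M (\<lambda>\<omega>. ((X \<omega> $ j + X \<omega> $ k)\<^sup>2 - (X \<omega> $ j)\<^sup>2 - (X \<omega> $ k)\<^sup>2) / 2)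
        (((2 * s + 2 * s * R $ j $ k) - s - s) / 2)"
      by (intro has_bochner_integral_divide_zero has_bochner_integral_diff m2 m3)
    then show ?thesis
      by (simp add: power2_sum mult.commute)
  qed
  have m5: "has_bochner_integral M (\<lambda>\<omega>. (X \<omega> $ j) ^ (2 * r)) (fact (2 * r) / (2 ^ r * fact r) * s ^ r)" for j r
    using mom[of "axis j 1", OF normal_law_even_moment] s unfolding quad by (simp add: diag)
  \<comment> \<open>The exact Gaussian moment has the denominator
    \<open>2 ^ r * fact r \<ge> 1\<close>, which is dropped.\<close>
  have le: "fact (2 * r) / (2 ^ r * fact r) * s ^ r \<le> fact (2 * r) * s ^ r" for r
  proof -
    have "1 * 1 \<le> (2 ^ r * fact r :: real)"
      by (intro mult_mono) (auto simp: fact_ge_1)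
    then have "fact (2 * r) / (2 ^ r * fact r) \<le> (fact (2 * r) / 1 :: real)"
      by (intro divide_left_mono) auto
    then show ?thesis
      using s by (intro mult_right_mono) auto
  qed
  show ?thesis
    unfolding noise_law_def
  proof (intro conjI allI)
    show "prob_space (distr M borel X)" by (rule prob_space_distr) simp
  next
    fix j r
    have "has_bochner_integral (distr M borel X) (\<lambda>v. (v $ j) ^ (2 * r)) (fact (2 * r) / (2 ^ r * fact r) * s ^ r)"
      using m5 by (subst has_bochner_integral_distr) auto
    then show "integrable (distr M borel X) (\<lambda>v. (v $ j) ^ (2 * r))"
      "(\<integral>v. (v $ j) ^ (2 * r) \<partial>distr M borel X) \<le> fact (2 * r) * s ^ r"
      using le[of r] by (auto simp: has_bochner_integral_iff)
  qed (use m1 m4 in \<open>auto simp: has_bochner_integral_distr\<close>)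
qed

lemma has_bochner_integral_pair_mult:
  fixes \<phi> :: "'b \<Rightarrow> real" and \<psi> :: "'c \<Rightarrow> real"
  assumes "sigma_finite_measure M1" "sigma_finite_measure M2"
    and \<phi>: "has_bochner_integral M1 \<phi> x" and \<psi>: "has_bochner_integral M2 \<psi> y"
  shows "has_bochner_integral (M1 \<Otimes>\<^sub>M M2) (\<lambda>p. \<phi> (fst p) * \<psi> (snd p)) (x * y)"
proof -
  interpret pair_sigma_finite M1 M2 using assms(1,2) by (rule pair_sigma_finite.intro)
  have [measurable]: "\<phi> \<in> borel_measurable M1" "\<psi> \<in> borel_measurable M2"
    using \<phi> \<psi> by (auto dest: borel_measurable_has_bochner_integral)
  have i: "integrable M1 \<phi>" "integrable M2 \<psi>" "integral\<^sup>L M1 \<phi> = x" "integral\<^sup>L M2 \<psi> = y"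
    using \<phi> \<psi> by (auto simp: has_bochner_integral_iff)
  have I: "integrable (M1 \<Otimes>\<^sub>M M2) (\<lambda>p. \<phi> (fst p) * \<psi> (snd p))"
    by (rule Fubini_integrable) (auto simp: i abs_mult)
  show ?thesis
    using integral_fst'[OF I] I by (simp add: has_bochner_integral_iff i)
qed

lemma power_three_sum_le: "0 \<le> x \<Longrightarrow> 0 \<le> y \<Longrightarrow> (1 + x + y) ^ r \<le> 3 ^ r * (1 + x ^ r + y ^ r)" for x y :: real
  using power_sum_le[of "{0, 1, 2::nat}" "\<lambda>i. if i = 0 then 1 else if i = 1 then x else y" r]
  by (simp add: add.assoc)

text \<open>Reduces arbitrary powers of absolute values to the even powers that
  \<open>noise_law\<close> controls.\<close>

lemma power_le_one_plus_square: "0 \<le> x \<Longrightarrow> x ^ r \<le> 1 + x ^ (2 * r)" for x :: real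
proof (cases "x \<le> 1")
  case True
  assume "0 \<le> x"
  then show ?thesis using power_le_one[of x r] True by (simp add: add_increasing2)
next
  case False
  then show ?thesis using power_increasing[of r "2 * r" x] by (simp add: add_increasing)
qed

text \<open>Division by \<open>e\<close>, the square root of the step size, makes the moments
  independent of the step; the summand 1 makes powers of \<open>theta\<close> increase with the
  exponent.\<close>

definition theta :: "real \<Rightarrow> (real^'m::finite) \<times> (real^'m) \<Rightarrow> real" where
  "theta e v = 1 + (\<Sum>j\<in>UNIV. \<bar>fst v $ j\<bar> / e) + (\<Sum>j\<in>UNIV. \<bar>snd v $ j\<bar> / e)"

text \<open>A half step has length \<open>e\<^sup>2 / 2\<close>. The two marginals may differ, and
  the class is closed under exchanging them, as \<open>centred_swap\<close> requires.\<close>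

definition noise_pair :: "real^'m^'m \<Rightarrow> real \<Rightarrow> ((real^'m::finite) \<times> (real^'m)) measure \<Rightarrow> bool" where
  "noise_pair R e Q \<longleftrightarrow> (\<exists>\<mu> \<nu>. noise_law R (e\<^sup>2 / 2) \<mu> \<and> noise_law R (e\<^sup>2 / 2) \<nu> \<and> Q = \<mu> \<Otimes>\<^sub>M \<nu>)"

lemma noise_pair_has_bochner_integral:
  assumes "noise_law R s \<mu>" "noise_law R s \<nu>" "has_bochner_integral \<mu> \<phi> x"
  shows "has_bochner_integral (\<mu> \<Otimes>\<^sub>M \<nu>) (\<lambda>p. \<phi> (fst p) :: real) x"
    and "has_bochner_integral (\<nu> \<Otimes>\<^sub>M \<mu>) (\<lambda>p. \<phi> (snd p) :: real) x"
proof -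
  interpret m: prob_space \<mu> using assms by (auto simp: noise_law_def)
  interpret n: prob_space \<nu> using assms by (auto simp: noise_law_def)
  have 1: "has_bochner_integral \<nu> (\<lambda>_. 1::real) 1"
    by (simp add: has_bochner_integral_iff n.prob_space)
  show "has_bochner_integral (\<mu> \<Otimes>\<^sub>M \<nu>) (\<lambda>p. \<phi> (fst p) :: real) x"
    using has_bochner_integral_pair_mult[OF m.sigma_finite_measure_axioms n.sigma_finite_measure_axioms assms(3) 1]
    by simp
  show "has_bochner_integral (\<nu> \<Otimes>\<^sub>M \<mu>) (\<lambda>p. \<phi> (snd p) :: real) x"
    using has_bochner_integral_pair_mult[OF n.sigma_finite_measure_axioms m.sigma_finite_measure_axioms 1 assms(3)]
    by simp
qed

lemma noise_pair_prob_space: "noise_pair R e Q \<Longrightarrow> prob_space Q"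
  unfolding noise_pair_def noise_law_def
  by (auto intro!: prob_space_pair)

lemma noise_pair_sets: "noise_pair R e Q \<Longrightarrow> sets Q = sets borel"
  unfolding noise_pair_def noise_law_def
  by (auto simp: borel_prod[symmetric] intro: sets_pair_measure_cong)

text \<open>Since the coordinates have variance \<open>e\<^sup>2 / 2\<close>, the even moments of
  the coordinates divided by \<open>e\<close> are bounded by \<open>fact (2 * r)\<close> for every
  \<open>e\<close>. The constant therefore depends only on \<open>r\<close> and the dimension of the
  noise.\<close>

lemma noise_pair_theta_moment:
  "\<exists>C. \<forall>e Q. 0 < e \<longrightarrow> noise_pair (R::real^'m^'m) e Q \<longrightarrow>
     integrable Q (\<lambda>v. theta e v ^ r) \<and> (\<integral>v. theta e v ^ r \<partial>Q) \<le> C"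
proof (intro exI allI impI)
  fix e :: real and Q :: "((real^'m) \<times> (real^'m)) measure"
  assume e: "0 < e" and Q: "noise_pair R e Q"
  let ?m = "real CARD('m)"
  let ?c = "?m * (1 + fact (2 * r))"
  interpret Q: prob_space Q using Q by (rule noise_pair_prob_space)
  obtain \<mu> \<nu> where \<mu>: "noise_law R (e\<^sup>2 / 2) \<mu>" and \<nu>: "noise_law R (e\<^sup>2 / 2) \<nu>" and Qeq: "Q = \<mu> \<Otimes>\<^sub>M \<nu>"
    using Q unfolding noise_pair_def by blast
  have mom: "integrable \<kappa> (\<lambda>v. (v $ j / e) ^ (2 * r))"
    "(\<integral>v. (v $ j / e) ^ (2 * r) \<partial>\<kappa>) \<le> fact (2 * r)"
    if "noise_law R (e\<^sup>2 / 2) \<kappa>" for \<kappa> j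
  proof -
    have i: "integrable \<kappa> (\<lambda>v. (v $ j) ^ (2 * r))"
      and b: "(\<integral>v. (v $ j) ^ (2 * r) \<partial>\<kappa>) \<le> fact (2 * r) * (e\<^sup>2 / 2) ^ r"
      using that unfolding noise_law_def by auto
    show "integrable \<kappa> (\<lambda>v. (v $ j / e) ^ (2 * r))"
      using i by (simp add: power_divide)
    have "(e\<^sup>2 / 2) ^ r \<le> e ^ (2 * r)"
      unfolding power_mult using e by (intro power_mono) auto
    then have "fact (2 * r) * (e\<^sup>2 / 2) ^ r \<le> fact (2 * r) * e ^ (2 * r)"
      by (intro mult_left_mono) auto
    then show "(\<integral>v. (v $ j / e) ^ (2 * r) \<partial>\<kappa>) \<le> fact (2 * r)"
      using order_trans[OF b] e by (simp add: power_divide pos_divide_le_eq)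
  qed
  let ?g = "\<lambda>v::real^'m. \<Sum>j\<in>UNIV. 1 + (v $ j / e) ^ (2 * r)"
  have g: "integrable \<kappa> ?g" "(\<integral>v. ?g v \<partial>\<kappa>) \<le> ?c" if "noise_law R (e\<^sup>2 / 2) \<kappa>" for \<kappa>
  proof -
    interpret k: prob_space \<kappa> using that by (simp add: noise_law_def)
    show "integrable \<kappa> ?g"
      using mom[OF that] by auto
    have "(\<integral>v. ?g v \<partial>\<kappa>) = (\<Sum>j\<in>UNIV. (\<integral>v. 1 + (v $ j / e) ^ (2 * r) \<partial>\<kappa>))"
      using mom[OF that] by (subst Bochner_Integration.integral_sum) auto
    also have "\<dots> = (\<Sum>j\<in>UNIV. 1 + (\<integral>v. (v $ j / e) ^ (2 * r) \<partial>\<kappa>))"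
      using mom[OF that] by (simp add: k.prob_space)
    also have "\<dots> \<le> (\<Sum>j\<in>(UNIV::'m set). 1 + fact (2 * r))"
      using mom[OF that] by (intro sum_mono add_left_mono) auto
    finally show "(\<integral>v. ?g v \<partial>\<kappa>) \<le> ?c" by simp
  qed
  have gl: "(\<Sum>j\<in>UNIV. \<bar>v $ j\<bar> / e) ^ r \<le> ?m ^ r * ?g v" for v
  proof -
    have "(\<Sum>j\<in>UNIV. \<bar>v $ j\<bar> / e) ^ r \<le> ?m ^ r * (\<Sum>j\<in>UNIV. (\<bar>v $ j\<bar> / e) ^ r)"
      using e by (intro power_sum_le) auto
    also have "\<dots> \<le> ?m ^ r * ?g v"
    proof (intro mult_left_mono sum_mono)
      fix j
      show "(\<bar>v $ j\<bar> / e) ^ r \<le> 1 + (v $ j / e) ^ (2 * r)"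
        using power_le_one_plus_square[of "\<bar>v $ j\<bar> / e" r] e by (simp add: power_divide power_mult)
    qed simp
    finally show ?thesis .
  qed
  \<comment> \<open>A majorant of \<open>theta e v ^ r\<close> that is a sum of functions of one
    half increment each, so its integral splits over the two marginals.\<close>
  let ?G = "\<lambda>v. 3 ^ r * (1 + ?m ^ r * ?g (fst v) + ?m ^ r * ?g (snd v))"
  have th: "theta e v ^ r \<le> ?G v" for v
  proof -
    have "theta e v ^ r \<le> 3 ^ r * (1 + (\<Sum>j\<in>UNIV. \<bar>fst v $ j\<bar> / e) ^ r + (\<Sum>j\<in>UNIV. \<bar>snd v $ j\<bar> / e) ^ r)"
      unfolding theta_def using e by (intro power_three_sum_le sum_nonneg) auto
    also have "\<dots> \<le> ?G v"
      by (intro mult_left_mono add_mono gl) auto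
    finally show ?thesis .
  qed
  have th0: "0 \<le> theta e v" for v
    unfolding theta_def using e by (intro add_nonneg_nonneg sum_nonneg) auto
  have gf: "has_bochner_integral Q (\<lambda>v. ?g (fst v)) (\<integral>v. ?g v \<partial>\<mu>)"
    unfolding Qeq by (rule noise_pair_has_bochner_integral(1)[OF \<mu> \<nu> has_bochner_integral_integrable[OF g(1)[OF \<mu>]]])
  have gs: "has_bochner_integral Q (\<lambda>v. ?g (snd v)) (\<integral>v. ?g v \<partial>\<nu>)"
    unfolding Qeq by (rule noise_pair_has_bochner_integral(2)[OF \<nu> \<mu> has_bochner_integral_integrable[OF g(1)[OF \<nu>]]])
  have 1: "has_bochner_integral Q (\<lambda>_. 1::real) 1"
    by (simp add: has_bochner_integral_iff Q.prob_space)
  have G: "has_bochner_integral Q ?G (3 ^ r * (1 + ?m ^ r * (\<integral>v. ?g v \<partial>\<mu>) + ?m ^ r * (\<integral>v. ?g v \<partial>\<nu>)))"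
    by (intro has_bochner_integral_mult_right has_bochner_integral_add gf gs 1)
  have "continuous_on UNIV (\<lambda>v::(real^'m) \<times> (real^'m). theta e v ^ r)"
    unfolding theta_def by (intro continuous_intros) (use e in auto)
  then have m: "(\<lambda>v. theta e v ^ r) \<in> borel_measurable Q"
    using noise_pair_sets[OF Q] borel_measurable_continuous_onI measurable_cong_sets by blast
  have I: "integrable Q (\<lambda>v. theta e v ^ r)"
  proof (rule Bochner_Integration.integrable_bound[rotated 2])
    have "norm (theta e v ^ r) \<le> norm (?G v)" for v
      unfolding real_norm_def abs_of_nonneg[OF zero_le_power[OF th0]]
      by (rule order_trans[OF th abs_ge_self])
    then show "AE v in Q. norm (theta e v ^ r) \<le> norm (?G v)"
      by blast
  qed (use G m in \<open>auto simp: has_bochner_integral_iff\<close>)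
  have "(\<integral>v. theta e v ^ r \<partial>Q) \<le> (\<integral>v. ?G v \<partial>Q)"
    using I G th by (intro integral_mono) (auto simp: has_bochner_integral_iff)
  also have "\<dots> \<le> 3 ^ r * (1 + ?m ^ r * ?c + ?m ^ r * ?c)"
    unfolding has_bochner_integral_integral_eq[OF G]
    using g(2)[OF \<mu>] g(2)[OF \<nu>] by (intro mult_left_mono add_mono) auto
  finally show "integrable Q (\<lambda>v. theta e v ^ r) \<and>
      (\<integral>v. theta e v ^ r \<partial>Q) \<le> 3 ^ r * (1 + ?m ^ r * ?c + ?m ^ r * ?c)"
    using I by simp
qed

subsection \<open>Orders of magnitude\<close>

text \<open>A configuration consists of the square root of the coarse step size, the states of the
  fine, antithetic and coarse paths, and the two half-step increments.\<close>

type_synonym 'd state = "(real^'d) \<times> (real^'d) \<times> (real^'d)"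
type_synonym ('d, 'm) config = "real \<times> 'd state \<times> (real^'m) \<times> (real^'m)"

abbreviation eps :: "('d::finite, 'm::finite) config \<Rightarrow> real" where "eps i \<equiv> fst i"
abbreviation xf :: "('d::finite, 'm::finite) config \<Rightarrow> real^'d" where "xf i \<equiv> fst (fst (snd i))"
abbreviation xa :: "('d::finite, 'm::finite) config \<Rightarrow> real^'d" where "xa i \<equiv> fst (snd (fst (snd i)))"
abbreviation xc :: "('d::finite, 'm::finite) config \<Rightarrow> real^'d" where "xc i \<equiv> snd (snd (fst (snd i)))"
abbreviation wa :: "('d::finite, 'm::finite) config \<Rightarrow> real^'m" where "wa i \<equiv> fst (snd (snd i))"
abbreviation wb :: "('d::finite, 'm::finite) config \<Rightarrow> real^'m" where "wb i \<equiv> snd (snd (snd i))"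

text \<open>The antithetic path is the fine path of the swapped configuration, so that estimates for it follow by
  symmetry.\<close>

definition swap :: "('d::finite, 'm::finite) config \<Rightarrow> ('d, 'm) config" where
  "swap i = (eps i, (xa i, xf i, xc i), (wb i, wa i))"

lemma swap_simps [simp]:
  "eps (swap i) = eps i" "xf (swap i) = xa i" "xa (swap i) = xf i" "xc (swap i) = xc i"
  "wa (swap i) = wb i" "wb (swap i) = wa i"
  by (simp_all add: swap_def)

text \<open>Coordinatewise powers replace norms so that moments can be estimated one coordinate at a
  time. The coarse state has no fourth power of its own: it is recovered from the refined states and
  the last term, at the price of \<open>ell ^ 2\<close> in \<open>ord_bound_xc\<close>.\<close>

definition lyap :: "real \<Rightarrow> 'd::finite state \<Rightarrow> real" where
  "lyap e S = 1 + (\<Sum>k\<in>UNIV. (fst S $ k) ^ 4) + (\<Sum>k\<in>UNIV. (fst (snd S) $ k) ^ 4)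
     + (\<Sum>k\<in>UNIV. (fst S $ k - fst (snd S) $ k) ^ 4) / e ^ 4
     + (\<Sum>k\<in>UNIV. ((fst S $ k + fst (snd S) $ k) / 2 - snd (snd S) $ k) ^ 2) / e ^ 4"

definition ell :: "real \<Rightarrow> 'd::finite state \<Rightarrow> real" where
  "ell e S = root 4 (lyap e S)"

lemma abs_le_of_power4_le: "\<bar>x\<bar> \<le> y" if "x ^ 4 \<le> y ^ 4" "0 \<le> y" for x y :: real
proof (rule power_le_imp_le_base)
  show "\<bar>x\<bar> ^ Suc 3 \<le> y ^ Suc 3"
    using that(1) by (simp add: numeral_eq_Suc flip: power_abs)
qed (use that in simp)

lemma lyap_bounds:
  fixes S :: "'d::finite state"
  shows "1 \<le> lyap e S" "(fst S $ k) ^ 4 \<le> lyap e S"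
    "(fst S $ k - fst (snd S) $ k) ^ 4 / e ^ 4 \<le> lyap e S"
    "((fst S $ k + fst (snd S) $ k) / 2 - snd (snd S) $ k) ^ 2 / e ^ 4 \<le> lyap e S"
proof -
  let ?a = "\<Sum>k\<in>UNIV. (fst S $ k) ^ 4" and ?b = "\<Sum>k\<in>UNIV. (fst (snd S) $ k) ^ 4"
  let ?c = "(\<Sum>k\<in>UNIV. (fst S $ k - fst (snd S) $ k) ^ 4) / e ^ 4"
  let ?d = "(\<Sum>k\<in>UNIV. ((fst S $ k + fst (snd S) $ k) / 2 - snd (snd S) $ k) ^ 2) / e ^ 4"
  have nn: "0 \<le> ?a" "0 \<le> ?b" "0 \<le> ?c" "0 \<le> ?d"
    by (auto intro!: sum_nonneg divide_nonneg_nonneg)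
  have "(fst S $ k) ^ 4 \<le> ?a"
    by (rule member_le_sum[of k UNIV "\<lambda>k. (fst S $ k) ^ 4"]) auto
  moreover have "(fst S $ k - fst (snd S) $ k) ^ 4 / e ^ 4 \<le> ?c"
    by (intro divide_right_mono member_le_sum[of k UNIV "\<lambda>k. (fst S $ k - fst (snd S) $ k) ^ 4"]) auto
  moreover have "((fst S $ k + fst (snd S) $ k) / 2 - snd (snd S) $ k) ^ 2 / e ^ 4 \<le> ?d"
    by (intro divide_right_mono member_le_sum[of k UNIV "\<lambda>k. ((fst S $ k + fst (snd S) $ k) / 2 - snd (snd S) $ k) ^ 2"]) auto
  ultimately show "1 \<le> lyap e S" "(fst S $ k) ^ 4 \<le> lyap e S"
    "(fst S $ k - fst (snd S) $ k) ^ 4 / e ^ 4 \<le> lyap e S"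
    "((fst S $ k + fst (snd S) $ k) / 2 - snd (snd S) $ k) ^ 2 / e ^ 4 \<le> lyap e S"
    using nn unfolding lyap_def by linarith+
qed

lemma ell_pow4: "ell e S ^ 4 = lyap e S"
  unfolding ell_def using lyap_bounds(1)[of e S] by (intro real_root_pow_pos2) auto

lemma ell_ge_1: "1 \<le> ell e S"
  unfolding ell_def using lyap_bounds(1)[of e S] real_root_ge_1_iff[of 4] by simp

lemma lyap_swap: "lyap (eps i) (fst (snd (swap i))) = lyap (eps i) (fst (snd i))"
proof -
  have "(xa i $ k - xf i $ k) ^ 4 = (xf i $ k - xa i $ k) ^ 4" for k
    by (metis (no_types) abs_minus_commute even_numeral power_even_abs)
  then show ?thesis
    unfolding lyap_def by (simp add: add.commute)
qed

lemma ell_swap: "ell (eps i) (fst (snd (swap i))) = ell (eps i) (fst (snd i))"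
  unfolding ell_def lyap_swap ..

lemma theta_swap: "theta e (snd (snd (swap i))) = theta e (snd (snd i))"
  unfolding theta_def by simp

lemma theta_ge_1: "0 < e \<Longrightarrow> 1 \<le> theta e v"
proof -
  assume "0 < e"
  then have "0 \<le> (\<Sum>j\<in>UNIV. \<bar>fst v $ j\<bar> / e)" "0 \<le> (\<Sum>j\<in>UNIV. \<bar>snd v $ j\<bar> / e)"
    by (auto intro!: sum_nonneg)
  then show ?thesis unfolding theta_def by linarith
qed

lemma noise_le_theta:
  assumes e: "0 < e"
  shows "\<bar>fst v $ j\<bar> \<le> e * theta e v" "\<bar>snd v $ j\<bar> \<le> e * theta e v"
proof -
  have "0 \<le> (\<Sum>j\<in>UNIV. \<bar>fst v $ j\<bar> / e)" "0 \<le> (\<Sum>j\<in>UNIV. \<bar>snd v $ j\<bar> / e)"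
    using e by (auto intro!: sum_nonneg)
  moreover have "\<bar>fst v $ j\<bar> / e \<le> (\<Sum>j\<in>UNIV. \<bar>fst v $ j\<bar> / e)"
    using e by (intro member_le_sum) auto
  moreover have "\<bar>snd v $ j\<bar> / e \<le> (\<Sum>j\<in>UNIV. \<bar>snd v $ j\<bar> / e)"
    using e by (intro member_le_sum) auto
  ultimately have "\<bar>fst v $ j\<bar> / e \<le> theta e v" "\<bar>snd v $ j\<bar> / e \<le> theta e v"
    unfolding theta_def by linarith+
  then show "\<bar>fst v $ j\<bar> \<le> e * theta e v" "\<bar>snd v $ j\<bar> \<le> e * theta e v"
    using e by (simp_all add: pos_divide_le_eq mult.commute)
qed

text \<open>The power of \<open>theta\<close> is left unspecified because all its moments are bounded
  uniformly in the step size.\<close>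

definition ord_bound :: "real \<Rightarrow> nat \<Rightarrow> nat \<Rightarrow> (('d::finite, 'm::finite) config \<Rightarrow> real) \<Rightarrow> bool" where
  "ord_bound T p q \<phi> \<longleftrightarrow> (\<exists>r C. 0 \<le> C \<and> (\<forall>e S v. 0 < e \<longrightarrow> e\<^sup>2 \<le> T \<longrightarrow>
     \<bar>\<phi> (e, S, v)\<bar> \<le> C * (e ^ p * ell e S ^ q * theta e v ^ r)))"

lemma ord_boundI:
  assumes "0 \<le> C" "\<And>e S v. 0 < e \<Longrightarrow> e\<^sup>2 \<le> T \<Longrightarrow> \<bar>\<phi> (e, S, v)\<bar> \<le> C * (e ^ p * ell e S ^ q * theta e v ^ r)"
  shows "ord_bound T p q \<phi>"
  using assms unfolding ord_bound_def by blast

lemma ord_boundE: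
  assumes "ord_bound T p q \<phi>"
  obtains r C where "0 \<le> C"
    "\<And>e S v. 0 < e \<Longrightarrow> e\<^sup>2 \<le> T \<Longrightarrow> \<bar>\<phi> (e, S, v)\<bar> \<le> C * (e ^ p * ell e S ^ q * theta e v ^ r)"
  using assms unfolding ord_bound_def by blast

lemma ell_nonneg [simp]: "0 \<le> ell e S"
  using ell_ge_1[of e S] by simp

lemma theta_nonneg: "0 < e \<Longrightarrow> 0 \<le> theta e v"
  using theta_ge_1[of e v] by simp

lemma ord_bound_le:
  assumes "ord_bound T p q \<psi>" "\<And>i. \<bar>\<phi> i\<bar> \<le> \<bar>\<psi> i\<bar>"
  shows "ord_bound T p q \<phi>"
proof -
  from assms(1) obtain r C where C: "0 \<le> C"
    "\<And>e S v. 0 < e \<Longrightarrow> e\<^sup>2 \<le> T \<Longrightarrow> \<bar>\<psi> (e, S, v)\<bar> \<le> C * (e ^ p * ell e S ^ q * theta e v ^ r)"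
    by (rule ord_boundE) blast
  show ?thesis
    by (rule ord_boundI[OF C(1)]) (rule order_trans[OF assms(2) C(2)])
qed

text \<open>Surplus powers of \<open>e\<close> go into the constant because
  \<open>e \<le> sqrt T\<close>, and the power of \<open>ell\<close> may grow because
  \<open>ell \<ge> 1\<close>.\<close>

lemma ord_bound_mono:
  assumes "ord_bound T p q \<phi>" "p' \<le> p" "q \<le> q'"
  shows "ord_bound T p' q' \<phi>"
proof -
  from assms(1) obtain r C where C: "0 \<le> C"
    "\<And>e S v. 0 < e \<Longrightarrow> e\<^sup>2 \<le> T \<Longrightarrow> \<bar>\<phi> (e, S, v)\<bar> \<le> C * (e ^ p * ell e S ^ q * theta e v ^ r)"
    by (rule ord_boundE) blast
  show ?thesis
  proof (rule ord_boundI)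
    let ?E = "sqrt T ^ (p - p')"
    show "0 \<le> C * \<bar>?E\<bar>" using C(1) by simp
    fix e :: real and S :: "'a state" and v :: "(real^'b) \<times> (real^'b)"
    assume e: "0 < e" "e\<^sup>2 \<le> T"
    have "e \<le> sqrt T" using e by (simp add: real_le_rsqrt)
    then have "e ^ (p - p') \<le> \<bar>?E\<bar>" using e by (auto intro: order_trans[OF power_mono abs_ge_self])
    then have "e ^ p' * e ^ (p - p') \<le> e ^ p' * \<bar>?E\<bar>"
      using e by (intro mult_left_mono) auto
    then have "e ^ p \<le> \<bar>?E\<bar> * e ^ p'"
      using assms(2) by (simp add: power_add[symmetric] mult.commute)
    moreover have "ell e S ^ q \<le> ell e S ^ q'"
      using assms(3) ell_ge_1 by (rule power_increasing)
    ultimately have "e ^ p * ell e S ^ q * theta e v ^ r \<le> (\<bar>?E\<bar> * e ^ p') * ell e S ^ q' * theta e v ^ r"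
      using e by (intro mult_right_mono mult_mono) (auto simp: theta_nonneg)
    then have "C * (e ^ p * ell e S ^ q * theta e v ^ r) \<le> C * ((\<bar>?E\<bar> * e ^ p') * ell e S ^ q' * theta e v ^ r)"
      using C(1) by (intro mult_left_mono)
    also have "\<dots> = C * \<bar>?E\<bar> * (e ^ p' * ell e S ^ q' * theta e v ^ r)"
      by (simp add: mult_ac)
    finally show "\<bar>\<phi> (e, S, v)\<bar> \<le> C * \<bar>?E\<bar> * (e ^ p' * ell e S ^ q' * theta e v ^ r)"
      using C(2)[OF e, of S v] by linarith
  qed
qed

lemma ord_bound_add:
  assumes "ord_bound T p q \<phi>" "ord_bound T p q \<psi>"
  shows "ord_bound T p q (\<lambda>i. \<phi> i + \<psi> i)"
proof -
  from assms(1) obtain r C where C: "0 \<le> C"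
    "\<And>e S v. 0 < e \<Longrightarrow> e\<^sup>2 \<le> T \<Longrightarrow> \<bar>\<phi> (e, S, v)\<bar> \<le> C * (e ^ p * ell e S ^ q * theta e v ^ r)"
    by (rule ord_boundE) blast
  from assms(2) obtain r' C' where C': "0 \<le> C'"
    "\<And>e S v. 0 < e \<Longrightarrow> e\<^sup>2 \<le> T \<Longrightarrow> \<bar>\<psi> (e, S, v)\<bar> \<le> C' * (e ^ p * ell e S ^ q * theta e v ^ r')"
    by (rule ord_boundE) blast
  show ?thesis
  proof (rule ord_boundI)
    show "0 \<le> C + C'" using C C' by simp
    fix e :: real and S :: "'a state" and v :: "(real^'b) \<times> (real^'b)"
    assume e: "0 < e" "e\<^sup>2 \<le> T"
    let ?k = "e ^ p * ell e S ^ q"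
    \<comment> \<open>The two unspecified exponents are raised to a common one, using
      \<open>theta \<ge> 1\<close>.\<close>
    have t: "theta e v ^ r \<le> theta e v ^ (r + r')" "theta e v ^ r' \<le> theta e v ^ (r + r')"
      by (rule power_increasing; simp add: theta_ge_1[OF e(1)])+
    have "C * (?k * theta e v ^ r) \<le> C * (?k * theta e v ^ (r + r'))"
      "C' * (?k * theta e v ^ r') \<le> C' * (?k * theta e v ^ (r + r'))"
      using e C(1) C'(1) t by (auto intro!: mult_left_mono)
    then show "\<bar>\<phi> (e, S, v) + \<psi> (e, S, v)\<bar> \<le> (C + C') * (?k * theta e v ^ (r + r'))"
      using C(2)[OF e, of S v] C'(2)[OF e, of S v] unfolding distrib_right by linarith
  qed
qed

lemma ord_bound_mult:
  assumes "ord_bound T p q \<phi>" "ord_bound T p' q' \<psi>"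
  shows "ord_bound T (p + p') (q + q') (\<lambda>i. \<phi> i * \<psi> i)"
proof -
  from assms(1) obtain r C where C: "0 \<le> C"
    "\<And>e S v. 0 < e \<Longrightarrow> e\<^sup>2 \<le> T \<Longrightarrow> \<bar>\<phi> (e, S, v)\<bar> \<le> C * (e ^ p * ell e S ^ q * theta e v ^ r)"
    by (rule ord_boundE) blast
  from assms(2) obtain r' C' where C': "0 \<le> C'"
    "\<And>e S v. 0 < e \<Longrightarrow> e\<^sup>2 \<le> T \<Longrightarrow> \<bar>\<psi> (e, S, v)\<bar> \<le> C' * (e ^ p' * ell e S ^ q' * theta e v ^ r')"
    by (rule ord_boundE) blast
  show ?thesis
  proof (rule ord_boundI)
    show "0 \<le> C * C'" using C C' by simp
    fix e :: real and S :: "'a state" and v :: "(real^'b) \<times> (real^'b)"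
    assume e: "0 < e" "e\<^sup>2 \<le> T"
    have "\<bar>\<phi> (e, S, v) * \<psi> (e, S, v)\<bar> \<le> (C * (e ^ p * ell e S ^ q * theta e v ^ r)) * (C' * (e ^ p' * ell e S ^ q' * theta e v ^ r'))"
      unfolding abs_mult using C(2)[OF e, of S v] C'(2)[OF e, of S v]
      by (intro mult_mono) (auto intro: order_trans[OF abs_ge_zero])
    then show "\<bar>\<phi> (e, S, v) * \<psi> (e, S, v)\<bar> \<le> C * C' * (e ^ (p + p') * ell e S ^ (q + q') * theta e v ^ (r + r'))"
      by (simp add: power_add mult_ac)
  qed
qed

lemma ord_bound_mult':
  assumes "ord_bound T p q \<phi>" "ord_bound T p' q' \<psi>" "P \<le> p + p'" "q + q' \<le> Q"
  shows "ord_bound T P Q (\<lambda>i. \<phi> i * \<psi> i)"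
  by (rule ord_bound_mono[OF ord_bound_mult[OF assms(1,2)] assms(3,4)])

lemma ord_bound_const: "ord_bound T 0 q (\<lambda>i. c)"
proof (rule ord_bound_mono)
  show "ord_bound T 0 0 (\<lambda>i. c)"
    by (rule ord_boundI[where C = "\<bar>c\<bar>" and r = 0]) auto
qed auto

lemma ord_bound_zero: "ord_bound T p q (\<lambda>i. 0)"
  by (rule ord_boundI[where C = 0 and r = 0]) auto

lemma ord_bound_cmult: "ord_bound T p q \<phi> \<Longrightarrow> ord_bound T p q (\<lambda>i. c * \<phi> i)"
  using ord_bound_mult[OF ord_bound_const[of T 0 c]] by fastforce

lemma ord_bound_minus: "ord_bound T p q \<phi> \<Longrightarrow> ord_bound T p q (\<lambda>i. - \<phi> i)"
  by (erule ord_bound_le) simp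

lemma ord_bound_diff: "ord_bound T p q \<phi> \<Longrightarrow> ord_bound T p q \<psi> \<Longrightarrow> ord_bound T p q (\<lambda>i. \<phi> i - \<psi> i)"
  using ord_bound_add[OF _ ord_bound_minus, of T p q \<phi> \<psi>] by simp

lemma ord_bound_divide: "ord_bound T p q \<phi> \<Longrightarrow> ord_bound T p q (\<lambda>i. \<phi> i / c)"
  using ord_bound_cmult[of T p q \<phi> "1 / c"] by simp

lemma ord_bound_sum:
  assumes "\<And>j. j \<in> A \<Longrightarrow> ord_bound T p q (\<phi> j)"
  shows "ord_bound T p q (\<lambda>i. \<Sum>j\<in>A. \<phi> j i)"
  using assms by (induction A rule: infinite_finite_induct) (auto intro: ord_bound_zero ord_bound_add)

lemma ord_bound_power:
  assumes "ord_bound T p q \<phi>"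
  shows "ord_bound T (n * p) (n * q) (\<lambda>i. \<phi> i ^ n)"
  by (induction n) (auto intro: ord_bound_const ord_bound_mult[OF assms])

lemma ord_bound_swap:
  assumes "ord_bound T p q \<phi>"
  shows "ord_bound T p q (\<lambda>i. \<phi> (swap i))"
proof -
  from assms obtain r C where C: "0 \<le> C"
    "\<And>e S v. 0 < e \<Longrightarrow> e\<^sup>2 \<le> T \<Longrightarrow> \<bar>\<phi> (e, S, v)\<bar> \<le> C * (e ^ p * ell e S ^ q * theta e v ^ r)"
    by (rule ord_boundE) blast
  show ?thesis
  proof (rule ord_boundI[OF C(1)])
    fix e :: real and S :: "'a state" and v :: "(real^'b) \<times> (real^'b)"
    assume e: "0 < e" "e\<^sup>2 \<le> T"
    let ?i = "swap (e, S, v)"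
    have "?i = (e, fst (snd ?i), snd (snd ?i))"
      by (simp add: swap_def)
    then show "\<bar>\<phi> ?i\<bar> \<le> C * (e ^ p * ell e S ^ q * theta e v ^ r)"
      using C(2)[OF e, of "fst (snd ?i)" "snd (snd ?i)"]
      using ell_swap[of "(e, S, v)"] theta_swap[of e "(e, S, v)"] by simp
  qed
qed

lemma ord_bound_eps: "ord_bound T 1 0 eps"
  by (rule ord_boundI[where C = 1 and r = 0]) auto

lemma ord_bound_eps2: "ord_bound T 2 0 (\<lambda>i. (eps i)\<^sup>2)"
  using ord_bound_power[OF ord_bound_eps, of T 2] by simp

lemma ord_bound_wa: "ord_bound T 1 0 (\<lambda>i. wa i $ j)"
  by (rule ord_boundI[where C = 1 and r = 1]) (auto simp: noise_le_theta)

lemma ord_bound_wb: "ord_bound T 1 0 (\<lambda>i. wb i $ j)"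
  by (rule ord_boundI[where C = 1 and r = 1]) (auto simp: noise_le_theta)

lemma ord_bound_state:
  assumes "\<And>e S v. 0 < e \<Longrightarrow> \<bar>\<phi> (e, S, v)\<bar> \<le> e ^ p * ell e S ^ q"
  shows "ord_bound T p q \<phi>"
  using assms by (intro ord_boundI[where C = 1 and r = 0]) auto

lemma ord_bound_xf: "ord_bound T 0 1 (\<lambda>i. xf i $ k)"
proof (rule ord_bound_state)
  fix e :: real and S :: "'a state" and v :: "(real^'b) \<times> (real^'b)"
  assume e: "0 < e"
  have "(fst S $ k) ^ 4 \<le> ell e S ^ 4"
    using lyap_bounds(2)[of S k e] by (simp add: ell_pow4)
  then show "\<bar>xf (e, S, v) $ k\<bar> \<le> e ^ 0 * ell e S ^ 1"
    by (simp add: abs_le_of_power4_le)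
qed

lemma ord_bound_xa: "ord_bound T 0 1 (\<lambda>i. xa i $ k)"
  using ord_bound_swap[OF ord_bound_xf] by simp

lemma ord_bound_xf_xa: "ord_bound T 1 1 (\<lambda>i. xf i $ k - xa i $ k)"
proof (rule ord_bound_state)
  fix e :: real and S :: "'a state" and v :: "(real^'b) \<times> (real^'b)"
  assume e: "0 < e"
  have "(fst S $ k - fst (snd S) $ k) ^ 4 \<le> (e * ell e S) ^ 4"
    using lyap_bounds(3)[of S k e] e by (simp add: power_mult_distrib ell_pow4 pos_divide_le_eq mult.commute)
  then show "\<bar>xf (e, S, v) $ k - xa (e, S, v) $ k\<bar> \<le> e ^ 1 * ell e S ^ 1"
    using e by (simp add: abs_le_of_power4_le)
qed

text \<open>This error enters \<open>lyap\<close> squared, so it is bounded by \<open>e ^ 2\<close>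
  times the square root of \<open>lyap\<close>, that is by \<open>ell ^ 2\<close> and not by
  \<open>ell\<close>.\<close>

lemma ord_bound_mean_xc: "ord_bound T 2 2 (\<lambda>i. (xf i $ k + xa i $ k) / 2 - xc i $ k)"
proof (rule ord_bound_state)
  fix e :: real and S :: "'a state" and v :: "(real^'b) \<times> (real^'b)"
  assume e: "0 < e"
  let ?x = "(fst S $ k + fst (snd S) $ k) / 2 - snd (snd S) $ k"
  have "\<bar>?x\<bar> ^ 2 \<le> lyap e S * e ^ 4"
    using lyap_bounds(4)[of S k e] e by (simp add: pos_divide_le_eq)
  also have "\<dots> = (e ^ 2 * ell e S ^ 2) ^ 2"
    by (simp add: power_mult_distrib power_mult[symmetric] ell_pow4 mult.commute)
  finally have "\<bar>?x\<bar> \<le> e ^ 2 * ell e S ^ 2"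
    by (rule power2_le_imp_le) simp
  then show "\<bar>(xf (e, S, v) $ k + xa (e, S, v) $ k) / 2 - xc (e, S, v) $ k\<bar> \<le> e ^ 2 * ell e S ^ 2"
    by simp
qed

lemma ord_bound_norm:
  assumes "\<And>k. ord_bound T p q (\<lambda>i. X i $ k)"
  shows "ord_bound T p q (\<lambda>i. norm (X i))"
proof (rule ord_bound_le)
  have "ord_bound T p q (\<lambda>i. \<bar>X i $ k\<bar>)" for k
    by (rule ord_bound_le[OF assms[of k]]) simp
  then show "ord_bound T p q (\<lambda>i. \<Sum>k\<in>UNIV. \<bar>X i $ k\<bar>)"
    by (rule ord_bound_sum)
  show "\<bar>norm (X i)\<bar> \<le> \<bar>\<Sum>k\<in>UNIV. \<bar>X i $ k\<bar>\<bar>" for i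
    using norm_le_l1_cart[of "X i"] by (simp add: sum_nonneg)
qed

lemma ord_bound_lipschitz:
  assumes "lipschitz_fun u" "\<And>k. ord_bound T p q (\<lambda>i. X i $ k - Y i $ k)"
  shows "ord_bound T p q (\<lambda>i. u (X i) - u (Y i))"
proof -
  from assms(1) obtain L where L: "0 \<le> L" "\<And>x y. \<bar>u x - u y\<bar> \<le> L * norm (x - y)"
    unfolding lipschitz_fun_def by blast
  have "ord_bound T p q (\<lambda>i. L * norm (X i - Y i))"
    by (intro ord_bound_cmult ord_bound_norm) (simp add: assms(2))
  then show ?thesis
    by (rule ord_bound_le) (use L in auto)
qed

text \<open>Linear growth is the Lipschitz estimate against the fixed point 0; the constant
  \<open>u 0\<close> is absorbed by \<open>ell \<ge> 1\<close>.\<close>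

lemma ord_bound_growth:
  assumes "lipschitz_fun u" "\<And>k. ord_bound T 0 q (\<lambda>i. X i $ k)"
  shows "ord_bound T 0 q (\<lambda>i. u (X i))"
  using ord_bound_add[OF ord_bound_lipschitz[OF assms(1), of T 0 q X "\<lambda>_. 0"] ord_bound_const[of T q "u 0"]] assms(2)
  by simp

lemma ord_bound_taylor:
  assumes "taylor_fun u" "\<And>k. ord_bound T p q (\<lambda>i. Y i $ k - X i $ k)"
  shows "ord_bound T (2 * p) (2 * q)
    (\<lambda>i. u (Y i) - u (X i) - (\<Sum>l\<in>UNIV. partial l u (X i) * (Y i $ l - X i $ l)))"
proof -
  from assms(1) obtain L where L: "0 \<le> L" "\<And>x y. \<bar>u y - u x - (\<Sum>l\<in>UNIV. partial l u x * (y $ l - x $ l))\<bar> \<le> L * (norm (y - x))\<^sup>2"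
    unfolding taylor_fun_def by blast
  have "ord_bound T (2 * p) (2 * q) (\<lambda>i. L * (norm (Y i - X i))\<^sup>2)"
    by (intro ord_bound_cmult ord_bound_power ord_bound_norm) (simp add: assms(2))
  then show ?thesis
    by (rule ord_bound_le) (use L in auto)
qed

lemma ord_bound_midpoint:
  assumes "taylor_fun u" "\<And>k. ord_bound T p q (\<lambda>i. X i $ k - Y i $ k)"
  shows "ord_bound T (2 * p) (2 * q) (\<lambda>i. (u (X i) + u (Y i)) / 2 - u ((1/2) *\<^sub>R (X i + Y i)))"
proof -
  from taylor_fun_midpoint[OF assms(1)] obtain L where L: "0 \<le> L"
    "\<And>p q. \<bar>(u p + u q) / 2 - u ((1/2) *\<^sub>R (p + q))\<bar> \<le> L * (norm (p - q))\<^sup>2"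
    by blast
  have "ord_bound T (2 * p) (2 * q) (\<lambda>i. L * (norm (X i - Y i))\<^sup>2)"
    by (intro ord_bound_cmult ord_bound_power ord_bound_norm) (simp add: assms(2))
  then show ?thesis
    by (rule ord_bound_le) (use L in auto)
qed

subsection \<open>One-step expectations\<close>

text \<open>The source of all measurability: joint continuity in state and noise at fixed step size
  makes both the noise slices and the compositions with the random paths measurable.\<close>

definition cont_config :: "(('d::finite, 'm::finite) config \<Rightarrow> real) \<Rightarrow> bool" where
  "cont_config \<phi> \<longleftrightarrow> (\<forall>e. continuous_on UNIV (\<lambda>p. \<phi> (e, p)))"

lemma cont_config_intros:
  "cont_config (\<lambda>i. c)" "cont_config (\<lambda>i. eps i)"
  "cont_config (\<lambda>i. xf i $ k)" "cont_config (\<lambda>i. xa i $ k)" "cont_config (\<lambda>i. xc i $ k)"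
  "cont_config (\<lambda>i. wa i $ j)" "cont_config (\<lambda>i. wb i $ j)"
  "cont_config \<phi> \<Longrightarrow> cont_config \<psi> \<Longrightarrow> cont_config (\<lambda>i. \<phi> i + \<psi> i)"
  "cont_config \<phi> \<Longrightarrow> cont_config \<psi> \<Longrightarrow> cont_config (\<lambda>i. \<phi> i - \<psi> i)"
  "cont_config \<phi> \<Longrightarrow> cont_config \<psi> \<Longrightarrow> cont_config (\<lambda>i. \<phi> i * \<psi> i)"
  "cont_config \<phi> \<Longrightarrow> cont_config (\<lambda>i. \<phi> i ^ n)"
  unfolding cont_config_def by (auto intro!: continuous_intros)

lemma cont_config_divide: "cont_config \<phi> \<Longrightarrow> cont_config (\<lambda>i. \<phi> i / c)"
  unfolding divide_inverse by (intro cont_config_intros)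

lemma cont_config_sum:
  "(\<And>k. k \<in> A \<Longrightarrow> cont_config (\<phi> k)) \<Longrightarrow> cont_config (\<lambda>i. \<Sum>k\<in>A. \<phi> k i)"
  by (induction A rule: infinite_finite_induct) (auto intro: cont_config_intros)

lemma continuous_on_vecI:
  fixes X :: "'a::topological_space \<Rightarrow> real^'n::finite"
  assumes "\<And>k. continuous_on A (\<lambda>x. X x $ k)"
  shows "continuous_on A X"
  using continuous_on_vec_lambda[of A "\<lambda>k x. X x $ k", OF assms] by simp

lemma cont_config_compose:
  assumes "continuous_on UNIV u" "\<And>k. cont_config (\<lambda>i. X i $ k)"
  shows "cont_config (\<lambda>i. u (X i))"
  unfolding cont_config_def
proof
  fix e
  have "continuous_on UNIV (\<lambda>p. X (e, p))"
    using assms(2) by (intro continuous_on_vecI) (simp add: cont_config_def)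
  then show "continuous_on UNIV (\<lambda>p. u (X (e, p)))"
    by (rule continuous_on_compose2[OF assms(1)]) auto
qed

lemma cont_config_swap: "cont_config \<phi> \<Longrightarrow> cont_config (\<lambda>i. \<phi> (swap i))"
  unfolding cont_config_def swap_def
proof
  fix e assume "\<forall>e. continuous_on UNIV (\<lambda>p. \<phi> (e, p))"
  then have c: "continuous_on UNIV (\<lambda>p. \<phi> (e, p))" by blast
  show "continuous_on UNIV (\<lambda>p. \<phi> (eps (e, p), (xa (e, p), xf (e, p), xc (e, p)), wb (e, p), wa (e, p)))"
    unfolding fst_conv snd_conv
    by (rule continuous_on_compose2[OF c]) (auto intro!: continuous_intros)
qed

lemmas cont_config_rules = cont_config_intros cont_config_divide cont_config_sum cont_config_swap

lemma cont_config_slice: "cont_config \<phi> \<Longrightarrow> continuous_on UNIV (\<lambda>v. \<phi> (e, S, v))"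
proof -
  assume "cont_config \<phi>"
  then have c: "continuous_on UNIV (\<lambda>p. \<phi> (e, p))" by (simp add: cont_config_def)
  show ?thesis
    by (rule continuous_on_compose2[OF c]) (auto intro!: continuous_intros)
qed

lemma cont_config_measurable:
  assumes "cont_config \<phi>" "noise_pair R e' Q"
  shows "(\<lambda>v. \<phi> (e, S, v)) \<in> borel_measurable Q"
  using borel_measurable_continuous_onI[OF cont_config_slice[OF assms(1)]] noise_pair_sets[OF assms(2)]
    measurable_cong_sets by blast

text \<open>Integrating out the noise replaces the power of \<open>theta\<close> by a constant and
  leaves the orders in \<open>e\<close> and \<open>ell\<close> unchanged.\<close>

lemma ord_bound_integral:
  fixes \<phi> :: "('d::finite, 'm::finite) config \<Rightarrow> real" and R :: "real^'m^'m"
  assumes "ord_bound T p q \<phi>" "cont_config \<phi>"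
  shows "\<exists>C\<ge>0. \<forall>e S Q. 0 < e \<longrightarrow> e\<^sup>2 \<le> T \<longrightarrow> noise_pair R e Q \<longrightarrow>
    integrable Q (\<lambda>v. \<phi> (e, S, v)) \<and> \<bar>\<integral>v. \<phi> (e, S, v) \<partial>Q\<bar> \<le> C * (e ^ p * ell e S ^ q)"
proof -
  from assms(1) obtain r C where C: "0 \<le> C"
    "\<And>e S v. 0 < e \<Longrightarrow> e\<^sup>2 \<le> T \<Longrightarrow> \<bar>\<phi> (e, S, v)\<bar> \<le> C * (e ^ p * ell e S ^ q * theta e v ^ r)"
    by (rule ord_boundE) blast
  obtain K where K: "\<And>e Q. 0 < e \<Longrightarrow> noise_pair R e Q \<Longrightarrow>
     integrable Q (\<lambda>v. theta e v ^ r) \<and> (\<integral>v. theta e v ^ r \<partial>Q) \<le> K"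
    using noise_pair_theta_moment[of R r] by blast
  show ?thesis
  proof (intro exI[of _ "C * \<bar>K\<bar>"] conjI allI impI)
    show "0 \<le> C * \<bar>K\<bar>" using C(1) by simp
    fix e :: real and S :: "'d state" and Q :: "((real^'m) \<times> (real^'m)) measure"
    assume e: "0 < e" "e\<^sup>2 \<le> T" and Q: "noise_pair R e Q"
    let ?k = "C * (e ^ p * ell e S ^ q)"
    have k: "0 \<le> ?k" using C(1) e by simp
    have I: "integrable Q (\<lambda>v. ?k * theta e v ^ r)"
      using K[OF e(1) Q] by simp
    have le: "\<bar>\<phi> (e, S, v)\<bar> \<le> ?k * theta e v ^ r" for v
      using C(2)[OF e, of S v] by (simp add: mult.assoc)
    show i: "integrable Q (\<lambda>v. \<phi> (e, S, v))"
    proof (rule Bochner_Integration.integrable_bound[OF I cont_config_measurable[OF assms(2) Q]])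
      have "norm (\<phi> (e, S, v)) \<le> norm (?k * theta e v ^ r)" for v
        unfolding real_norm_def by (rule order_trans[OF le abs_ge_self])
      then show "AE v in Q. norm (\<phi> (e, S, v)) \<le> norm (?k * theta e v ^ r)"
        by blast
    qed
    have "\<bar>\<integral>v. \<phi> (e, S, v) \<partial>Q\<bar> \<le> (\<integral>v. \<bar>\<phi> (e, S, v)\<bar> \<partial>Q)"
      by (rule integral_abs_bound)
    also have "\<dots> \<le> (\<integral>v. ?k * theta e v ^ r \<partial>Q)"
      using i I le by (intro integral_mono) auto
    also have "\<dots> = ?k * (\<integral>v. theta e v ^ r \<partial>Q)"
      by simp
    also have "\<dots> \<le> ?k * \<bar>K\<bar>"
      using K[OF e(1) Q] k by (intro mult_left_mono) auto
    finally show "\<bar>\<integral>v. \<phi> (e, S, v) \<partial>Q\<bar> \<le> C * \<bar>K\<bar> * (e ^ p * ell e S ^ q)"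
      by (simp add: mult_ac)
  qed
qed

text \<open>A pointwise version of vanishing conditional expectation given the state: the state is a
  parameter. Integrability is part of the notion.\<close>

definition centred :: "real^'m^'m \<Rightarrow> real \<Rightarrow> (('d::finite, 'm::finite) config \<Rightarrow> real) \<Rightarrow> bool" where
  "centred R T \<phi> \<longleftrightarrow> (\<forall>e S Q. 0 < e \<longrightarrow> e\<^sup>2 \<le> T \<longrightarrow> noise_pair R e Q \<longrightarrow>
     has_bochner_integral Q (\<lambda>v. \<phi> (e, S, v)) 0)"

lemma centredD:
  "centred R T \<phi> \<Longrightarrow> 0 < e \<Longrightarrow> e\<^sup>2 \<le> T \<Longrightarrow> noise_pair R e Q \<Longrightarrow> has_bochner_integral Q (\<lambda>v. \<phi> (e, S, v)) 0"
  unfolding centred_def by blast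

lemma centred_add: "centred R T \<phi> \<Longrightarrow> centred R T \<psi> \<Longrightarrow> centred R T (\<lambda>i. \<phi> i + \<psi> i)"
  unfolding centred_def using has_bochner_integral_add[where x = 0 and y = "0::real", simplified] by blast

lemma centred_diff: "centred R T \<phi> \<Longrightarrow> centred R T \<psi> \<Longrightarrow> centred R T (\<lambda>i. \<phi> i - \<psi> i)"
  unfolding centred_def using has_bochner_integral_diff[where x = 0 and y = "0::real", simplified] by blast

lemma centred_zero: "centred R T (\<lambda>i. 0)"
  unfolding centred_def by auto

lemma centred_sum:
  "(\<And>k. k \<in> A \<Longrightarrow> centred R T (\<phi> k)) \<Longrightarrow> centred R T (\<lambda>i. \<Sum>k\<in>A. \<phi> k i)"
  by (induction A rule: infinite_finite_induct) (auto intro: centred_zero centred_add)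

text \<open>The condition on \<open>\<psi>\<close> says that it does not depend on the noise, 0
  being an arbitrary reference value; such a factor leaves the integral.\<close>

lemma centred_mult_state:
  assumes "centred R T \<phi>" "\<And>e S v. \<psi> (e, S, v) = \<psi> (e, S, 0)"
  shows "centred R T (\<lambda>i. \<psi> i * \<phi> i)"
  unfolding centred_def
proof (intro allI impI)
  fix e S Q assume "0 < e" "e\<^sup>2 \<le> T" "noise_pair R e Q"
  then have "has_bochner_integral Q (\<lambda>v. \<psi> (e, S, 0) * \<phi> (e, S, v)) (\<psi> (e, S, 0) * 0)"
    by (intro has_bochner_integral_mult_right centredD[OF assms(1)])
  then show "has_bochner_integral Q (\<lambda>v. \<psi> (e, S, v) * \<phi> (e, S, v)) 0"
    by (subst assms(2)) simp
qed

lemma centred_divide: "centred R T \<phi> \<Longrightarrow> centred R T (\<lambda>i. \<phi> i / c)"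
  using centred_mult_state[of R T \<phi> "\<lambda>_. 1 / c"] by simp

lemma centred_swap:
  fixes \<phi> :: "('d::finite, 'm::finite) config \<Rightarrow> real"
  assumes "centred R T \<phi>"
  shows "centred R T (\<lambda>i. \<phi> (swap i))"
  unfolding centred_def
proof (intro allI impI)
  fix e and S :: "'d state" and Q assume e: "0 < e" "e\<^sup>2 \<le> T" and Q: "noise_pair R e Q"
  obtain \<mu> \<nu> where \<mu>: "noise_law R (e\<^sup>2 / 2) \<mu>" and \<nu>: "noise_law R (e\<^sup>2 / 2) \<nu>" and Qeq: "Q = \<mu> \<Otimes>\<^sub>M \<nu>"
    using Q unfolding noise_pair_def by blast
  interpret m: prob_space \<mu> using \<mu> by (simp add: noise_law_def)
  interpret n: prob_space \<nu> using \<nu> by (simp add: noise_law_def)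
  interpret pair_sigma_finite \<nu> \<mu> ..
  let ?S = "(fst (snd S), fst S, snd (snd S))"
  have "noise_pair R e (\<nu> \<Otimes>\<^sub>M \<mu>)"
    using \<mu> \<nu> unfolding noise_pair_def by blast
  then have h: "has_bochner_integral (\<nu> \<Otimes>\<^sub>M \<mu>) (\<lambda>v. \<phi> (e, ?S, v)) 0"
    by (rule centredD[OF assms e])
  then have [measurable]: "(\<lambda>v. \<phi> (e, ?S, v)) \<in> borel_measurable (\<nu> \<Otimes>\<^sub>M \<mu>)"
    by (rule borel_measurable_has_bochner_integral)
  have eq: "(\<lambda>v. \<phi> (swap (e, S, v))) = (\<lambda>(x, y). \<phi> (e, ?S, (y, x)))"
    by (auto simp: swap_def fun_eq_iff)
  show "has_bochner_integral Q (\<lambda>v. \<phi> (swap (e, S, v))) 0"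
    using h integrable_product_swap[of "\<lambda>v. \<phi> (e, ?S, v)"] integral_product_swap[of "\<lambda>v. \<phi> (e, ?S, v)"]
    unfolding Qeq eq has_bochner_integral_iff by simp
qed

text \<open>The martingale structure inside one coarse step. A factor depending on the state and the
  first half increment is constant while the second half increment is integrated, and the inner
  integral vanishes; the order bound supplies the integrability for Fubini.\<close>

lemma centred_mult_second:
  fixes \<psi> :: "('d::finite, 'm::finite) config \<Rightarrow> real" and R :: "real^'m^'m"
  assumes ob: "ord_bound T p q (\<lambda>i. \<psi> i * \<xi> (eps i) (wb i))"
    and c: "cont_config (\<lambda>i. \<psi> i * \<xi> (eps i) (wb i))"
    and \<psi>: "\<And>e S a b. \<psi> (e, S, a, b) = \<psi> (e, S, a, 0)"
    and \<xi>: "\<And>e \<mu>. 0 < e \<Longrightarrow> noise_law R (e\<^sup>2 / 2) \<mu> \<Longrightarrow> has_bochner_integral \<mu> (\<xi> e) 0"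
  shows "centred R T (\<lambda>i. \<psi> i * \<xi> (eps i) (wb i))"
  unfolding centred_def
proof (intro allI impI)
  fix e and S :: "'d state" and Q assume e: "0 < e" "e\<^sup>2 \<le> T" and Q: "noise_pair R e Q"
  obtain \<mu> \<nu> where \<mu>: "noise_law R (e\<^sup>2 / 2) \<mu>" and \<nu>: "noise_law R (e\<^sup>2 / 2) \<nu>" and Qeq: "Q = \<mu> \<Otimes>\<^sub>M \<nu>"
    using Q unfolding noise_pair_def by blast
  interpret m: prob_space \<mu> using \<mu> by (simp add: noise_law_def)
  interpret n: prob_space \<nu> using \<nu> by (simp add: noise_law_def)
  interpret pair_sigma_finite \<mu> \<nu> ..
  have "integrable Q (\<lambda>v. \<psi> (e, S, v) * \<xi> e (snd v))"
    using ord_bound_integral[OF ob c, of R] e Q unfolding fst_conv snd_conv by blast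
  moreover have eq: "(\<lambda>v. \<psi> (e, S, v) * \<xi> e (snd v)) = (\<lambda>v. \<psi> (e, S, fst v, 0) * \<xi> e (snd v))"
    using \<psi>[of e S] by (intro ext arg_cong2[of _ _ _ _ times] refl) (metis prod.collapse)
  ultimately have I: "integrable (\<mu> \<Otimes>\<^sub>M \<nu>) (\<lambda>v. \<psi> (e, S, fst v, 0) * \<xi> e (snd v))"
    unfolding Qeq by simp
  have "(\<integral>v. \<psi> (e, S, fst v, 0) * \<xi> e (snd v) \<partial>(\<mu> \<Otimes>\<^sub>M \<nu>)) = 0"
    using \<xi>[OF e(1) \<nu>] unfolding integral_fst'[OF I, symmetric]
    by (simp add: has_bochner_integral_iff)
  then show "has_bochner_integral Q (\<lambda>v. \<psi> (e, S, v) * \<xi> (eps (e, S, v)) (wb (e, S, v))) 0"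
    using I unfolding Qeq has_bochner_integral_iff fst_conv snd_conv eq by blast
qed

text \<open>The quadratic Milstein factor of a half step; subtracting the covariance over a time
  \<open>e\<^sup>2 / 2\<close> makes it centred.\<close>

definition qa :: "real^'m^'m \<Rightarrow> 'm \<Rightarrow> 'm \<Rightarrow> ('d::finite, 'm::finite) config \<Rightarrow> real" where
  "qa R j l i = wa i $ j * wa i $ l - R $ j $ l * ((eps i)\<^sup>2 / 2)"
definition qb :: "real^'m^'m \<Rightarrow> 'm \<Rightarrow> 'm \<Rightarrow> ('d::finite, 'm::finite) config \<Rightarrow> real" where
  "qb R j l i = wb i $ j * wb i $ l - R $ j $ l * ((eps i)\<^sup>2 / 2)"

lemma q_swap [simp]: "qa R j l (swap i) = qb R j l i" "qb R j l (swap i) = qa R j l i"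
  by (simp_all add: qa_def qb_def)

lemma ord_bound_q: "ord_bound T 2 0 (qa R j l)" "ord_bound T 2 0 (qb R j l)"
proof -
  show "ord_bound T 2 0 (qa R j l)"
    unfolding qa_def
    by (intro ord_bound_diff ord_bound_mult'[OF ord_bound_wa ord_bound_wa] ord_bound_cmult
        ord_bound_divide ord_bound_eps2) auto
  from ord_bound_swap[OF this] show "ord_bound T 2 0 (qb R j l)" by simp
qed

lemma cont_config_q: "cont_config (qa R j l)" "cont_config (qb R j l)"
  unfolding qa_def qb_def by (intro cont_config_rules)+

lemma centred_wb:
  assumes "ord_bound T p q \<psi>" "cont_config \<psi>" "\<And>e S a b. \<psi> (e, S, a, b) = \<psi> (e, S, a, 0)"
  shows "centred R T (\<lambda>i. \<psi> i * wb i $ j)"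
proof (rule centred_mult_second[where \<xi> = "\<lambda>e v. v $ j" and \<psi> = \<psi>])
  show "ord_bound T (p + 1) (q + 0) (\<lambda>i. \<psi> i * wb i $ j)"
    by (rule ord_bound_mult[OF assms(1) ord_bound_wb])
  show "cont_config (\<lambda>i. \<psi> i * wb i $ j)"
    by (intro cont_config_rules assms)
  show "\<psi> (e, S, a, b) = \<psi> (e, S, a, 0)" for e S a b
    by (rule assms(3))
qed (simp add: noise_law_def)

lemma centred_qb:
  assumes "ord_bound T p q \<psi>" "cont_config \<psi>" "\<And>e S a b. \<psi> (e, S, a, b) = \<psi> (e, S, a, 0)"
  shows "centred R T (\<lambda>i. \<psi> i * qb R j l i)"
proof -
  have "centred R T (\<lambda>i. \<psi> i * (\<lambda>e v. v $ j * v $ l - R $ j $ l * (e\<^sup>2 / 2)) (eps i) (wb i))"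
  proof (rule centred_mult_second)
    fix e \<mu> assume \<mu>: "noise_law R (e\<^sup>2 / 2) \<mu>"
    then interpret prob_space \<mu> by (simp add: noise_law_def)
    have "has_bochner_integral \<mu> (\<lambda>v. v $ j * v $ l) (R $ j $ l * (e\<^sup>2 / 2))"
      using \<mu> by (simp add: noise_law_def)
    from has_bochner_integral_diff[OF this, of "\<lambda>_. R $ j $ l * (e\<^sup>2 / 2)" "R $ j $ l * (e\<^sup>2 / 2)"]
    show "has_bochner_integral \<mu> (\<lambda>v. v $ j * v $ l - R $ j $ l * (e\<^sup>2 / 2)) 0"
      by (simp add: has_bochner_integral_iff prob_space)
  next
    show "ord_bound T (p + 2) (q + 0) (\<lambda>i. \<psi> i * (wb i $ j * wb i $ l - R $ j $ l * ((eps i)\<^sup>2 / 2)))"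
      using ord_bound_mult[OF assms(1) ord_bound_q(2)[of T R j l]] by (simp only: qb_def)
    show "cont_config (\<lambda>i. \<psi> i * (wb i $ j * wb i $ l - R $ j $ l * ((eps i)\<^sup>2 / 2)))"
      by (intro cont_config_rules assms)
    show "\<psi> (e, S, a, b) = \<psi> (e, S, a, 0)" for e S a b
      by (rule assms(3))
  qed
  then show ?thesis by (simp add: qb_def)
qed

lemma centred_noise:
  "centred R T (\<lambda>i. wa i $ j)" "centred R T (\<lambda>i. wb i $ j)"
  "centred R T (qa R j l)" "centred R T (qb R j l)"
  "centred R T (\<lambda>i. wa i $ j * wb i $ l)"
proof -
  show b: "centred R T (\<lambda>i. wb i $ j)"
    using centred_wb[OF ord_bound_const[where c = 1 and q = 0]] by (simp add: cont_config_rules)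
  from centred_swap[OF this] show "centred R T (\<lambda>i. wa i $ j)" by simp
  show b: "centred R T (qb R j l)"
    using centred_qb[OF ord_bound_const[where c = 1 and q = 0]] by (simp add: cont_config_rules)
  from centred_swap[OF this] show "centred R T (qa R j l)" by simp
  show "centred R T (\<lambda>i. wa i $ j * wb i $ l)"
    by (rule centred_wb[OF ord_bound_wa]) (auto intro: cont_config_rules)
qed

text \<open>The product \<open>\<Psi> i * B i\<close> is a martingale increment, so only the
  remainder contributes to the growth of the expectation.\<close>

lemma one_step_expectation:
  fixes Y X \<Psi> B :: "('d::finite, 'm::finite) config \<Rightarrow> real" and R :: "real^'m^'m"
  assumes "centred R T B"
    and X: "\<And>e S v. X (e, S, v) = X (e, S, 0)" and \<Psi>: "\<And>e S v. \<Psi> (e, S, v) = \<Psi> (e, S, 0)"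
    and "ord_bound T p q (\<lambda>i. Y i - X i - \<Psi> i * B i)" "cont_config (\<lambda>i. Y i - X i - \<Psi> i * B i)"
  shows "\<exists>C\<ge>0. \<forall>e S Q. 0 < e \<longrightarrow> e\<^sup>2 \<le> T \<longrightarrow> noise_pair R e Q \<longrightarrow>
    integrable Q (\<lambda>v. Y (e, S, v)) \<and> (\<integral>v. Y (e, S, v) \<partial>Q) \<le> X (e, S, 0) + C * (e ^ p * ell e S ^ q)"
proof -
  obtain C where C: "0 \<le> C" "\<And>e S Q. 0 < e \<Longrightarrow> e\<^sup>2 \<le> T \<Longrightarrow> noise_pair R e Q \<Longrightarrow>
    integrable Q (\<lambda>v. Y (e, S, v) - X (e, S, v) - \<Psi> (e, S, v) * B (e, S, v)) \<and>
    \<bar>\<integral>v. Y (e, S, v) - X (e, S, v) - \<Psi> (e, S, v) * B (e, S, v) \<partial>Q\<bar> \<le> C * (e ^ p * ell e S ^ q)"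
    using ord_bound_integral[OF assms(4,5), of R] by blast
  show ?thesis
  proof (intro exI[of _ C] conjI[OF C(1)] allI impI)
    fix e :: real and S :: "'d state" and Q :: "((real^'m) \<times> (real^'m)) measure"
    assume e: "0 < e" "e\<^sup>2 \<le> T" and Q: "noise_pair R e Q"
    interpret prob_space Q using Q by (rule noise_pair_prob_space)
    let ?G = "\<lambda>v. Y (e, S, v) - X (e, S, v) - \<Psi> (e, S, v) * B (e, S, v)"
    have G: "has_bochner_integral Q ?G (integral\<^sup>L Q ?G)"
      using C(2)[OF e Q] by (blast intro: has_bochner_integral_integrable)
    have B: "has_bochner_integral Q (\<lambda>v. \<Psi> (e, S, 0) * B (e, S, v)) (\<Psi> (e, S, 0) * 0)"
      by (intro has_bochner_integral_mult_right centredD[OF assms(1) e Q])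
    have c: "has_bochner_integral Q (\<lambda>v. X (e, S, 0)) (X (e, S, 0))"
      by (simp add: has_bochner_integral_iff prob_space)
    have "has_bochner_integral Q (\<lambda>v. ?G v + (X (e, S, 0) + \<Psi> (e, S, 0) * B (e, S, v)))
        (integral\<^sup>L Q ?G + (X (e, S, 0) + \<Psi> (e, S, 0) * 0))"
      by (intro has_bochner_integral_add G B c)
    moreover have "?G v + (X (e, S, 0) + \<Psi> (e, S, 0) * B (e, S, v)) = Y (e, S, v)" for v
      using X[of e S v] \<Psi>[of e S v] by simp
    ultimately have "has_bochner_integral Q (\<lambda>v. Y (e, S, v)) (integral\<^sup>L Q ?G + X (e, S, 0))"
      by simp
    then show "integrable Q (\<lambda>v. Y (e, S, v)) \<and> (\<integral>v. Y (e, S, v) \<partial>Q) \<le> X (e, S, 0) + C * (e ^ p * ell e S ^ q)"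
      using C(2)[OF e Q, of S] by (auto simp: has_bochner_integral_iff)
  qed
qed

text \<open>With \<open>D = Y - X\<close>, expand \<open>Y ^ 4 - X ^ 4\<close> in powers of
  \<open>D\<close> and remove the centred part \<open>4 * X ^ 3 * (D - A)\<close>. The drift
  \<open>A\<close> has two powers of \<open>e\<close> more than \<open>X\<close>, and all other
  terms contain at least two factors \<open>D\<close>, each with one power more; so every remaining
  term gains \<open>e ^ 2\<close>.\<close>

lemma one_step_fourth_moment:
  fixes Y X A :: "('d::finite, 'm::finite) config \<Rightarrow> real" and R :: "real^'m^'m"
  assumes "centred R T (\<lambda>i. Y i - X i - A i)" "\<And>e S v. X (e, S, v) = X (e, S, 0)"
    and X: "ord_bound T p q X" and A: "ord_bound T (p + 2) q A" and D: "ord_bound T (p + 1) q (\<lambda>i. Y i - X i)"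
    and "cont_config Y" "cont_config X" "cont_config A"
  shows "\<exists>C\<ge>0. \<forall>e S Q. 0 < e \<longrightarrow> e\<^sup>2 \<le> T \<longrightarrow> noise_pair R e Q \<longrightarrow>
    integrable Q (\<lambda>v. Y (e, S, v) ^ 4) \<and>
    (\<integral>v. Y (e, S, v) ^ 4 \<partial>Q) \<le> X (e, S, 0) ^ 4 + C * (e ^ (4 * p + 2) * ell e S ^ (4 * q))"
proof (rule one_step_expectation[where X = "\<lambda>i. X i ^ 4" and Y = "\<lambda>i. Y i ^ 4"
      and \<Psi> = "\<lambda>i. 4 * X i ^ 3" and B = "\<lambda>i. Y i - X i - A i"])
  let ?D = "\<lambda>i. Y i - X i"
  have "ord_bound T (4 * p + 2) (4 * q)
      (\<lambda>i. 4 * (X i ^ 3 * A i) + 6 * (X i ^ 2 * ?D i ^ 2) + 4 * (X i * ?D i ^ 3) + ?D i ^ 4)"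
    by (intro ord_bound_add ord_bound_cmult
        ord_bound_mult'[OF ord_bound_power[OF X] A] ord_bound_mult'[OF ord_bound_power[OF X] ord_bound_power[OF D]]
        ord_bound_mult'[OF X ord_bound_power[OF D]] ord_bound_mono[OF ord_bound_power[OF D]]) auto
  moreover have "Y i ^ 4 - X i ^ 4 - 4 * X i ^ 3 * (Y i - X i - A i)
     = 4 * (X i ^ 3 * A i) + 6 * (X i ^ 2 * ?D i ^ 2) + 4 * (X i * ?D i ^ 3) + ?D i ^ 4" for i
    by (simp add: power4_eq_xxxx power3_eq_cube power2_eq_square algebra_simps)
  ultimately show "ord_bound T (4 * p + 2) (4 * q) (\<lambda>i. Y i ^ 4 - X i ^ 4 - 4 * X i ^ 3 * (Y i - X i - A i))"
    by simp
  show "X (e, S, v) ^ 4 = X (e, S, 0) ^ 4" "4 * X (e, S, v) ^ 3 = 4 * X (e, S, 0) ^ 3" for e S v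
    by (simp_all only: assms(2)[of e S v])
  show "cont_config (\<lambda>i. Y i ^ 4 - X i ^ 4 - 4 * X i ^ 3 * (Y i - X i - A i))"
    by (intro cont_config_rules assms)
qed (rule assms(1))

lemma one_step_second_moment:
  fixes Y X A :: "('d::finite, 'm::finite) config \<Rightarrow> real" and R :: "real^'m^'m"
  assumes "centred R T (\<lambda>i. Y i - X i - A i)" "\<And>e S v. X (e, S, v) = X (e, S, 0)"
    and X: "ord_bound T p q X" and A: "ord_bound T (p + 2) q A" and D: "ord_bound T (p + 1) q (\<lambda>i. Y i - X i)"
    and "cont_config Y" "cont_config X" "cont_config A"
  shows "\<exists>C\<ge>0. \<forall>e S Q. 0 < e \<longrightarrow> e\<^sup>2 \<le> T \<longrightarrow> noise_pair R e Q \<longrightarrow>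
    integrable Q (\<lambda>v. Y (e, S, v) ^ 2) \<and>
    (\<integral>v. Y (e, S, v) ^ 2 \<partial>Q) \<le> X (e, S, 0) ^ 2 + C * (e ^ (2 * p + 2) * ell e S ^ (2 * q))"
proof (rule one_step_expectation[where X = "\<lambda>i. X i ^ 2" and Y = "\<lambda>i. Y i ^ 2"
      and \<Psi> = "\<lambda>i. 2 * X i" and B = "\<lambda>i. Y i - X i - A i"])
  let ?D = "\<lambda>i. Y i - X i"
  have "ord_bound T (2 * p + 2) (2 * q) (\<lambda>i. 2 * (X i * A i) + ?D i ^ 2)"
    by (intro ord_bound_add ord_bound_cmult ord_bound_mult'[OF X A] ord_bound_mono[OF ord_bound_power[OF D]]) auto
  moreover have "Y i ^ 2 - X i ^ 2 - 2 * X i * (Y i - X i - A i) = 2 * (X i * A i) + ?D i ^ 2" for i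
    by (simp add: power4_eq_xxxx power3_eq_cube power2_eq_square algebra_simps)
  ultimately show "ord_bound T (2 * p + 2) (2 * q) (\<lambda>i. Y i ^ 2 - X i ^ 2 - 2 * X i * (Y i - X i - A i))"
    by simp
  show "X (e, S, v) ^ 2 = X (e, S, 0) ^ 2" "2 * X (e, S, v) = 2 * X (e, S, 0)" for e S v
    by (simp_all only: assms(2)[of e S v])
  show "cont_config (\<lambda>i. Y i ^ 2 - X i ^ 2 - 2 * X i * (Y i - X i - A i))"
    by (intro cont_config_rules assms)
qed (rule assms(1))

subsection \<open>One step of the coupled scheme\<close>

text \<open>Choice makes the constant a function of the coordinate, so that the constants can be
  summed over all coordinates.\<close>

lemma choose_constants:
  fixes V :: "'k \<Rightarrow> real \<Rightarrow> 's \<Rightarrow> 'q \<Rightarrow> real"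
  assumes "\<And>k. \<exists>C\<ge>0. \<forall>e S Q. 0 < e \<longrightarrow> e\<^sup>2 \<le> T \<longrightarrow> N e Q \<longrightarrow> I k e S Q \<and> V k e S Q \<le> X k S + C * B e S"
  obtains C :: "'k \<Rightarrow> real" where "\<And>k. 0 \<le> C k"
    "\<And>k e S Q. 0 < e \<Longrightarrow> e\<^sup>2 \<le> T \<Longrightarrow> N e Q \<Longrightarrow> I k e S Q \<and> V k e S Q \<le> X k S + C k * B e S"
proof -
  from choice[OF allI[OF assms]] obtain C where C: "\<forall>k. 0 \<le> C k \<and> (\<forall>e S Q. 0 < e \<longrightarrow> e\<^sup>2 \<le> T \<longrightarrow> N e Q \<longrightarrow>
      I k e S Q \<and> V k e S Q \<le> X k S + C k * B e S)" ..
  show thesis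
    by (rule that[of C]) (use C in blast)+
qed

locale milstein_scheme =
  fixes f :: "real^'d::finite \<Rightarrow> real^'d" and g :: "real^'d \<Rightarrow> real^'m::finite^'d"
    and R :: "real^'m^'m" and T :: real
  assumes C2_f: "\<And>i. C2_fun (\<lambda>x. f x $ i)" and C2_g: "\<And>i j. C2_fun (\<lambda>x. g x $ i $ j)"
    and bounded: "bounded_derivs_R f g"
begin

text \<open>Since \<open>partial\<close> is defined by \<open>deriv\<close>, bounds on the partial
  derivatives of \<open>h_coeff\<close> give a Lipschitz bound only once differentiability is
  known.\<close>

lemma h_coeff_differentiable: "h_coeff g i j k differentiable (at x)"
proof -
  have "(\<lambda>x. 1/2 * (\<Sum>l\<in>UNIV. g x $ l $ k * partial l (\<lambda>y. g y $ i $ j) x)) differentiable (at x)"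
    by (intro differentiable_mult differentiable_sum differentiable_const finite ballI C2_fun_differentiable C2_g)
  then show ?thesis
    unfolding h_coeff_def[abs_def] .
qed

lemma lipschitz_coeffs:
  "lipschitz_fun (\<lambda>x. f x $ i)" "lipschitz_fun (\<lambda>x. g x $ i $ j)" "lipschitz_fun (h_coeff g i j k)"
  "lipschitz_fun (partial l (\<lambda>x. f x $ i))" "lipschitz_fun (partial l (\<lambda>x. g x $ i $ j))"
proof -
  obtain K where "\<forall>x. (\<forall>i l. \<bar>partial l (\<lambda>y. f y $ i) x\<bar> \<le> K) \<and>
     (\<forall>i j l. \<bar>partial l (\<lambda>y. g y $ i $ j) x\<bar> \<le> K) \<and>
     (\<forall>i j k l. \<bar>partial l (h_coeff g i j k) x\<bar> \<le> K) \<and>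
     (\<forall>i l m. \<bar>partial m (partial l (\<lambda>y. f y $ i)) x\<bar> \<le> K) \<and>
     (\<forall>i j l m. \<bar>partial m (partial l (\<lambda>y. g y $ i $ j)) x\<bar> \<le> K)"
    using bounded unfolding bounded_derivs_R_def ..
  then show "lipschitz_fun (\<lambda>x. f x $ i)" "lipschitz_fun (\<lambda>x. g x $ i $ j)" "lipschitz_fun (h_coeff g i j k)"
    "lipschitz_fun (partial l (\<lambda>x. f x $ i))" "lipschitz_fun (partial l (\<lambda>x. g x $ i $ j))"
    by (auto intro!: lipschitz_fun_bounded_partials[where K = K] C2_fun_differentiable C2_f C2_g h_coeff_differentiable)
qed

lemma taylor_coeffs: "taylor_fun (\<lambda>x. f x $ i)" "taylor_fun (\<lambda>x. g x $ i $ j)"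
  by (auto intro!: taylor_fun_bounded_partials lipschitz_coeffs C2_fun_differentiable C2_f C2_g)

lemma continuous_coeffs:
  "continuous_on UNIV (\<lambda>x. f x $ i)" "continuous_on UNIV (\<lambda>x. g x $ i $ j)" "continuous_on UNIV (h_coeff g i j k)"
  "continuous_on UNIV (partial l (\<lambda>x. f x $ i))" "continuous_on UNIV (partial l (\<lambda>x. g x $ i $ j))"
  by (intro lipschitz_fun_continuous lipschitz_coeffs)+

lemma ord_bound_partials:
  "ord_bound T 0 0 (\<lambda>i. partial l (\<lambda>x. f x $ k) (X i))" "ord_bound T 0 0 (\<lambda>i. partial l (\<lambda>x. g x $ k $ j) (X i))"
proof -
  obtain K where K: "\<And>x k l. \<bar>partial l (\<lambda>y. f y $ k) x\<bar> \<le> K" "\<And>x k j l. \<bar>partial l (\<lambda>y. g y $ k $ j) x\<bar> \<le> K"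
    using bounded unfolding bounded_derivs_R_def by (elim exE) (rule that; blast)
  show "ord_bound T 0 0 (\<lambda>i. partial l (\<lambda>x. f x $ k) (X i))"
    "ord_bound T 0 0 (\<lambda>i. partial l (\<lambda>x. g x $ k $ j) (X i))"
    by (rule ord_bound_le[OF ord_bound_const[where c = K]] order_trans[OF K(1) abs_ge_self] order_trans[OF K(2) abs_ge_self])+
qed

text \<open>\<open>yf\<close> and \<open>zf\<close> are the midpoint and the endpoint of one fine
  step; composition with \<open>swap\<close> yields the antithetic ones. The coarse endpoint
  \<open>zc\<close> is driven by the same two half increments.\<close>

definition yf :: "('d, 'm) config \<Rightarrow> real^'d" where
  "yf i = milstein_step f g R (xf i) ((eps i)\<^sup>2 / 2) (wa i)"
definition zf :: "('d, 'm) config \<Rightarrow> real^'d" where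
  "zf i = milstein_step f g R (yf i) ((eps i)\<^sup>2 / 2) (wb i)"
definition zc :: "('d, 'm) config \<Rightarrow> real^'d" where
  "zc i = milstein_step f g R (xc i) ((eps i)\<^sup>2) (wa i + wb i)"

text \<open>The quadratic factor of the whole step, written as four pieces that are centred
  separately; \<open>qa\<close> and \<open>qb\<close> carry one half of the compensator
  each.\<close>

abbreviation coarse_q :: "'m \<Rightarrow> 'm \<Rightarrow> ('d, 'm) config \<Rightarrow> real" where
  "coarse_q j l i \<equiv> qa R j l i + qb R j l i + wa i $ j * wb i $ l + wb i $ j * wa i $ l"

lemma yf_eq: "yf i $ k = xf i $ k + f (xf i) $ k * ((eps i)\<^sup>2 / 2) + (\<Sum>j\<in>UNIV. g (xf i) $ k $ j * wa i $ j)
    + (\<Sum>j\<in>UNIV. \<Sum>l\<in>UNIV. h_coeff g k j l (xf i) * qa R j l i)"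
  by (simp add: yf_def milstein_step_def qa_def)

lemma zf_eq: "zf i $ k = yf i $ k + f (yf i) $ k * ((eps i)\<^sup>2 / 2) + (\<Sum>j\<in>UNIV. g (yf i) $ k $ j * wb i $ j)
    + (\<Sum>j\<in>UNIV. \<Sum>l\<in>UNIV. h_coeff g k j l (yf i) * qb R j l i)"
  by (simp add: zf_def milstein_step_def qb_def)

lemma zc_eq: "zc i $ k = xc i $ k + f (xc i) $ k * (eps i)\<^sup>2 + (\<Sum>j\<in>UNIV. g (xc i) $ k $ j * (wa i $ j + wb i $ j))
    + (\<Sum>j\<in>UNIV. \<Sum>l\<in>UNIV. h_coeff g k j l (xc i) * coarse_q j l i)"
proof -
  have "(wa i $ j + wb i $ j) * (wa i $ l + wb i $ l) - R $ j $ l * (eps i)\<^sup>2 = coarse_q j l i" for j l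
    by (simp add: qa_def qb_def field_simps)
  then show ?thesis
    by (simp add: zc_def milstein_step_def)
qed

lemma cont_config_milstein_step:
  assumes X: "\<And>k. cont_config (\<lambda>i. X i $ k)" and t: "cont_config t" and v: "\<And>j. cont_config (\<lambda>i. v i $ j)"
  shows "cont_config (\<lambda>i. milstein_step f g R (X i) (t i) (v i) $ k)"
  unfolding milstein_step_def vec_lambda_beta
  by (intro cont_config_rules X t v cont_config_compose[where u = "\<lambda>x. f x $ k"]
      cont_config_compose[where u = "\<lambda>x. g x $ k $ j" for j] cont_config_compose[where u = "h_coeff g k j l" for j l]
      continuous_coeffs)

lemma cont_config_yf: "cont_config (\<lambda>i. yf i $ k)"
  and cont_config_zf: "cont_config (\<lambda>i. zf i $ k)"
  and cont_config_zc: "cont_config (\<lambda>i. zc i $ k)"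
proof -
  show y: "cont_config (\<lambda>i. yf i $ k)" for k
    unfolding yf_def by (intro cont_config_milstein_step cont_config_rules)
  show "cont_config (\<lambda>i. zf i $ k)"
    unfolding zf_def by (intro cont_config_milstein_step cont_config_rules y)
  show "cont_config (\<lambda>i. zc i $ k)"
    unfolding zc_def vector_add_component
    by (intro cont_config_milstein_step, auto intro!: cont_config_rules)
qed

lemmas cont_config_coeffs =
  cont_config_compose[OF continuous_coeffs(1)] cont_config_compose[OF continuous_coeffs(2)]
  cont_config_compose[OF continuous_coeffs(3)] cont_config_compose[OF continuous_coeffs(4)]
  cont_config_compose[OF continuous_coeffs(5)]

lemmas cont_config_scheme = cont_config_rules cont_config_q cont_config_yf cont_config_zf cont_config_zc cont_config_coeffs

lemmas ord_bound_growth_coeffs =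
  ord_bound_growth[OF lipschitz_coeffs(1)] ord_bound_growth[OF lipschitz_coeffs(2)] ord_bound_growth[OF lipschitz_coeffs(3)]
lemmas ord_bound_lipschitz_coeffs =
  ord_bound_lipschitz[OF lipschitz_coeffs(1)] ord_bound_lipschitz[OF lipschitz_coeffs(2)] ord_bound_lipschitz[OF lipschitz_coeffs(3)]

lemma ord_bound_half_eps2: "ord_bound T 2 0 (\<lambda>i. (eps i)\<^sup>2 / 2)"
  by (intro ord_bound_divide ord_bound_eps2)

lemma ord_bound_sum_wa:
  assumes "\<And>j. ord_bound T p q (u j)" "P \<le> p + 1" "q \<le> Q"
  shows "ord_bound T P Q (\<lambda>i. \<Sum>j\<in>UNIV. u j i * wa i $ j)"
  by (intro ord_bound_sum ord_bound_mult'[OF assms(1) ord_bound_wa]) (use assms in auto)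

lemma ord_bound_sum_wb:
  assumes "\<And>j. ord_bound T p q (u j)" "P \<le> p + 1" "q \<le> Q"
  shows "ord_bound T P Q (\<lambda>i. \<Sum>j\<in>UNIV. u j i * wb i $ j)"
  by (intro ord_bound_sum ord_bound_mult'[OF assms(1) ord_bound_wb]) (use assms in auto)

lemma ord_bound_sum_dw:
  assumes "\<And>j. ord_bound T p q (u j)" "P \<le> p + 1" "q \<le> Q"
  shows "ord_bound T P Q (\<lambda>i. \<Sum>j\<in>UNIV. u j i * (wa i $ j + wb i $ j))"
  by (intro ord_bound_sum ord_bound_mult'[OF assms(1) ord_bound_add[OF ord_bound_wa ord_bound_wb]]) (use assms in auto)

lemma ord_bound_sum_q:
  assumes "\<And>j l. ord_bound T p q (u j l)" "\<And>j l. ord_bound T 2 0 (Z j l)" "P \<le> p + 2" "q \<le> Q"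
  shows "ord_bound T P Q (\<lambda>i. \<Sum>j\<in>UNIV. \<Sum>l\<in>UNIV. u j l i * Z j l i)"
  by (intro ord_bound_sum ord_bound_mult'[OF assms(1,2)]) (use assms in auto)

lemma ord_bound_coarse_q: "ord_bound T 2 0 (coarse_q j l)"
  by (intro ord_bound_add ord_bound_q ord_bound_mult'[OF ord_bound_wa ord_bound_wb] ord_bound_mult'[OF ord_bound_wb ord_bound_wa]) auto

lemma ord_bound_half_drift:
  assumes "ord_bound T p q u" "P \<le> p + 2" "q \<le> Q"
  shows "ord_bound T P Q (\<lambda>i. u i * ((eps i)\<^sup>2 / 2))"
  by (rule ord_bound_mult'[OF assms(1) ord_bound_half_eps2]) (use assms in auto)

lemma ord_bound_drift:
  assumes "ord_bound T p q u" "P \<le> p + 2" "q \<le> Q"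
  shows "ord_bound T P Q (\<lambda>i. u i * (eps i)\<^sup>2)"
  by (rule ord_bound_mult'[OF assms(1) ord_bound_eps2]) (use assms in auto)

lemma ord_bound_yf_diff2:
  "ord_bound T 2 1 (\<lambda>i. yf i $ k - xf i $ k - (\<Sum>j\<in>UNIV. g (xf i) $ k $ j * wa i $ j))"
proof -
  have "ord_bound T 2 1 (\<lambda>i. f (xf i) $ k * ((eps i)\<^sup>2 / 2) + (\<Sum>j\<in>UNIV. \<Sum>l\<in>UNIV. h_coeff g k j l (xf i) * qa R j l i))"
    by (rule ord_bound_add ord_bound_half_drift ord_bound_sum_q ord_bound_growth_coeffs ord_bound_xf ord_bound_q | simp)+
  then show ?thesis by (simp add: yf_eq)
qed

lemma ord_bound_yf_diff: "ord_bound T 1 1 (\<lambda>i. yf i $ k - xf i $ k)"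
proof -
  have "ord_bound T 1 1 (\<lambda>i. (yf i $ k - xf i $ k - (\<Sum>j\<in>UNIV. g (xf i) $ k $ j * wa i $ j))
      + (\<Sum>j\<in>UNIV. g (xf i) $ k $ j * wa i $ j))"
    by (rule ord_bound_add ord_bound_mono[OF ord_bound_yf_diff2] ord_bound_sum_wa ord_bound_growth_coeffs ord_bound_xf | simp)+
  then show ?thesis by simp
qed

lemma ord_bound_yf: "ord_bound T 0 1 (\<lambda>i. yf i $ k)"
proof -
  have "ord_bound T 0 1 (\<lambda>i. (yf i $ k - xf i $ k) + xf i $ k)"
    by (rule ord_bound_add ord_bound_mono[OF ord_bound_yf_diff] ord_bound_xf | simp)+
  then show ?thesis by simp
qed

section \<open>First-order decomposition of the refined steps and fourth moments\<close>

definition drift :: "'d \<Rightarrow> ('d, 'm) config \<Rightarrow> real" where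
  "drift k i = (f (xf i) $ k + f (yf i) $ k) * ((eps i)\<^sup>2 / 2)"

text \<open>The centred terms of order e^2 that remain when \<open>g\<close> is frozen at the
  initial state of the step.\<close>

definition fluct :: "'d \<Rightarrow> ('d, 'm) config \<Rightarrow> real" where
  "fluct k i = (\<Sum>j\<in>UNIV. (g (yf i) $ k $ j - g (xf i) $ k $ j) * wb i $ j)
     + (\<Sum>j\<in>UNIV. \<Sum>l\<in>UNIV. h_coeff g k j l (xf i) * qa R j l i)
     + (\<Sum>j\<in>UNIV. \<Sum>l\<in>UNIV. h_coeff g k j l (yf i) * qb R j l i)"

lemma zf_decomp:
  "zf i $ k = xf i $ k + drift k i + (\<Sum>j\<in>UNIV. g (xf i) $ k $ j * (wa i $ j + wb i $ j)) + fluct k i"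
  unfolding zf_eq yf_eq drift_def fluct_def
  by (simp add: distrib_left left_diff_distrib sum.distrib sum_subtractf algebra_simps)

lemma ord_bound_drift_term: "ord_bound T 2 1 (drift k)"
  unfolding drift_def
  by (rule ord_bound_half_drift ord_bound_add ord_bound_growth_coeffs ord_bound_xf ord_bound_yf | simp)+

lemma ord_bound_fluct: "ord_bound T 2 1 (fluct k)"
  unfolding fluct_def
  by (rule ord_bound_add ord_bound_sum_q ord_bound_growth_coeffs ord_bound_xf ord_bound_yf ord_bound_q
      ord_bound_sum_wb[where p = 1 and q = 1] ord_bound_lipschitz_coeffs ord_bound_yf_diff | simp)+

lemma ord_bound_zf_diff: "ord_bound T 1 1 (\<lambda>i. zf i $ k - xf i $ k)"
proof -
  have "ord_bound T 1 1 (\<lambda>i. drift k i + (\<Sum>j\<in>UNIV. g (xf i) $ k $ j * (wa i $ j + wb i $ j)) + fluct k i)"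
    by (rule ord_bound_add ord_bound_mono[OF ord_bound_drift_term] ord_bound_mono[OF ord_bound_fluct]
        ord_bound_sum_dw[where p = 0 and q = 1] ord_bound_growth_coeffs ord_bound_xf | simp)+
  then show ?thesis by (simp add: zf_decomp add.assoc)
qed

lemma centred_dw:
  assumes "\<And>e S v j. u j (e, S, v) = u j (e, S, 0)"
  shows "centred R T (\<lambda>i. \<Sum>j\<in>UNIV. u j i * (wa i $ j + wb i $ j))"
  by (intro centred_sum centred_mult_state centred_add centred_noise assms)

text \<open>Coefficients at \<open>yf\<close> are functions of the state and the first half
  increment, hence fixed when the second half increment is integrated.\<close>

lemma centred_fluct: "centred R T (fluct k)"
  unfolding fluct_def
proof (intro centred_add centred_sum)
  show "centred R T (\<lambda>i. (g (yf i) $ k $ j - g (xf i) $ k $ j) * wb i $ j)" for j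
    by (rule centred_wb[OF ord_bound_lipschitz_coeffs(2)[OF ord_bound_yf_diff]])
      (intro cont_config_scheme, simp add: yf_def)
  show "centred R T (\<lambda>i. h_coeff g k j l (xf i) * qa R j l i)" for j l
    by (rule centred_mult_state[OF centred_noise(3)]) simp
  show "centred R T (\<lambda>i. h_coeff g k j l (yf i) * qb R j l i)" for j l
    by (rule centred_qb[OF ord_bound_growth_coeffs(3)[OF ord_bound_yf]])
      (intro cont_config_scheme, simp add: yf_def)
qed

lemma cont_config_drift_term: "cont_config (drift k)"
  unfolding drift_def by (intro cont_config_scheme)

lemma fine_fourth_moment:
  "\<exists>C\<ge>0. \<forall>e S Q. 0 < e \<longrightarrow> e\<^sup>2 \<le> T \<longrightarrow> noise_pair R e Q \<longrightarrow>
    integrable Q (\<lambda>v. (zf (e, S, v) $ k) ^ 4) \<and>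
    (\<integral>v. (zf (e, S, v) $ k) ^ 4 \<partial>Q) \<le> (xf (e, S, 0 :: (real^'m) \<times> (real^'m)) $ k) ^ 4 + C * (e ^ (4 * 0 + 2) * ell e S ^ (4 * 1))"
proof (rule one_step_fourth_moment[where A = "drift k" and X = "\<lambda>i. xf i $ k"])
  have "centred R T (\<lambda>i. (\<Sum>j\<in>UNIV. g (xf i) $ k $ j * (wa i $ j + wb i $ j)) + fluct k i)"
    by (intro centred_add centred_dw centred_fluct) simp
  then show "centred R T (\<lambda>i. zf i $ k - xf i $ k - drift k i)"
    by (simp add: zf_decomp algebra_simps)
  show "ord_bound T (0 + 1) 1 (\<lambda>i. zf i $ k - xf i $ k)"
    by (rule ord_bound_mono[OF ord_bound_zf_diff]) auto
  show "ord_bound T (0 + 2) 1 (drift k)"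
    by (rule ord_bound_mono[OF ord_bound_drift_term]) auto
qed (auto intro: ord_bound_xf[simplified] cont_config_scheme cont_config_drift_term)

lemma antithetic_fourth_moment:
  "\<exists>C\<ge>0. \<forall>e S Q. 0 < e \<longrightarrow> e\<^sup>2 \<le> T \<longrightarrow> noise_pair R e Q \<longrightarrow>
    integrable Q (\<lambda>v. (zf (swap (e, S, v)) $ k) ^ 4) \<and>
    (\<integral>v. (zf (swap (e, S, v)) $ k) ^ 4 \<partial>Q) \<le> (xa (e, S, 0 :: (real^'m) \<times> (real^'m)) $ k) ^ 4 + C * (e ^ (4 * 0 + 2) * ell e S ^ (4 * 1))"
proof (rule one_step_fourth_moment[where A = "\<lambda>i. drift k (swap i)" and X = "\<lambda>i. xa i $ k" and Y = "\<lambda>i. zf (swap i) $ k"])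
  have "centred R T (\<lambda>i. (\<Sum>j\<in>UNIV. g (xf i) $ k $ j * (wa i $ j + wb i $ j)) + fluct k i)"
    by (intro centred_add centred_dw centred_fluct) simp
  from centred_swap[OF this] show "centred R T (\<lambda>i. zf (swap i) $ k - xa i $ k - drift k (swap i))"
    by (simp add: zf_decomp algebra_simps)
  show "ord_bound T (0 + 1) 1 (\<lambda>i. zf (swap i) $ k - xa i $ k)"
    using ord_bound_swap[OF ord_bound_zf_diff] by simp
  show "ord_bound T (0 + 2) 1 (\<lambda>i. drift k (swap i))"
    by (rule ord_bound_mono[OF ord_bound_swap[OF ord_bound_drift_term]]) auto
  show "cont_config (\<lambda>i. drift k (swap i))"
    by (rule cont_config_swap[OF cont_config_drift_term])
  show "cont_config (\<lambda>i. zf (swap i) $ k)"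
    by (rule cont_config_swap[OF cont_config_zf])
qed (auto intro: ord_bound_xa[simplified] cont_config_scheme)

lemma ord_bound_yf_swap_diff: "ord_bound T 1 1 (\<lambda>i. yf (swap i) $ k - xa i $ k)"
  using ord_bound_swap[OF ord_bound_yf_diff] by simp

text \<open>Both \<open>xf - xa\<close> and the moves from the initial states to the midpoints are
  of order \<open>e * ell\<close>. By the Lipschitz property of \<open>f\<close>, the factor
  \<open>e ^ 2\<close> then leads to order 3.\<close>

lemma ord_bound_drift_difference: "ord_bound T 3 1 (\<lambda>i. drift k i - drift k (swap i))"
proof -
  have "ord_bound T 3 1 (\<lambda>i. (f (xf i) $ k - f (xa i) $ k) * (eps i)\<^sup>2
      + ((f (yf i) $ k - f (xf i) $ k) * ((eps i)\<^sup>2 / 2) - (f (yf (swap i)) $ k - f (xa i) $ k) * ((eps i)\<^sup>2 / 2)))"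
    by (rule ord_bound_add ord_bound_diff ord_bound_drift[where p = 1 and q = 1] ord_bound_half_drift[where p = 1 and q = 1]
        ord_bound_lipschitz_coeffs ord_bound_xf_xa ord_bound_yf_diff ord_bound_yf_swap_diff | simp)+
  then show ?thesis
    by (simp add: drift_def algebra_simps)
qed

lemma zf_difference_decomp:
  "zf i $ k - zf (swap i) $ k = (xf i $ k - xa i $ k) + (drift k i - drift k (swap i))
    + ((\<Sum>j\<in>UNIV. (g (xf i) $ k $ j - g (xa i) $ k $ j) * (wa i $ j + wb i $ j)) + (fluct k i - fluct k (swap i)))"
  unfolding zf_decomp
  by (simp add: left_diff_distrib sum_subtractf add.commute)

lemma ord_bound_zf_difference_increment:
  "ord_bound T 2 1 (\<lambda>i. (zf i $ k - zf (swap i) $ k) - (xf i $ k - xa i $ k))"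
proof -
  have "ord_bound T 2 1 (\<lambda>i. (drift k i - drift k (swap i))
    + ((\<Sum>j\<in>UNIV. (g (xf i) $ k $ j - g (xa i) $ k $ j) * (wa i $ j + wb i $ j)) + (fluct k i - fluct k (swap i))))"
    by (rule ord_bound_add ord_bound_mono[OF ord_bound_drift_difference] ord_bound_diff[OF ord_bound_fluct ord_bound_swap[OF ord_bound_fluct]]
        ord_bound_sum_dw[where p = 1 and q = 1] ord_bound_lipschitz_coeffs ord_bound_xf_xa | simp)+
  then show ?thesis
    unfolding zf_difference_decomp add.assoc add_diff_cancel_left' .
qed

text \<open>The case of exponents 1 and 1 of the general estimate: relative to a difference of size
  \<open>e * ell\<close>, the increment may be of order 2, so no cancellation between
  \<open>fluct\<close> and its swapped version is used, but the drift must be of order 3.\<close>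

lemma difference_fourth_moment:
  "\<exists>C\<ge>0. \<forall>e S Q. 0 < e \<longrightarrow> e\<^sup>2 \<le> T \<longrightarrow> noise_pair R e Q \<longrightarrow>
    integrable Q (\<lambda>v. (zf (e, S, v) $ k - zf (swap (e, S, v)) $ k) ^ 4) \<and>
    (\<integral>v. (zf (e, S, v) $ k - zf (swap (e, S, v)) $ k) ^ 4 \<partial>Q)
      \<le> (xf (e, S, 0 :: (real^'m) \<times> (real^'m)) $ k - xa (e, S, 0 :: (real^'m) \<times> (real^'m)) $ k) ^ 4
        + C * (e ^ (4 * 1 + 2) * ell e S ^ (4 * 1))"
proof (rule one_step_fourth_moment[where A = "\<lambda>i. drift k i - drift k (swap i)" and X = "\<lambda>i. xf i $ k - xa i $ k"
      and Y = "\<lambda>i. zf i $ k - zf (swap i) $ k"])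
  have "centred R T (\<lambda>i. (\<Sum>j\<in>UNIV. (g (xf i) $ k $ j - g (xa i) $ k $ j) * (wa i $ j + wb i $ j)) + (fluct k i - fluct k (swap i)))"
    by (intro centred_add centred_diff centred_dw centred_swap[OF centred_fluct] centred_fluct) simp
  then show "centred R T (\<lambda>i. zf i $ k - zf (swap i) $ k - (xf i $ k - xa i $ k) - (drift k i - drift k (swap i)))"
    unfolding zf_difference_decomp by (simp add: algebra_simps)
  show "ord_bound T (1 + 1) 1 (\<lambda>i. (zf i $ k - zf (swap i) $ k) - (xf i $ k - xa i $ k))"
    by (rule ord_bound_mono[OF ord_bound_zf_difference_increment]) auto
  show "ord_bound T (1 + 2) 1 (\<lambda>i. drift k i - drift k (swap i))"
    by (rule ord_bound_mono[OF ord_bound_drift_difference]) auto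
  show "cont_config (\<lambda>i. drift k i - drift k (swap i))"
    by (intro cont_config_scheme cont_config_drift_term)
  show "cont_config (\<lambda>i. zf i $ k - zf (swap i) $ k)"
    by (intro cont_config_scheme)
qed (auto intro: ord_bound_xf_xa[simplified] cont_config_scheme)

section \<open>Second-order expansion of the fine step\<close>

definition grad_incr :: "(real^'d \<Rightarrow> real) \<Rightarrow> ('d, 'm) config \<Rightarrow> real" where
  "grad_incr u i = (\<Sum>l\<in>UNIV. partial l u (xf i) * (\<Sum>m\<in>UNIV. g (xf i) $ l $ m * wa i $ m))"

lemma ord_bound_grad_incr:
  assumes "\<And>l. ord_bound T 0 0 (\<lambda>i::('d, 'm) config. partial l u (xf i))"
  shows "ord_bound T 1 1 (grad_incr u)"
  unfolding grad_incr_def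
proof (rule ord_bound_sum)
  fix l
  have "ord_bound T 1 1 (\<lambda>i. \<Sum>m\<in>UNIV. g (xf i) $ l $ m * wa i $ m)"
    by (rule ord_bound_sum_wa ord_bound_growth_coeffs ord_bound_xf | simp)+
  from ord_bound_mult[OF assms this]
  show "ord_bound T 1 1 (\<lambda>i. partial l u (xf i) * (\<Sum>m\<in>UNIV. g (xf i) $ l $ m * wa i $ m))"
    by simp
qed

text \<open>Two errors of order 2: the quadratic Taylor remainder, which brings
  \<open>ell ^ 2\<close>, and the bounded gradient applied to the part of \<open>yf - xf\<close>
  beyond the diffusion term.\<close>

lemma ord_bound_grad_remainder:
  assumes "taylor_fun u" "\<And>l. ord_bound T 0 0 (\<lambda>i::('d, 'm) config. partial l u (xf i))"
  shows "ord_bound T 2 2 (\<lambda>i. u (yf i) - u (xf i) - grad_incr u i)"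
proof -
  let ?r = "\<lambda>l i. yf i $ l - xf i $ l - (\<Sum>m\<in>UNIV. g (xf i) $ l $ m * wa i $ m)"
  have "ord_bound T (2 * 1) (2 * 1) (\<lambda>i. u (yf i) - u (xf i) - (\<Sum>l\<in>UNIV. partial l u (xf i) * (yf i $ l - xf i $ l)))"
    by (rule ord_bound_taylor[OF assms(1) ord_bound_yf_diff])
  moreover have "ord_bound T 2 2 (\<lambda>i. \<Sum>l\<in>UNIV. partial l u (xf i) * ?r l i)"
    by (intro ord_bound_sum ord_bound_mult'[OF assms(2) ord_bound_yf_diff2]) auto
  ultimately have "ord_bound T 2 2 (\<lambda>i. (u (yf i) - u (xf i) - (\<Sum>l\<in>UNIV. partial l u (xf i) * (yf i $ l - xf i $ l)))
      + (\<Sum>l\<in>UNIV. partial l u (xf i) * ?r l i))"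
    by (simp add: ord_bound_add)
  moreover have "(u (yf i) - u (xf i) - (\<Sum>l\<in>UNIV. partial l u (xf i) * (yf i $ l - xf i $ l)))
      + (\<Sum>l\<in>UNIV. partial l u (xf i) * ?r l i) = u (yf i) - u (xf i) - grad_incr u i" for i
    by (simp add: grad_incr_def right_diff_distrib sum_subtractf)
  ultimately show ?thesis by simp
qed

text \<open>The 2 undoes the factor 1/2 in \<open>h_coeff\<close>. Hence the leading change of
  \<open>g\<close> over the first half step, multiplied by the second half increment, can be merged
  with the Milstein terms.\<close>

lemma grad_incr_g: "grad_incr (\<lambda>x. g x $ k $ j) i = 2 * (\<Sum>l\<in>UNIV. h_coeff g k j l (xf i) * wa i $ l)"
proof -
  have "grad_incr (\<lambda>x. g x $ k $ j) i
      = (\<Sum>l\<in>UNIV. \<Sum>m\<in>UNIV. g (xf i) $ m $ l * partial m (\<lambda>x. g x $ k $ j) (xf i) * wa i $ l)"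
    unfolding grad_incr_def sum_distrib_left
    by (subst sum.swap) (simp add: mult_ac)
  also have "\<dots> = 2 * (\<Sum>l\<in>UNIV. h_coeff g k j l (xf i) * wa i $ l)"
    by (simp add: h_coeff_def sum_distrib_left sum_distrib_right mult_ac)
  finally show ?thesis .
qed

text \<open>The remainder of the expansion is divided by its mean. The target error has size
  \<open>e ^ 2 * ell ^ 2\<close>; the centred \<open>mart\<close> may be smaller by only one factor
  \<open>e\<close>, whereas the uncentred \<open>rest\<close> must be smaller by
  \<open>e ^ 2\<close>.\<close>

definition mart :: "'d \<Rightarrow> ('d, 'm) config \<Rightarrow> real" where
  "mart k i = (\<Sum>l\<in>UNIV. (partial l (\<lambda>x. f x $ k) (xf i) * ((eps i)\<^sup>2 / 2)) * (\<Sum>m\<in>UNIV. g (xf i) $ l $ m * wa i $ m))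
    + (\<Sum>j\<in>UNIV. (g (yf i) $ k $ j - g (xf i) $ k $ j - grad_incr (\<lambda>x. g x $ k $ j) i) * wb i $ j)
    + (\<Sum>j\<in>UNIV. \<Sum>l\<in>UNIV. (h_coeff g k j l (yf i) - h_coeff g k j l (xf i)) * qb R j l i)"

definition rest :: "'d \<Rightarrow> ('d, 'm) config \<Rightarrow> real" where
  "rest k i = (f (yf i) $ k - f (xf i) $ k - grad_incr (\<lambda>x. f x $ k) i) * ((eps i)\<^sup>2 / 2)"

lemma mart_drift_eq:
  "(\<Sum>l\<in>UNIV. (partial l (\<lambda>x. f x $ k) (xf i) * ((eps i)\<^sup>2 / 2)) * (\<Sum>m\<in>UNIV. g (xf i) $ l $ m * wa i $ m))
    = grad_incr (\<lambda>x. f x $ k) i * ((eps i)\<^sup>2 / 2)"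
  unfolding grad_incr_def sum_distrib_right[of _ UNIV "(eps i)\<^sup>2 / 2"]
  by (intro sum.cong refl) (simp only: mult_ac)

text \<open>The term \<open>wa i $ l * wb i $ j - wa i $ j * wb i $ l\<close> is the Levy-area part, which is antisymmetric under
  exchanging the two increments and hence cancels in the mean of the fine and antithetic paths.\<close>

lemma zf_expansion:
  "zf i $ k = xf i $ k + f (xf i) $ k * (eps i)\<^sup>2 + (\<Sum>j\<in>UNIV. g (xf i) $ k $ j * (wa i $ j + wb i $ j))
    + (\<Sum>j\<in>UNIV. \<Sum>l\<in>UNIV. h_coeff g k j l (xf i) * coarse_q j l i)
    + (\<Sum>j\<in>UNIV. \<Sum>l\<in>UNIV. h_coeff g k j l (xf i) * (wa i $ l * wb i $ j - wa i $ j * wb i $ l))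
    + mart k i + rest k i"
proof -
  let ?h = "\<lambda>j l. h_coeff g k j l (xf i)"
  have 1: "(\<Sum>j\<in>UNIV. (g (yf i) $ k $ j - g (xf i) $ k $ j - grad_incr (\<lambda>x. g x $ k $ j) i) * wb i $ j)
     = (\<Sum>j\<in>UNIV. g (yf i) $ k $ j * wb i $ j) - (\<Sum>j\<in>UNIV. g (xf i) $ k $ j * wb i $ j)
       - (\<Sum>j\<in>UNIV. \<Sum>l\<in>UNIV. ?h j l * (2 * wa i $ l * wb i $ j))"
    unfolding sum_subtractf[symmetric]
    by (intro sum.cong refl) (simp add: grad_incr_g left_diff_distrib right_diff_distrib sum_distrib_left sum_distrib_right mult_ac)
  \<comment> \<open>The fine step produces \<open>2 * wa i $ l * wb i $ j\<close>, while
    \<open>coarse_q\<close> contains the product symmetrised in \<open>j\<close> and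
    \<open>l\<close>; the discrepancy is the Levy-area term.\<close>
  have 2: "(\<Sum>j\<in>UNIV. \<Sum>l\<in>UNIV. ?h j l * coarse_q j l i)
      + (\<Sum>j\<in>UNIV. \<Sum>l\<in>UNIV. ?h j l * (wa i $ l * wb i $ j - wa i $ j * wb i $ l))
    = (\<Sum>j\<in>UNIV. \<Sum>l\<in>UNIV. ?h j l * qa R j l i) + (\<Sum>j\<in>UNIV. \<Sum>l\<in>UNIV. ?h j l * qb R j l i)
      + (\<Sum>j\<in>UNIV. \<Sum>l\<in>UNIV. ?h j l * (2 * wa i $ l * wb i $ j))"
    unfolding sum.distrib[symmetric] by (intro sum.cong refl) (simp add: algebra_simps)
  have 3: "(\<Sum>j\<in>UNIV. g (xf i) $ k $ j * (wa i $ j + wb i $ j))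
      = (\<Sum>j\<in>UNIV. g (xf i) $ k $ j * wa i $ j) + (\<Sum>j\<in>UNIV. g (xf i) $ k $ j * wb i $ j)"
    by (simp add: distrib_left sum.distrib)
  have 4: "(\<Sum>j\<in>UNIV. \<Sum>l\<in>UNIV. (h_coeff g k j l (yf i) - ?h j l) * qb R j l i)
      = (\<Sum>j\<in>UNIV. \<Sum>l\<in>UNIV. h_coeff g k j l (yf i) * qb R j l i) - (\<Sum>j\<in>UNIV. \<Sum>l\<in>UNIV. ?h j l * qb R j l i)"
    by (simp add: left_diff_distrib sum_subtractf)
  have 5: "(f (yf i) $ k - f (xf i) $ k - G) * ((eps i)\<^sup>2 / 2)
      = f (yf i) $ k * ((eps i)\<^sup>2 / 2) - f (xf i) $ k * ((eps i)\<^sup>2 / 2) - G * ((eps i)\<^sup>2 / 2)" for G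
    by (simp add: left_diff_distrib)
  have 6: "f (xf i) $ k * (eps i)\<^sup>2 = f (xf i) $ k * ((eps i)\<^sup>2 / 2) + f (xf i) $ k * ((eps i)\<^sup>2 / 2)"
    by simp
  show ?thesis
    unfolding zf_eq mart_def mart_drift_eq rest_def 1 3 4 5 6 yf_eq[of i k] using 2 by linarith
qed

lemma ord_bound_mart: "ord_bound T 3 2 (mart k)"
  unfolding mart_def mart_drift_eq
proof (intro ord_bound_add)
  show "ord_bound T 3 2 (\<lambda>i. grad_incr (\<lambda>x. f x $ k) i * ((eps i)\<^sup>2 / 2))"
    by (rule ord_bound_half_drift[OF ord_bound_grad_incr[OF ord_bound_partials(1)]]) auto
  show "ord_bound T 3 2 (\<lambda>i. \<Sum>j\<in>UNIV. (g (yf i) $ k $ j - g (xf i) $ k $ j - grad_incr (\<lambda>x. g x $ k $ j) i) * wb i $ j)"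
    by (rule ord_bound_sum_wb[OF ord_bound_grad_remainder[OF taylor_coeffs(2) ord_bound_partials(2)]]) auto
  show "ord_bound T 3 2 (\<lambda>i. \<Sum>j\<in>UNIV. \<Sum>l\<in>UNIV. (h_coeff g k j l (yf i) - h_coeff g k j l (xf i)) * qb R j l i)"
    by (rule ord_bound_sum_q[OF ord_bound_lipschitz_coeffs(3)[OF ord_bound_yf_diff] ord_bound_q(2)]) auto
qed

lemma ord_bound_rest: "ord_bound T 4 2 (rest k)"
  unfolding rest_def
  by (rule ord_bound_half_drift[OF ord_bound_grad_remainder[OF taylor_coeffs(1) ord_bound_partials(1)]]) auto

lemma cont_config_grad_incr: "cont_config (grad_incr (\<lambda>x. f x $ k))" "cont_config (grad_incr (\<lambda>x. g x $ k $ j))"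
  unfolding grad_incr_def by (intro cont_config_scheme)+

lemma centred_mart: "centred R T (mart k)"
  unfolding mart_def
proof (intro centred_add centred_sum)
  show "centred R T (\<lambda>i. (partial l (\<lambda>x. f x $ k) (xf i) * ((eps i)\<^sup>2 / 2)) * (\<Sum>m\<in>UNIV. g (xf i) $ l $ m * wa i $ m))" for l
    by (intro centred_mult_state centred_sum centred_noise) simp_all
  show "centred R T (\<lambda>i. (g (yf i) $ k $ j - g (xf i) $ k $ j - grad_incr (\<lambda>x. g x $ k $ j) i) * wb i $ j)" for j
    by (rule centred_wb[OF ord_bound_grad_remainder[OF taylor_coeffs(2) ord_bound_partials(2)]])
      (intro cont_config_scheme cont_config_grad_incr, simp add: yf_def grad_incr_def)
  show "centred R T (\<lambda>i. (h_coeff g k j l (yf i) - h_coeff g k j l (xf i)) * qb R j l i)" for j l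
    by (rule centred_qb[OF ord_bound_lipschitz_coeffs(3)[OF ord_bound_yf_diff]])
      (intro cont_config_scheme, simp add: yf_def)
qed

section \<open>The mean of the refined paths against the coarse path\<close>

lemma ord_bound_mean_lipschitz:
  assumes "taylor_fun u" "lipschitz_fun u"
  shows "ord_bound T 2 2 (\<lambda>i::('d, 'm) config. (u (xf i) + u (xa i)) / 2 - u (xc i))"
proof -
  \<comment> \<open>The value of \<open>u\<close> at the midpoint of the refined states is inserted:
    the midpoint rule costs the square of \<open>e * ell\<close>, and the Lipschitz property
    transfers the bound on the mean error.\<close>
  have "ord_bound T (2 * 1) (2 * 1) (\<lambda>i::('d, 'm) config. (u (xf i) + u (xa i)) / 2 - u ((1/2) *\<^sub>R (xf i + xa i)))"
    by (rule ord_bound_midpoint[OF assms(1) ord_bound_xf_xa])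
  moreover have "ord_bound T 2 2 (\<lambda>i::('d, 'm) config. u ((1/2) *\<^sub>R (xf i + xa i)) - u (xc i))"
    by (rule ord_bound_lipschitz[OF assms(2)]) (use ord_bound_mean_xc in simp)
  ultimately have "ord_bound T 2 2 (\<lambda>i::('d, 'm) config. ((u (xf i) + u (xa i)) / 2 - u ((1/2) *\<^sub>R (xf i + xa i)))
      + (u ((1/2) *\<^sub>R (xf i + xa i)) - u (xc i)))"
    by (intro ord_bound_add) simp_all
  then show ?thesis by simp
qed

text \<open>A single refined path differs from the coarse one by half of \<open>xf - xa\<close> plus
  the mean error; the first part limits the order to 1.\<close>

lemma ord_bound_xf_xc: "ord_bound T 1 2 (\<lambda>i::('d, 'm) config. xf i $ k - xc i $ k)"
proof -
  have "ord_bound T 1 2 (\<lambda>i::('d, 'm) config. (xf i $ k - xa i $ k) / 2 + ((xf i $ k + xa i $ k) / 2 - xc i $ k))"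
    by (rule ord_bound_add ord_bound_divide ord_bound_mono[OF ord_bound_xf_xa] ord_bound_mono[OF ord_bound_mean_xc] | simp)+
  moreover have "(a - b) / 2 + ((a + b) / 2 - c) = a - c" for a b c :: real
    by (simp add: field_simps)
  ultimately show ?thesis by simp
qed

lemma ord_bound_xa_xc: "ord_bound T 1 2 (\<lambda>i::('d, 'm) config. xa i $ k - xc i $ k)"
  using ord_bound_swap[OF ord_bound_xf_xc] by simp

definition mean_drift :: "'d \<Rightarrow> ('d, 'm) config \<Rightarrow> real" where
  "mean_drift k i = ((f (xf i) $ k + f (xa i) $ k) / 2 - f (xc i) $ k) * (eps i)\<^sup>2 + (rest k i + rest k (swap i)) / 2"

text \<open>The linear noise terms need the second-order closeness of the averaged \<open>g\<close>.
  The quadratic ones already have order 2, so first-order differences of \<open>h_coeff\<close>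
  suffice; for this reason they are written as differences against the coarse state or between the
  refined states.\<close>

definition mean_fluct :: "'d \<Rightarrow> ('d, 'm) config \<Rightarrow> real" where
  "mean_fluct k i = (\<Sum>j\<in>UNIV. ((g (xf i) $ k $ j + g (xa i) $ k $ j) / 2 - g (xc i) $ k $ j) * (wa i $ j + wb i $ j))
    + (\<Sum>j\<in>UNIV. \<Sum>l\<in>UNIV. ((h_coeff g k j l (xf i) - h_coeff g k j l (xc i)) / 2
        + (h_coeff g k j l (xa i) - h_coeff g k j l (xc i)) / 2) * coarse_q j l i)
    + (\<Sum>j\<in>UNIV. \<Sum>l\<in>UNIV. ((h_coeff g k j l (xf i) - h_coeff g k j l (xa i)) / 2) * (wa i $ l * wb i $ j - wa i $ j * wb i $ l))
    + (mart k i + mart k (swap i)) / 2"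

lemma mean_decomp:
  "(zf i $ k + zf (swap i) $ k) / 2 - zc i $ k
    = ((xf i $ k + xa i $ k) / 2 - xc i $ k) + mean_drift k i + mean_fluct k i"
proof -
  have 1: "(\<Sum>j\<in>UNIV. ((g (xf i) $ k $ j + g (xa i) $ k $ j) / 2 - g (xc i) $ k $ j) * (wa i $ j + wb i $ j))
    = ((\<Sum>j\<in>UNIV. g (xf i) $ k $ j * (wa i $ j + wb i $ j)) + (\<Sum>j\<in>UNIV. g (xa i) $ k $ j * (wa i $ j + wb i $ j))) / 2
      - (\<Sum>j\<in>UNIV. g (xc i) $ k $ j * (wa i $ j + wb i $ j))"
    by (simp add: sum_subtractf[symmetric] sum.distrib[symmetric] sum_divide_distrib) (simp add: field_simps)
  have 2: "(\<Sum>j\<in>UNIV. \<Sum>l\<in>UNIV. ((h_coeff g k j l (xf i) - h_coeff g k j l (xc i)) / 2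
        + (h_coeff g k j l (xa i) - h_coeff g k j l (xc i)) / 2) * coarse_q j l i)
    = ((\<Sum>j\<in>UNIV. \<Sum>l\<in>UNIV. h_coeff g k j l (xf i) * coarse_q j l i) + (\<Sum>j\<in>UNIV. \<Sum>l\<in>UNIV. h_coeff g k j l (xa i) * coarse_q j l i)) / 2
      - (\<Sum>j\<in>UNIV. \<Sum>l\<in>UNIV. h_coeff g k j l (xc i) * coarse_q j l i)"
    unfolding sum_subtractf[symmetric] sum.distrib[symmetric] sum_divide_distrib
    by (intro sum.cong refl) (simp add: field_simps)
  \<comment> \<open>Exchanging the half increments reverses the sign of the Levy area, so averaging
    the two paths leaves only the difference of the \<open>h_coeff\<close> values, which is of order
    1.\<close>
  have 3: "(\<Sum>j\<in>UNIV. \<Sum>l\<in>UNIV. ((h_coeff g k j l (xf i) - h_coeff g k j l (xa i)) / 2) * (wa i $ l * wb i $ j - wa i $ j * wb i $ l))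
    = ((\<Sum>j\<in>UNIV. \<Sum>l\<in>UNIV. h_coeff g k j l (xf i) * (wa i $ l * wb i $ j - wa i $ j * wb i $ l))
      + (\<Sum>j\<in>UNIV. \<Sum>l\<in>UNIV. h_coeff g k j l (xa i) * (wb i $ l * wa i $ j - wb i $ j * wa i $ l))) / 2"
    unfolding sum_subtractf[symmetric] sum.distrib[symmetric] sum_divide_distrib
    by (intro sum.cong refl) (simp add: field_simps)
  have 4: "coarse_q j l (swap i) = coarse_q j l i" for j l
    by simp
  have 5: "(\<Sum>j\<in>UNIV. g (xa i) $ k $ j * (wb i $ j + wa i $ j)) = (\<Sum>j\<in>UNIV. g (xa i) $ k $ j * (wa i $ j + wb i $ j))"
    by (simp add: add.commute)
  show ?thesis
    unfolding zf_expansion zc_eq mean_drift_def mean_fluct_def 1 2 3 4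
    unfolding swap_simps 5 by (simp add: field_simps)
qed

lemma ord_bound_mean_drift: "ord_bound T 4 2 (mean_drift k)"
  unfolding mean_drift_def
  by (rule ord_bound_add ord_bound_divide ord_bound_rest ord_bound_swap[OF ord_bound_rest]
      ord_bound_drift[OF ord_bound_mean_lipschitz[OF taylor_coeffs(1) lipschitz_coeffs(1)]] | simp)+

lemma ord_bound_mean_fluct: "ord_bound T 3 2 (mean_fluct k)"
  unfolding mean_fluct_def
proof (intro ord_bound_add ord_bound_divide ord_bound_mart ord_bound_swap[OF ord_bound_mart])
  show "ord_bound T 3 2 (\<lambda>i. \<Sum>j\<in>UNIV. ((g (xf i) $ k $ j + g (xa i) $ k $ j) / 2 - g (xc i) $ k $ j) * (wa i $ j + wb i $ j))"
    by (rule ord_bound_sum_dw[OF ord_bound_mean_lipschitz[OF taylor_coeffs(2) lipschitz_coeffs(2)]]) auto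
  show "ord_bound T 3 2 (\<lambda>i. \<Sum>j\<in>UNIV. \<Sum>l\<in>UNIV. ((h_coeff g k j l (xf i) - h_coeff g k j l (xc i)) / 2
        + (h_coeff g k j l (xa i) - h_coeff g k j l (xc i)) / 2) * coarse_q j l i)"
    by (rule ord_bound_sum_q[OF ord_bound_add[OF ord_bound_divide[OF ord_bound_lipschitz_coeffs(3)[OF ord_bound_xf_xc]]
        ord_bound_divide[OF ord_bound_lipschitz_coeffs(3)[OF ord_bound_xa_xc]]] ord_bound_coarse_q]) auto
  have "ord_bound T 2 0 (\<lambda>i. wa i $ l * wb i $ j - wa i $ j * wb i $ l)" for j l
    by (intro ord_bound_diff ord_bound_mult'[OF ord_bound_wa ord_bound_wb]) auto
  then show "ord_bound T 3 2 (\<lambda>i. \<Sum>j\<in>UNIV. \<Sum>l\<in>UNIV. ((h_coeff g k j l (xf i) - h_coeff g k j l (xa i)) / 2)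
      * (wa i $ l * wb i $ j - wa i $ j * wb i $ l))"
    by (rule ord_bound_sum_q[OF ord_bound_divide[OF ord_bound_lipschitz_coeffs(3)[OF ord_bound_xf_xa]]]) auto
qed

lemma centred_mean_fluct: "centred R T (mean_fluct k)"
  unfolding mean_fluct_def
proof (intro centred_add centred_divide centred_mart centred_swap[OF centred_mart] centred_dw)
  have c: "centred R T (\<lambda>i. wb i $ j * wa i $ l)" for j l
    using centred_noise(5)[of R T l j] by (simp add: mult.commute)
  show "centred R T (\<lambda>i. \<Sum>j\<in>UNIV. \<Sum>l\<in>UNIV. ((h_coeff g k j l (xf i) - h_coeff g k j l (xc i)) / 2
        + (h_coeff g k j l (xa i) - h_coeff g k j l (xc i)) / 2) * coarse_q j l i)"
    by (intro centred_sum centred_mult_state centred_add centred_noise c) simp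
  show "centred R T (\<lambda>i. \<Sum>j\<in>UNIV. \<Sum>l\<in>UNIV. ((h_coeff g k j l (xf i) - h_coeff g k j l (xa i)) / 2)
      * (wa i $ l * wb i $ j - wa i $ j * wb i $ l))"
    by (intro centred_sum centred_mult_state centred_diff centred_noise) simp
qed simp

text \<open>The second-moment estimate with both exponents equal to 2: the error
  \<open>e ^ 6 * ell ^ 4\<close> is \<open>e ^ 2\<close> times the natural size
  \<open>e ^ 4 * ell ^ 4\<close> of the squared mean error.\<close>

lemma mean_second_moment:
  "\<exists>C\<ge>0. \<forall>e S Q. 0 < e \<longrightarrow> e\<^sup>2 \<le> T \<longrightarrow> noise_pair R e Q \<longrightarrow>
    integrable Q (\<lambda>v. ((zf (e, S, v) $ k + zf (swap (e, S, v)) $ k) / 2 - zc (e, S, v) $ k) ^ 2) \<and>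
    (\<integral>v. ((zf (e, S, v) $ k + zf (swap (e, S, v)) $ k) / 2 - zc (e, S, v) $ k) ^ 2 \<partial>Q)
      \<le> ((xf (e, S, 0 :: (real^'m) \<times> (real^'m)) $ k + xa (e, S, 0 :: (real^'m) \<times> (real^'m)) $ k) / 2
            - xc (e, S, 0 :: (real^'m) \<times> (real^'m)) $ k) ^ 2
        + C * (e ^ (2 * 2 + 2) * ell e S ^ (2 * 2))"
proof (rule one_step_second_moment[where A = "mean_drift k" and X = "\<lambda>i. (xf i $ k + xa i $ k) / 2 - xc i $ k"
      and Y = "\<lambda>i. (zf i $ k + zf (swap i) $ k) / 2 - zc i $ k"])
  show "centred R T (\<lambda>i. (zf i $ k + zf (swap i) $ k) / 2 - zc i $ k - ((xf i $ k + xa i $ k) / 2 - xc i $ k) - mean_drift k i)"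
    unfolding mean_decomp using centred_mean_fluct by (simp add: algebra_simps)
  have "ord_bound T (2 + 1) 2 (\<lambda>i. mean_drift k i + mean_fluct k i)"
    by (rule ord_bound_add ord_bound_mono[OF ord_bound_mean_drift] ord_bound_mono[OF ord_bound_mean_fluct] | simp)+
  then show "ord_bound T (2 + 1) 2 (\<lambda>i. (zf i $ k + zf (swap i) $ k) / 2 - zc i $ k - ((xf i $ k + xa i $ k) / 2 - xc i $ k))"
    unfolding mean_decomp add.assoc add_diff_cancel_left' .
  show "ord_bound T (2 + 2) 2 (mean_drift k)"
    by (rule ord_bound_mono[OF ord_bound_mean_drift]) auto
  show "cont_config (mean_drift k)"
    unfolding mean_drift_def rest_def
    by (intro cont_config_scheme cont_config_grad_incr cont_config_swap[of "\<lambda>i. (f (yf i) $ k - f (xf i) $ k - grad_incr (\<lambda>x. f x $ k) i) * ((eps i)\<^sup>2 / 2)"])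
  show "cont_config (\<lambda>i. (zf i $ k + zf (swap i) $ k) / 2 - zc i $ k)"
    by (intro cont_config_scheme)
  show "cont_config (\<lambda>i::('d, 'm) config. (xf i $ k + xa i $ k) / 2 - xc i $ k)"
    by (intro cont_config_scheme)
qed (auto intro: ord_bound_mean_xc)

section \<open>Growth of the Lyapunov function in one coupled step\<close>

definition step :: "real \<Rightarrow> 'd state \<Rightarrow> (real^'m) \<times> (real^'m) \<Rightarrow> 'd state" where
  "step e S v = (zf (e, S, v), zf (swap (e, S, v)), zc (e, S, v))"

lemma lyap_step:
  "\<exists>C\<ge>0. \<forall>e S Q. 0 < e \<longrightarrow> e\<^sup>2 \<le> T \<longrightarrow> noise_pair R e Q \<longrightarrow>
    integrable Q (\<lambda>v. lyap e (step e S v)) \<and> (\<integral>v. lyap e (step e S v) \<partial>Q) \<le> (1 + C * e\<^sup>2) * lyap e S"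
proof -
  have c1: "\<exists>C\<ge>0. \<forall>e S Q. 0 < e \<longrightarrow> e\<^sup>2 \<le> T \<longrightarrow> noise_pair R e Q \<longrightarrow>
    integrable Q (\<lambda>v. (zf (e, S, v) $ k) ^ 4) \<and>
    (\<integral>v. (zf (e, S, v) $ k) ^ 4 \<partial>Q) \<le> (fst S $ k) ^ 4 + C * (e\<^sup>2 * lyap e S)" for k
    using fine_fourth_moment[of k] by (simp add: ell_pow4 power2_eq_square)
  obtain C1 where C1: "\<And>k. 0 \<le> C1 k" "\<And>k e S Q. 0 < e \<Longrightarrow> e\<^sup>2 \<le> T \<Longrightarrow> noise_pair R e Q \<Longrightarrow>
    integrable Q (\<lambda>v. (zf (e, S, v) $ k) ^ 4) \<and>
    (\<integral>v. (zf (e, S, v) $ k) ^ 4 \<partial>Q) \<le> (fst S $ k) ^ 4 + C1 k * (e\<^sup>2 * lyap e S)"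
    by (rule choose_constants[OF c1], rule that)
  have c2: "\<exists>C\<ge>0. \<forall>e S Q. 0 < e \<longrightarrow> e\<^sup>2 \<le> T \<longrightarrow> noise_pair R e Q \<longrightarrow>
    integrable Q (\<lambda>v. (zf (swap (e, S, v)) $ k) ^ 4) \<and>
    (\<integral>v. (zf (swap (e, S, v)) $ k) ^ 4 \<partial>Q) \<le> (fst (snd S) $ k) ^ 4 + C * (e\<^sup>2 * lyap e S)" for k
    using antithetic_fourth_moment[of k] by (simp add: ell_pow4 power2_eq_square)
  obtain C2 where C2: "\<And>k. 0 \<le> C2 k" "\<And>k e S Q. 0 < e \<Longrightarrow> e\<^sup>2 \<le> T \<Longrightarrow> noise_pair R e Q \<Longrightarrow>
    integrable Q (\<lambda>v. (zf (swap (e, S, v)) $ k) ^ 4) \<and>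
    (\<integral>v. (zf (swap (e, S, v)) $ k) ^ 4 \<partial>Q) \<le> (fst (snd S) $ k) ^ 4 + C2 k * (e\<^sup>2 * lyap e S)"
    by (rule choose_constants[OF c2], rule that)
  have c3: "\<exists>C\<ge>0. \<forall>e S Q. 0 < e \<longrightarrow> e\<^sup>2 \<le> T \<longrightarrow> noise_pair R e Q \<longrightarrow>
    integrable Q (\<lambda>v. (zf (e, S, v) $ k - zf (swap (e, S, v)) $ k) ^ 4) \<and>
    (\<integral>v. (zf (e, S, v) $ k - zf (swap (e, S, v)) $ k) ^ 4 \<partial>Q)
      \<le> (fst S $ k - fst (snd S) $ k) ^ 4 + C * (e ^ 6 * lyap e S)" for k
    using difference_fourth_moment[of k] by (simp add: ell_pow4)
  obtain C3 where C3: "\<And>k. 0 \<le> C3 k" "\<And>k e S Q. 0 < e \<Longrightarrow> e\<^sup>2 \<le> T \<Longrightarrow> noise_pair R e Q \<Longrightarrow>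
    integrable Q (\<lambda>v. (zf (e, S, v) $ k - zf (swap (e, S, v)) $ k) ^ 4) \<and>
    (\<integral>v. (zf (e, S, v) $ k - zf (swap (e, S, v)) $ k) ^ 4 \<partial>Q)
      \<le> (fst S $ k - fst (snd S) $ k) ^ 4 + C3 k * (e ^ 6 * lyap e S)"
    by (rule choose_constants[OF c3], rule that)
  have c4: "\<exists>C\<ge>0. \<forall>e S Q. 0 < e \<longrightarrow> e\<^sup>2 \<le> T \<longrightarrow> noise_pair R e Q \<longrightarrow>
    integrable Q (\<lambda>v. ((zf (e, S, v) $ k + zf (swap (e, S, v)) $ k) / 2 - zc (e, S, v) $ k) ^ 2) \<and>
    (\<integral>v. ((zf (e, S, v) $ k + zf (swap (e, S, v)) $ k) / 2 - zc (e, S, v) $ k) ^ 2 \<partial>Q)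
      \<le> ((fst S $ k + fst (snd S) $ k) / 2 - snd (snd S) $ k) ^ 2 + C * (e ^ 6 * lyap e S)" for k
    using mean_second_moment[of k] by (simp add: ell_pow4)
  obtain C4 where C4: "\<And>k. 0 \<le> C4 k" "\<And>k e S Q. 0 < e \<Longrightarrow> e\<^sup>2 \<le> T \<Longrightarrow> noise_pair R e Q \<Longrightarrow>
    integrable Q (\<lambda>v. ((zf (e, S, v) $ k + zf (swap (e, S, v)) $ k) / 2 - zc (e, S, v) $ k) ^ 2) \<and>
    (\<integral>v. ((zf (e, S, v) $ k + zf (swap (e, S, v)) $ k) / 2 - zc (e, S, v) $ k) ^ 2 \<partial>Q)
      \<le> ((fst S $ k + fst (snd S) $ k) / 2 - snd (snd S) $ k) ^ 2 + C4 k * (e ^ 6 * lyap e S)"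
    by (rule choose_constants[OF c4], rule that)
  define C where "C = (\<Sum>k\<in>UNIV. C1 k) + (\<Sum>k\<in>UNIV. C2 k) + (\<Sum>k\<in>UNIV. C3 k) + (\<Sum>k\<in>UNIV. C4 k)"
  show ?thesis
  proof (intro exI[of _ C] conjI allI impI)
    show "0 \<le> C" unfolding C_def by (intro add_nonneg_nonneg sum_nonneg C1 C2 C3 C4)
    fix e :: real and S :: "'d state" and Q :: "((real^'m) \<times> (real^'m)) measure"
    assume e: "0 < e" "e\<^sup>2 \<le> T" and Q: "noise_pair R e Q"
    interpret prob_space Q using Q by (rule noise_pair_prob_space)
    let ?L = "lyap e S"
    let ?a = "\<lambda>k v. (zf (e, S, v) $ k) ^ 4" and ?b = "\<lambda>k v. (zf (swap (e, S, v)) $ k) ^ 4"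
    let ?c = "\<lambda>k v. (zf (e, S, v) $ k - zf (swap (e, S, v)) $ k) ^ 4"
    let ?d = "\<lambda>k v. ((zf (e, S, v) $ k + zf (swap (e, S, v)) $ k) / 2 - zc (e, S, v) $ k) ^ 2"
    have i: "integrable Q (?a k)" "integrable Q (?b k)" "integrable Q (?c k)" "integrable Q (?d k)" for k
      using C1(2) C2(2) C3(2) C4(2) e Q by blast+
    have eq: "(\<lambda>v. lyap e (step e S v)) = (\<lambda>v. 1 + (\<Sum>k\<in>UNIV. ?a k v) + (\<Sum>k\<in>UNIV. ?b k v)
        + (\<Sum>k\<in>UNIV. ?c k v) / e ^ 4 + (\<Sum>k\<in>UNIV. ?d k v) / e ^ 4)"
      by (simp add: lyap_def step_def)
    show "integrable Q (\<lambda>v. lyap e (step e S v))"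
      unfolding eq by (intro Bochner_Integration.integrable_add Bochner_Integration.integrable_sum integrable_divide_zero i) simp
    have sums: "has_bochner_integral Q (\<lambda>v. \<Sum>k\<in>UNIV. u k v) (\<Sum>k\<in>UNIV. integral\<^sup>L Q (u k))"
      if "\<And>k. integrable Q (u k)" for u :: "'d \<Rightarrow> (real^'m) \<times> (real^'m) \<Rightarrow> real"
      by (intro has_bochner_integral_sum has_bochner_integral_integrable that)
    have "has_bochner_integral Q (\<lambda>v. lyap e (step e S v)) (1 + (\<Sum>k\<in>UNIV. integral\<^sup>L Q (?a k)) + (\<Sum>k\<in>UNIV. integral\<^sup>L Q (?b k))
        + (\<Sum>k\<in>UNIV. integral\<^sup>L Q (?c k)) / e ^ 4 + (\<Sum>k\<in>UNIV. integral\<^sup>L Q (?d k)) / e ^ 4)"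
      unfolding eq by (intro has_bochner_integral_add has_bochner_integral_divide_zero sums i)
        (simp add: has_bochner_integral_iff prob_space)
    then have "(\<integral>v. lyap e (step e S v) \<partial>Q) = 1 + (\<Sum>k\<in>UNIV. integral\<^sup>L Q (?a k)) + (\<Sum>k\<in>UNIV. integral\<^sup>L Q (?b k))
        + (\<Sum>k\<in>UNIV. integral\<^sup>L Q (?c k)) / e ^ 4 + (\<Sum>k\<in>UNIV. integral\<^sup>L Q (?d k)) / e ^ 4"
      by (rule has_bochner_integral_integral_eq)
    also have "\<dots> \<le> 1 + (\<Sum>k\<in>UNIV. (fst S $ k) ^ 4 + C1 k * (e\<^sup>2 * ?L)) + (\<Sum>k\<in>UNIV. (fst (snd S) $ k) ^ 4 + C2 k * (e\<^sup>2 * ?L))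
        + (\<Sum>k\<in>UNIV. (fst S $ k - fst (snd S) $ k) ^ 4 + C3 k * (e ^ 6 * ?L)) / e ^ 4
        + (\<Sum>k\<in>UNIV. ((fst S $ k + fst (snd S) $ k) / 2 - snd (snd S) $ k) ^ 2 + C4 k * (e ^ 6 * ?L)) / e ^ 4"
      using C1(2)[OF e Q] C2(2)[OF e Q] C3(2)[OF e Q] C4(2)[OF e Q] e
      by (intro add_mono sum_mono divide_right_mono) auto
    also have "\<dots> = ?L + ((\<Sum>k\<in>UNIV. C1 k) * (e\<^sup>2 * ?L) + (\<Sum>k\<in>UNIV. C2 k) * (e\<^sup>2 * ?L)
        + (\<Sum>k\<in>UNIV. C3 k) * (e ^ 6 * ?L) / e ^ 4 + (\<Sum>k\<in>UNIV. C4 k) * (e ^ 6 * ?L) / e ^ 4)"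
      unfolding sum.distrib sum_distrib_right[symmetric]
      \<comment> \<open>Only the isolated \<open>?L\<close> is unfolded; its occurrences in the
        error terms stay folded.\<close>
      by (subst (5) lyap_def) (simp add: add_divide_distrib)
    also have "\<dots> = (1 + C * e\<^sup>2) * ?L"
    proof -
      \<comment> \<open>The weights \<open>e ^ 4\<close> in the denominators of \<open>lyap\<close>
        turn the one-step errors of order 6 into order 2, one Gronwall increment.\<close>
      have "x * (e ^ 6 * ?L) / e ^ 4 = x * (e\<^sup>2 * ?L)" for x
        using e by (simp add: field_simps flip: power_add)
      then show ?thesis
        unfolding C_def by (simp only:) (simp add: algebra_simps)
    qed
    finally show "(\<integral>v. lyap e (step e S v) \<partial>Q) \<le> (1 + C * e\<^sup>2) * ?L" .
  qed
qed

section \<open>Contributions of one step to the time averages\<close>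

definition ave_diff :: "'d \<Rightarrow> ('d, 'm) config \<Rightarrow> real" where
  "ave_diff k i = ((xf i $ k - xa i $ k) + 2 * (yf i $ k - yf (swap i) $ k) + (zf i $ k - zf (swap i) $ k)) / 4"

text \<open>The mean of the refined midpoints is compared with the linear interpolation of the
  coarse path at the middle of the step.\<close>

definition mid_mean :: "'d \<Rightarrow> ('d, 'm) config \<Rightarrow> real" where
  "mid_mean k i = (yf i $ k + yf (swap i) $ k) / 2 - (xc i $ k + zc i $ k) / 2"

text \<open>The coarse trapezoidal weights 1/2, 1/2 become 1/4, 1/2, 1/4 once the interpolated
  midpoint is inserted, and then match the weights of the refined averages.\<close>

definition ave_mean :: "'d \<Rightarrow> ('d, 'm) config \<Rightarrow> real" where
  "ave_mean k i = (((xf i $ k + xa i $ k) / 2 - xc i $ k) + 2 * mid_mean k i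
     + ((zf i $ k + zf (swap i) $ k) / 2 - zc i $ k)) / 4"

lemma ord_bound_ave_diff: "ord_bound T 1 1 (ave_diff k)"
proof -
  have "ord_bound T 1 1 (\<lambda>i. ((xf i $ k - xa i $ k)
      + 2 * ((yf i $ k - xf i $ k) - (yf (swap i) $ k - xa i $ k) + (xf i $ k - xa i $ k))
      + ((xf i $ k - xa i $ k) + ((zf i $ k - zf (swap i) $ k) - (xf i $ k - xa i $ k)))) / 4)"
    by (intro ord_bound_add ord_bound_diff ord_bound_divide ord_bound_cmult ord_bound_xf_xa ord_bound_yf_diff
        ord_bound_yf_swap_diff ord_bound_mono[OF ord_bound_zf_difference_increment]) auto
  then show ?thesis
    unfolding ave_diff_def by (simp add: algebra_simps)
qed

lemma ord_bound_xc: "ord_bound T 0 2 (\<lambda>i::('d, 'm) config. xc i $ k)"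
proof -
  have "ord_bound T 0 2 (\<lambda>i::('d, 'm) config. xf i $ k - (xf i $ k - xc i $ k))"
    by (intro ord_bound_diff[OF ord_bound_mono[OF ord_bound_xf] ord_bound_mono[OF ord_bound_xf_xc]]) auto
  then show ?thesis by simp
qed

text \<open>The order-1 parts cancel up to coefficient differences: the first half increment drives
  the fine midpoint, the second one the antithetic midpoint, and together they make up the coarse
  increment.\<close>

lemma mid_mean_decomp:
  "mid_mean k i = ((xf i $ k + xa i $ k) / 2 - xc i $ k)
    + ((yf i $ k - xf i $ k - (\<Sum>j\<in>UNIV. g (xf i) $ k $ j * wa i $ j))
      + (yf (swap i) $ k - xf (swap i) $ k - (\<Sum>j\<in>UNIV. g (xf (swap i)) $ k $ j * wa (swap i) $ j))) / 2
    + ((\<Sum>j\<in>UNIV. (g (xf i) $ k $ j - g (xc i) $ k $ j) * wa i $ j)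
      + (\<Sum>j\<in>UNIV. (g (xa i) $ k $ j - g (xc i) $ k $ j) * wb i $ j)) / 2
    - (f (xc i) $ k * (eps i)\<^sup>2 + (\<Sum>j\<in>UNIV. \<Sum>l\<in>UNIV. h_coeff g k j l (xc i) * coarse_q j l i)) / 2"
  unfolding mid_mean_def zc_eq
  by (simp add: left_diff_distrib sum_subtractf distrib_left sum.distrib field_simps)

lemma ord_bound_mid_mean: "ord_bound T 2 2 (mid_mean k)"
proof -
  have r: "ord_bound T 2 2 (\<lambda>i. yf i $ k - xf i $ k - (\<Sum>j\<in>UNIV. g (xf i) $ k $ j * wa i $ j))"
    by (rule ord_bound_mono[OF ord_bound_yf_diff2]) auto
  show ?thesis
    unfolding mid_mean_decomp
    by (intro ord_bound_add ord_bound_diff ord_bound_divide ord_bound_mean_xc r ord_bound_swap[OF r]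
        ord_bound_sum_wa[OF ord_bound_lipschitz_coeffs(2)[OF ord_bound_xf_xc]]
        ord_bound_sum_wb[OF ord_bound_lipschitz_coeffs(2)[OF ord_bound_xa_xc]]
        ord_bound_drift[OF ord_bound_growth_coeffs(1)[OF ord_bound_xc]]
        ord_bound_sum_q[OF ord_bound_growth_coeffs(3)[OF ord_bound_xc] ord_bound_coarse_q]) auto
qed

lemma ord_bound_ave_mean: "ord_bound T 2 2 (ave_mean k)"
proof -
  have "ord_bound T 2 2 (\<lambda>i. (zf i $ k + zf (swap i) $ k) / 2 - zc i $ k)"
    unfolding mean_decomp
    by (intro ord_bound_add ord_bound_mean_xc ord_bound_mono[OF ord_bound_mean_drift] ord_bound_mono[OF ord_bound_mean_fluct]) auto
  then show ?thesis
    unfolding ave_mean_def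
    by (intro ord_bound_add ord_bound_divide ord_bound_cmult ord_bound_mean_xc ord_bound_mid_mean)
qed

definition ave_err :: "('d, 'm) config \<Rightarrow> real" where
  "ave_err i = (\<Sum>k\<in>UNIV. ave_diff k i ^ 4) + (\<Sum>k\<in>UNIV. ave_mean k i ^ 2)"

lemma ave_err_nonneg: "0 \<le> ave_err i"
  unfolding ave_err_def by (intro add_nonneg_nonneg sum_nonneg) auto

lemma cont_config_ave_err: "cont_config ave_err"
  unfolding ave_err_def ave_diff_def ave_mean_def mid_mean_def by (intro cont_config_scheme)

text \<open>Absolute bounds suffice here, without any centring: these errors are averaged over the
  steps and do not feed back into the recursion.\<close>

lemma ave_err_expectation:
  "\<exists>C\<ge>0. \<forall>e S Q. 0 < e \<longrightarrow> e\<^sup>2 \<le> T \<longrightarrow> noise_pair R e Q \<longrightarrow>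
    integrable Q (\<lambda>v. ave_err (e, S, v)) \<and> (\<integral>v. ave_err (e, S, v) \<partial>Q) \<le> C * (e ^ 4 * lyap e S)"
proof -
  have "ord_bound T (4 * 1) (4 * 1) (\<lambda>i. \<Sum>k\<in>UNIV. ave_diff k i ^ 4)"
    "ord_bound T (2 * 2) (2 * 2) (\<lambda>i. \<Sum>k\<in>UNIV. ave_mean k i ^ 2)"
    by (intro ord_bound_sum ord_bound_power ord_bound_ave_diff ord_bound_ave_mean)+
  then have "ord_bound T 4 4 ave_err"
    unfolding ave_err_def by (simp add: ord_bound_add)
  from ord_bound_integral[OF this cont_config_ave_err, of R]
  obtain C where C: "0 \<le> C" "\<And>e S Q. 0 < e \<Longrightarrow> e\<^sup>2 \<le> T \<Longrightarrow> noise_pair R e Q \<Longrightarrow>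
      integrable Q (\<lambda>v. ave_err (e, S, v)) \<and> \<bar>\<integral>v. ave_err (e, S, v) \<partial>Q\<bar> \<le> C * (e ^ 4 * lyap e S)"
    unfolding ell_pow4 by blast
  show ?thesis
  proof (intro exI[of _ C] conjI allI impI)
    fix e :: real and S :: "'d state" and Q :: "((real^'m) \<times> (real^'m)) measure"
    assume a: "0 < e" "e\<^sup>2 \<le> T" "noise_pair R e Q"
    from C(2)[OF a, of S] show "integrable Q (\<lambda>v. ave_err (e, S, v))"
      "(\<integral>v. ave_err (e, S, v) \<partial>Q) \<le> C * (e ^ 4 * lyap e S)"
      by auto
  qed (rule C(1))
qed

lemma step_measurable: "(\<lambda>p. step e (fst p) (snd p)) \<in> borel_measurable borel"
proof -
  have "continuous_on UNIV (\<lambda>p. zf (e, p))" "continuous_on UNIV (\<lambda>p. zf (swap (e, p)))" "continuous_on UNIV (\<lambda>p. zc (e, p))"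
    using cont_config_zf cont_config_zc cont_config_swap[OF cont_config_zf]
    unfolding cont_config_def by (auto intro!: continuous_on_vecI)
  then have "continuous_on UNIV (\<lambda>p. step e (fst p) (snd p))"
    unfolding step_def by (simp add: continuous_on_Pair)
  then show ?thesis
    by (rule borel_measurable_continuous_onI)
qed

lemma lyap_measurable: "lyap e \<in> borel_measurable borel"
  unfolding lyap_def[abs_def] divide_inverse
  by (intro borel_measurable_continuous_onI) (auto intro!: continuous_intros)

lemma config_measurable: "cont_config \<phi> \<Longrightarrow> (\<lambda>p. \<phi> (e, p)) \<in> borel_measurable borel"
  unfolding cont_config_def by (intro borel_measurable_continuous_onI) auto

end

subsection \<open>Independence\<close>

text \<open>The library's \<open>indep_var\<close> requires both variables to have the same value type.\<close>

definition (in prob_space) product_law ::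
  "('a \<Rightarrow> 'b::topological_space) \<Rightarrow> ('a \<Rightarrow> 'c::topological_space) \<Rightarrow> bool" where
  "product_law X Y \<longleftrightarrow> X \<in> borel_measurable M \<and> Y \<in> borel_measurable M \<and>
     distr M borel X \<Otimes>\<^sub>M distr M borel Y = distr M (borel \<Otimes>\<^sub>M borel) (\<lambda>\<omega>. (X \<omega>, Y \<omega>))"

lemma (in prob_space) product_law_subalgebra:
  assumes "subalgebra M G" and X: "X \<in> borel_measurable G" and Y[measurable]: "Y \<in> borel_measurable M"
    and indep: "indep_set (sets G) (sets (vimage_algebra (space M) Y borel))"
  shows "product_law X Y"
proof -
  have G: "space G = space M" using assms(1) by (simp add: subalgebra_def)
  have X'[measurable]: "X \<in> borel_measurable M"
    by (rule measurable_from_subalg[OF assms(1) X])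
  interpret X: prob_space "distr M borel X" by (rule prob_space_distr) simp
  interpret Y: prob_space "distr M borel Y" by (rule prob_space_distr) simp
  have "distr M borel X \<Otimes>\<^sub>M distr M borel Y = distr M (borel \<Otimes>\<^sub>M borel) (\<lambda>\<omega>. (X \<omega>, Y \<omega>))"
  \<comment> \<open>Two sigma-finite measures on the product agree once they agree on rectangles,
    where independence of the sigma-algebras applies directly.\<close>
  proof (rule pair_measure_eqI)
    fix A B assume "A \<in> sets (distr M borel X)" "B \<in> sets (distr M borel Y)"
    then have [measurable]: "A \<in> sets borel" "B \<in> sets borel" by auto
    have eq: "(\<lambda>\<omega>. (X \<omega>, Y \<omega>)) -` (A \<times> B) \<inter> space M = (X -` A \<inter> space M) \<inter> (Y -` B \<inter> space M)"
      by auto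
    have "X -` A \<inter> space M \<in> sets G"
      using measurable_sets[OF X, of A] by (simp add: G)
    moreover have "Y -` B \<inter> space M \<in> sets (vimage_algebra (space M) Y borel)"
      by (rule in_vimage_algebra) simp
    ultimately have "prob ((X -` A \<inter> space M) \<inter> (Y -` B \<inter> space M)) = prob (X -` A \<inter> space M) * prob (Y -` B \<inter> space M)"
      by (rule indep_setD[OF indep])
    then show "emeasure (distr M borel X) A * emeasure (distr M borel Y) B
        = emeasure (distr M (borel \<Otimes>\<^sub>M borel) (\<lambda>\<omega>. (X \<omega>, Y \<omega>))) (A \<times> B)"
      by (simp add: emeasure_distr eq emeasure_eq_measure ennreal_mult)
  qed (auto intro: X.sigma_finite_measure_axioms Y.sigma_finite_measure_axioms intro!: sets_pair_measure_cong)
  then show ?thesis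
    by (simp add: product_law_def)
qed

text \<open>The freezing principle: \<open>Y\<close> is integrated out while \<open>X\<close> is
  held fixed. With nonnegative integrals no integrability has to be known in advance.\<close>

lemma (in prob_space) nn_integral_product_law:
  fixes X :: "'a \<Rightarrow> 'b::second_countable_topology" and Y :: "'a \<Rightarrow> 'c::second_countable_topology"
  assumes "product_law X Y" and \<phi>[measurable]: "\<phi> \<in> borel_measurable (borel \<Otimes>\<^sub>M borel)"
  shows "(\<integral>\<^sup>+\<omega>. \<phi> (X \<omega>, Y \<omega>) \<partial>M) = (\<integral>\<^sup>+\<omega>. (\<integral>\<^sup>+y. \<phi> (X \<omega>, y) \<partial>distr M borel Y) \<partial>M)"
proof -
  have [measurable]: "X \<in> borel_measurable M" "Y \<in> borel_measurable M"
    and eq: "distr M borel X \<Otimes>\<^sub>M distr M borel Y = distr M (borel \<Otimes>\<^sub>M borel) (\<lambda>\<omega>. (X \<omega>, Y \<omega>))"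
    using assms(1) unfolding product_law_def by auto
  interpret Y: prob_space "distr M borel Y" by (rule prob_space_distr) simp
  have "(\<integral>\<^sup>+\<omega>. \<phi> (X \<omega>, Y \<omega>) \<partial>M) = (\<integral>\<^sup>+p. \<phi> p \<partial>distr M (borel \<Otimes>\<^sub>M borel) (\<lambda>\<omega>. (X \<omega>, Y \<omega>)))"
    by (simp add: nn_integral_distr)
  also have "\<dots> = (\<integral>\<^sup>+x. (\<integral>\<^sup>+y. \<phi> (x, y) \<partial>distr M borel Y) \<partial>distr M borel X)"
    unfolding eq[symmetric] by (rule Y.nn_integral_fst[symmetric]) simp
  also have "\<dots> = (\<integral>\<^sup>+\<omega>. (\<integral>\<^sup>+y. \<phi> (X \<omega>, y) \<partial>distr M borel Y) \<partial>M)"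
    by (rule nn_integral_distr) simp_all
  finally show ?thesis .
qed

text \<open>\<open>B\<close> is integrated out first, with \<open>X\<close> and \<open>A\<close>
  frozen, and then \<open>A\<close> with \<open>X\<close> frozen; this matches the order in which
  the half increments become known.\<close>

lemma (in prob_space) nn_integral_indep_two:
  fixes X :: "'a \<Rightarrow> 'b::second_countable_topology" and A B :: "'a \<Rightarrow> 'c::second_countable_topology"
  assumes XA: "product_law X A" and XAB: "product_law (\<lambda>\<omega>. (X \<omega>, A \<omega>)) B"
    and \<phi>: "\<phi> \<in> borel_measurable borel"
  shows "(\<integral>\<^sup>+\<omega>. \<phi> (X \<omega>, A \<omega>, B \<omega>) \<partial>M)
    = (\<integral>\<^sup>+\<omega>. (\<integral>\<^sup>+v. \<phi> (X \<omega>, v) \<partial>(distr M borel A \<Otimes>\<^sub>M distr M borel B)) \<partial>M)"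
proof -
  have [measurable]: "\<phi> \<in> borel_measurable (borel \<Otimes>\<^sub>M (borel \<Otimes>\<^sub>M borel))"
    using \<phi> by (simp add: borel_prod)
  have rv[measurable]: "random_variable borel A" "random_variable borel B"
    using XA XAB by (simp_all add: product_law_def)
  interpret B: prob_space "distr M borel B" by (rule prob_space_distr) simp
  let ?\<psi> = "\<lambda>p. \<phi> (fst (fst p), snd (fst p), snd p)"
  have \<psi>: "?\<psi> \<in> borel_measurable (borel \<Otimes>\<^sub>M borel)"
    by (simp flip: borel_prod)
  have "(\<integral>\<^sup>+\<omega>. \<phi> (X \<omega>, A \<omega>, B \<omega>) \<partial>M) = (\<integral>\<^sup>+\<omega>. (\<integral>\<^sup>+b. \<phi> (X \<omega>, A \<omega>, b) \<partial>distr M borel B) \<partial>M)"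
    using nn_integral_product_law[OF XAB \<psi>] by simp
  also have "\<dots> = (\<integral>\<^sup>+\<omega>. (\<integral>\<^sup>+a. (\<integral>\<^sup>+b. \<phi> (X \<omega>, a, b) \<partial>distr M borel B) \<partial>distr M borel A) \<partial>M)"
    using nn_integral_product_law[OF XA, of "\<lambda>p. \<integral>\<^sup>+b. \<phi> (fst p, snd p, b) \<partial>distr M borel B"] by simp
  also have "\<dots> = (\<integral>\<^sup>+\<omega>. (\<integral>\<^sup>+v. \<phi> (X \<omega>, v) \<partial>(distr M borel A \<Otimes>\<^sub>M distr M borel B)) \<partial>M)"
    by (intro nn_integral_cong B.nn_integral_fst[of "\<lambda>v. \<phi> (X _, v)"]) simp
  finally show ?thesis .
qed

subsection \<open>The coupled paths\<close>

locale coupled_paths = milstein_scheme f g R T + prob_space M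
  for f :: "real^'d::finite \<Rightarrow> real^'d" and g :: "real^'d \<Rightarrow> real^'m::finite^'d"
    and R :: "real^'m^'m" and T :: real and M :: "'a measure" +
  fixes F :: "real \<Rightarrow> 'a measure" and w :: "real \<Rightarrow> 'a \<Rightarrow> real^'m" and x0 :: "real^'d" and N :: nat
  assumes filt: "usual_filtration M F" and bm: "correlated_brownian_motion M F R w"
    and T_pos: "0 < T" and N_pos: "1 \<le> N"
begin

abbreviation \<tau> :: real where "\<tau> \<equiv> T / real N"
abbreviation \<epsilon> :: real where "\<epsilon> \<equiv> sqrt \<tau>"
abbreviation incr_a :: "nat \<Rightarrow> 'a \<Rightarrow> real^'m" where "incr_a n \<omega> \<equiv> first_half_incr T N w \<omega> n"
abbreviation incr_b :: "nat \<Rightarrow> 'a \<Rightarrow> real^'m" where "incr_b n \<omega> \<equiv> second_half_incr T N w \<omega> n"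

definition paths :: "nat \<Rightarrow> 'a \<Rightarrow> 'd state" where
  "paths n \<omega> = (halved_path f g R x0 \<tau> (first_half_incr T N w \<omega>) (second_half_incr T N w \<omega>) n,
     halved_path f g R x0 \<tau> (second_half_incr T N w \<omega>) (first_half_incr T N w \<omega>) n,
     coarse_path f g R x0 \<tau> (coarse_incr T N w \<omega>) n)"

definition conf :: "nat \<Rightarrow> 'a \<Rightarrow> ('d, 'm) config" where
  "conf n \<omega> = (\<epsilon>, paths n \<omega>, incr_a n \<omega>, incr_b n \<omega>)"

lemma tau_pos: "0 < \<tau>"
  using T_pos N_pos by simp

lemma eps_sq: "\<epsilon>\<^sup>2 = \<tau>"
  using tau_pos by simp

lemma eps_pos: "0 < \<epsilon>"
  using tau_pos by simp

lemma eps_sq_le: "\<epsilon>\<^sup>2 \<le> T"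
proof -
  have "T / real N \<le> T / 1"
    using T_pos N_pos by (intro divide_left_mono) auto
  then show ?thesis unfolding eps_sq by simp
qed

text \<open>The three recursions form one Markov chain on triples: the coarse increment is the sum
  of the half increments, and the antithetic component is a fine step of the swapped
  configuration.\<close>

lemma paths_Suc: "paths (Suc n) \<omega> = step \<epsilon> (paths n \<omega>) (incr_a n \<omega>, incr_b n \<omega>)"
proof -
  have "coarse_incr T N w \<omega> n = incr_a n \<omega> + incr_b n \<omega>"
    by (simp add: coarse_incr_def first_half_incr_def second_half_incr_def)
  then show ?thesis
    using eps_sq by (simp add: paths_def step_def yf_def zf_def zc_def swap_def)
qed

lemma subalgebra_F:
  assumes "0 \<le> s"
  shows "subalgebra M (F s)" and "s \<le> t \<Longrightarrow> subalgebra (F t) (F s)"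
proof -
  interpret filtration "space M" "\<lambda>t. F (max 0 t)"
    using filt by (simp add: usual_filtration_def)
  have sp: "space (F t) = space M" if "0 \<le> t" for t
    using space_F[of t] that by simp
  show "subalgebra M (F s)"
    using filt assms sp by (simp add: subalgebra_def usual_filtration_def)
  show "subalgebra (F t) (F s)" if "s \<le> t"
    using sets_F_mono[OF that] assms that sp by (simp add: subalgebra_def)
qed

lemma w_measurable: "0 \<le> s \<Longrightarrow> s \<le> t \<Longrightarrow> w s \<in> borel_measurable (F t)"
  using bm measurable_from_subalg[OF subalgebra_F(2)] unfolding correlated_brownian_motion_def by blast

lemma increment:
  assumes "0 \<le> s" "s < t"
  shows "noise_law R (t - s) (distr M borel (\<lambda>\<omega>. w t \<omega> - w s \<omega>))"
    and "X \<in> borel_measurable (F s) \<Longrightarrow> product_law X (\<lambda>\<omega>. w t \<omega> - w s \<omega>)"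
proof -
  have g: "centred_gaussian M (\<lambda>\<omega>. w t \<omega> - w s \<omega>) ((t - s) *\<^sub>R R)" and d: "\<And>j. R $ j $ j = 1"
    and i: "indep_set (sets (F s)) (sets (vimage_algebra (space M) (\<lambda>\<omega>. w t \<omega> - w s \<omega>) borel))"
    using bm assms unfolding correlated_brownian_motion_def by blast+
  show "noise_law R (t - s) (distr M borel (\<lambda>\<omega>. w t \<omega> - w s \<omega>))"
    using noise_law_centred_gaussian[OF prob_space_axioms g d] assms by simp
  show "product_law X (\<lambda>\<omega>. w t \<omega> - w s \<omega>)" if "X \<in> borel_measurable (F s)"
    using product_law_subalgebra[OF subalgebra_F(1)[OF assms(1)] that _ i] g
    by (simp add: centred_gaussian_def)
qed

abbreviation time :: "nat \<Rightarrow> real" where "time n \<equiv> real n * \<tau>"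
abbreviation mid_time :: "nat \<Rightarrow> real" where "mid_time n \<equiv> (real n + 1/2) * \<tau>"

lemma time_order: "0 \<le> time n" "time n < mid_time n" "0 \<le> mid_time n" "mid_time n < time (Suc n)"
  by (rule mult_nonneg_nonneg mult_strict_right_mono[OF _ tau_pos]; use less_imp_le[OF tau_pos] in simp)+

lemma time_diff: "mid_time n - time n = \<epsilon>\<^sup>2 / 2" "time (Suc n) - mid_time n = \<epsilon>\<^sup>2 / 2"
proof -
  have "(x + 1/2) * t - x * t = t / 2" "(1 + x) * t - (x + 1/2) * t = t / 2" for x t :: real
    by (simp_all add: algebra_simps)
  then show "mid_time n - time n = \<epsilon>\<^sup>2 / 2" "time (Suc n) - mid_time n = \<epsilon>\<^sup>2 / 2"
    unfolding eps_sq of_nat_Suc by blast+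
qed

lemma incr_measurable:
  "incr_a n \<in> borel_measurable (F (mid_time n))" "incr_a n \<in> borel_measurable (F (time (Suc n)))"
  "incr_b n \<in> borel_measurable (F (time (Suc n)))"
  unfolding first_half_incr_def second_half_incr_def
  by (intro borel_measurable_diff w_measurable time_order order.refl less_imp_le[OF time_order(2)] less_imp_le[OF time_order(4)]
      less_imp_le[OF less_trans[OF time_order(2) time_order(4)]])+

lemma paths_measurable: "paths n \<in> borel_measurable (F (time n))"
proof (induction n)
  case 0
  then show ?case by (simp add: paths_def)
next
  case (Suc n)
  have le: "time n \<le> time (Suc n)"
    using less_trans[OF time_order(2) time_order(4)] by (rule less_imp_le)
  have p: "paths n \<in> borel_measurable (F (time (Suc n)))"
    by (rule measurable_from_subalg[OF subalgebra_F(2)[OF time_order(1) le] Suc])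
  have "(\<lambda>\<omega>. (paths n \<omega>, incr_a n \<omega>, incr_b n \<omega>)) \<in> borel_measurable (F (time (Suc n)))"
    by (intro borel_measurable_Pair p incr_measurable)
  from measurable_compose[OF this step_measurable[of \<epsilon>]]
  show ?case by (simp add: paths_Suc)
qed

definition noise :: "nat \<Rightarrow> ((real^'m) \<times> (real^'m)) measure" where
  "noise n = distr M borel (incr_a n) \<Otimes>\<^sub>M distr M borel (incr_b n)"

lemma noise_pair_noise: "noise_pair R \<epsilon> (noise n)"
  using increment(1)[OF time_order(1,2), of n] increment(1)[OF time_order(3,4), of n]
  unfolding noise_pair_def noise_def time_diff first_half_incr_def second_half_incr_def by blast

text \<open>The Markov property in integrated form. The first half increment is independent of the
  past at the grid time; the second is independent of the past at the midpoint, with respect to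
  which the pair of state and first half increment is measurable.\<close>

lemma nn_integral_conf:
  assumes "(\<lambda>p. \<phi> (\<epsilon>, p)) \<in> borel_measurable borel"
  shows "(\<integral>\<^sup>+\<omega>. \<phi> (conf n \<omega>) \<partial>M) = (\<integral>\<^sup>+\<omega>. (\<integral>\<^sup>+v. \<phi> (\<epsilon>, paths n \<omega>, v) \<partial>noise n) \<partial>M)"
proof -
  have 1: "product_law (paths n) (incr_a n)"
    unfolding first_half_incr_def by (rule increment(2)[OF time_order(1,2) paths_measurable])
  have "paths n \<in> borel_measurable (F (mid_time n))"
    by (rule measurable_from_subalg[OF subalgebra_F(2)[OF time_order(1) less_imp_le[OF time_order(2)]] paths_measurable])
  then have "(\<lambda>\<omega>. (paths n \<omega>, incr_a n \<omega>)) \<in> borel_measurable (F (mid_time n))"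
    by (intro borel_measurable_Pair incr_measurable)
  then have 2: "product_law (\<lambda>\<omega>. (paths n \<omega>, incr_a n \<omega>)) (incr_b n)"
    unfolding second_half_incr_def by (rule increment(2)[OF time_order(3,4)])
  show ?thesis
    using nn_integral_indep_two[OF 1 2 assms] unfolding conf_def noise_def .
qed

section \<open>Moment bounds along the chain\<close>

lemma lyap_nonneg: "0 \<le> lyap e S"
  using lyap_bounds(1)[of e S] by simp

text \<open>A discrete Gronwall argument. The one-step bound is a hypothesis so that
  \<open>C\<close> can be fixed before \<open>N\<close> is chosen.\<close>

lemma lyap_paths_bound:
  assumes C: "0 \<le> C" "\<And>e S Q. 0 < e \<Longrightarrow> e\<^sup>2 \<le> T \<Longrightarrow> noise_pair R e Q \<Longrightarrow>
     integrable Q (\<lambda>v. lyap e (step e S v)) \<and> (\<integral>v. lyap e (step e S v) \<partial>Q) \<le> (1 + C * e\<^sup>2) * lyap e S"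
    and "n \<le> N"
  shows "(\<integral>\<^sup>+\<omega>. ennreal (lyap \<epsilon> (paths n \<omega>)) \<partial>M) \<le> ennreal (exp (C * T) * lyap 1 (x0, x0, x0))"
proof -
  let ?L = "lyap 1 (x0, x0, x0)"
  have m: "(\<lambda>\<omega>. lyap \<epsilon> (paths n \<omega>)) \<in> borel_measurable M" for n
    by (rule measurable_compose[OF measurable_from_subalg[OF subalgebra_F(1)[OF time_order(1)] paths_measurable] lyap_measurable])
  have "(\<integral>\<^sup>+\<omega>. ennreal (lyap \<epsilon> (paths n \<omega>)) \<partial>M) \<le> ennreal ((1 + C * \<epsilon>\<^sup>2) ^ n * ?L)" for n
  proof (induction n)
    case 0
    \<comment> \<open>All three paths start at \<open>x0\<close>, so the terms weighted by the step
      size vanish and the initial value is the same for every step size; hence the 1 in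
      \<open>?L\<close>.\<close>
    have "lyap \<epsilon> (paths 0 \<omega>) = ?L" for \<omega>
      by (simp add: paths_def lyap_def)
    then show ?case by (simp add: emeasure_space_1)
  next
    case (Suc n)
    have "(\<integral>\<^sup>+\<omega>. ennreal (lyap \<epsilon> (paths (Suc n) \<omega>)) \<partial>M)
        = (\<integral>\<^sup>+\<omega>. (\<integral>\<^sup>+v. ennreal (lyap \<epsilon> (step \<epsilon> (paths n \<omega>) v)) \<partial>noise n) \<partial>M)"
      using nn_integral_conf[of "\<lambda>i. ennreal (lyap (eps i) (step (eps i) (fst (snd i)) (snd (snd i))))" n]
        measurable_compose[OF step_measurable[of \<epsilon>] lyap_measurable[of \<epsilon>]]
      by (simp add: paths_Suc conf_def)
    also have "\<dots> \<le> (\<integral>\<^sup>+\<omega>. ennreal (1 + C * \<epsilon>\<^sup>2) * ennreal (lyap \<epsilon> (paths n \<omega>)) \<partial>M)"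
    proof (rule nn_integral_mono)
      fix \<omega>
      have "(\<integral>\<^sup>+v. ennreal (lyap \<epsilon> (step \<epsilon> (paths n \<omega>) v)) \<partial>noise n)
          = ennreal (\<integral>v. lyap \<epsilon> (step \<epsilon> (paths n \<omega>) v) \<partial>noise n)"
        using C(2)[OF eps_pos eps_sq_le noise_pair_noise] by (intro nn_integral_eq_integral) (auto simp: lyap_nonneg)
      also have "\<dots> \<le> ennreal ((1 + C * \<epsilon>\<^sup>2) * lyap \<epsilon> (paths n \<omega>))"
        using C(2)[OF eps_pos eps_sq_le noise_pair_noise] by (intro ennreal_leI) blast
      also have "\<dots> = ennreal (1 + C * \<epsilon>\<^sup>2) * ennreal (lyap \<epsilon> (paths n \<omega>))"
        using C(1) by (intro ennreal_mult) (auto simp: lyap_nonneg)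
      finally show "(\<integral>\<^sup>+v. ennreal (lyap \<epsilon> (step \<epsilon> (paths n \<omega>) v)) \<partial>noise n)
        \<le> ennreal (1 + C * \<epsilon>\<^sup>2) * ennreal (lyap \<epsilon> (paths n \<omega>))" .
    qed
    also have "\<dots> = ennreal (1 + C * \<epsilon>\<^sup>2) * (\<integral>\<^sup>+\<omega>. ennreal (lyap \<epsilon> (paths n \<omega>)) \<partial>M)"
      using m by (intro nn_integral_cmult) simp
    also have "\<dots> \<le> ennreal (1 + C * \<epsilon>\<^sup>2) * ennreal ((1 + C * \<epsilon>\<^sup>2) ^ n * ?L)"
      by (intro mult_left_mono Suc) simp
    also have "\<dots> = ennreal ((1 + C * \<epsilon>\<^sup>2) ^ Suc n * ?L)"
      using C(1) by (subst ennreal_mult[symmetric]) (auto simp: lyap_nonneg mult.assoc)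
    finally show ?case .
  qed
  \<comment> \<open>From \<open>1 + x \<le> exp x\<close> and the fact that at most \<open>N\<close>
    steps of length \<open>T / N\<close> are taken.\<close>
  also have "ennreal ((1 + C * \<epsilon>\<^sup>2) ^ n * ?L) \<le> ennreal (exp (C * T) * ?L)"
  proof (intro ennreal_leI mult_right_mono lyap_nonneg)
    have "(1 + C * \<epsilon>\<^sup>2) ^ n \<le> exp (C * \<epsilon>\<^sup>2) ^ n"
      using C(1) by (intro power_mono) auto
    also have "\<dots> = exp (real n * (C * \<epsilon>\<^sup>2))"
      by (simp add: exp_of_nat_mult)
    also have "\<dots> \<le> exp (C * T)"
    proof -
      have "real n * (C * \<epsilon>\<^sup>2) \<le> real N * (C * \<epsilon>\<^sup>2)"
        using assms(3) C(1) by (intro mult_right_mono) auto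
      also have "\<dots> = C * T"
        unfolding eps_sq using N_pos by simp
      finally show ?thesis by simp
    qed
    finally show "(1 + C * \<epsilon>\<^sup>2) ^ n \<le> exp (C * T)" .
  qed
  finally show ?thesis .
qed

lemma ave_err_bound:
  assumes C: "0 \<le> C" "\<And>e S Q. 0 < e \<Longrightarrow> e\<^sup>2 \<le> T \<Longrightarrow> noise_pair R e Q \<Longrightarrow>
     integrable Q (\<lambda>v. lyap e (step e S v)) \<and> (\<integral>v. lyap e (step e S v) \<partial>Q) \<le> (1 + C * e\<^sup>2) * lyap e S"
    and C': "0 \<le> C'" "\<And>e S Q. 0 < e \<Longrightarrow> e\<^sup>2 \<le> T \<Longrightarrow> noise_pair R e Q \<Longrightarrow>
     integrable Q (\<lambda>v. ave_err (e, S, v)) \<and> (\<integral>v. ave_err (e, S, v) \<partial>Q) \<le> C' * (e ^ 4 * lyap e S)"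
    and "n \<le> N"
  shows "(\<integral>\<^sup>+\<omega>. ennreal (ave_err (conf n \<omega>)) \<partial>M) \<le> ennreal (C' * \<tau>\<^sup>2 * (exp (C * T) * lyap 1 (x0, x0, x0)))"
proof -
  have m: "(\<lambda>\<omega>. lyap \<epsilon> (paths n \<omega>)) \<in> borel_measurable M"
    by (rule measurable_compose[OF measurable_from_subalg[OF subalgebra_F(1)[OF time_order(1)] paths_measurable] lyap_measurable])
  have e4: "\<epsilon> ^ 4 = \<tau>\<^sup>2"
    using eps_sq by (metis power_mult numeral_Bit0 mult_2)
  have "(\<integral>\<^sup>+\<omega>. ennreal (ave_err (conf n \<omega>)) \<partial>M) = (\<integral>\<^sup>+\<omega>. (\<integral>\<^sup>+v. ennreal (ave_err (\<epsilon>, paths n \<omega>, v)) \<partial>noise n) \<partial>M)"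
    using config_measurable[OF cont_config_ave_err, of \<epsilon>] by (intro nn_integral_conf) simp
  also have "\<dots> \<le> (\<integral>\<^sup>+\<omega>. ennreal (C' * \<tau>\<^sup>2) * ennreal (lyap \<epsilon> (paths n \<omega>)) \<partial>M)"
  proof (rule nn_integral_mono)
    fix \<omega>
    have "(\<integral>\<^sup>+v. ennreal (ave_err (\<epsilon>, paths n \<omega>, v)) \<partial>noise n) = ennreal (\<integral>v. ave_err (\<epsilon>, paths n \<omega>, v) \<partial>noise n)"
      using C'(2)[OF eps_pos eps_sq_le noise_pair_noise] by (intro nn_integral_eq_integral) (auto simp: ave_err_nonneg)
    also have "\<dots> \<le> ennreal (C' * (\<epsilon> ^ 4 * lyap \<epsilon> (paths n \<omega>)))"
      using C'(2)[OF eps_pos eps_sq_le noise_pair_noise] by (intro ennreal_leI) blast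
    also have "\<dots> = ennreal (C' * \<tau>\<^sup>2) * ennreal (lyap \<epsilon> (paths n \<omega>))"
      unfolding e4 using C'(1) by (subst ennreal_mult[symmetric]) (auto simp: lyap_nonneg mult.assoc)
    finally show "(\<integral>\<^sup>+v. ennreal (ave_err (\<epsilon>, paths n \<omega>, v)) \<partial>noise n)
      \<le> ennreal (C' * \<tau>\<^sup>2) * ennreal (lyap \<epsilon> (paths n \<omega>))" .
  qed
  also have "\<dots> = ennreal (C' * \<tau>\<^sup>2) * (\<integral>\<^sup>+\<omega>. ennreal (lyap \<epsilon> (paths n \<omega>)) \<partial>M)"
    using m by (intro nn_integral_cmult) simp
  also have "\<dots> \<le> ennreal (C' * \<tau>\<^sup>2) * ennreal (exp (C * T) * lyap 1 (x0, x0, x0))"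
    by (rule mult_left_mono[OF lyap_paths_bound[OF C assms(5)]]) simp_all
  also have "\<dots> = ennreal (C' * \<tau>\<^sup>2 * (exp (C * T) * lyap 1 (x0, x0, x0)))"
    using C'(1) by (subst ennreal_mult[symmetric]) (auto simp: lyap_nonneg)
  finally show ?thesis .
qed

end

subsection \<open>The antithetic estimator\<close>

text \<open>Jensen's inequality for the average over steps, via Cauchy-Schwarz; the fourth power
  below follows by applying it twice.\<close>

lemma mean_power2_le:
  fixes x :: "nat \<Rightarrow> real"
  assumes "1 \<le> N"
  shows "((\<Sum>n<N. x n) / real N)\<^sup>2 \<le> (\<Sum>n<N. (x n)\<^sup>2) / real N"
proof -
  have "(\<Sum>n<N. x n)\<^sup>2 \<le> (\<Sum>n<N. (x n)\<^sup>2) * real N"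
    using sum_squared_le_sum_of_squares[of x "{..<N}"] by simp
  then show ?thesis
    using assms by (simp add: power_divide divide_simps power2_eq_square)
qed

lemma mean_power4_le:
  fixes x :: "nat \<Rightarrow> real"
  assumes "1 \<le> N"
  shows "((\<Sum>n<N. x n) / real N) ^ 4 \<le> (\<Sum>n<N. (x n) ^ 4) / real N"
proof -
  have "((\<Sum>n<N. x n) / real N) ^ 4 = (((\<Sum>n<N. x n) / real N)\<^sup>2)\<^sup>2"
    by (simp flip: power_mult)
  also have "\<dots> \<le> ((\<Sum>n<N. (x n)\<^sup>2) / real N)\<^sup>2"
    by (intro power_mono mean_power2_le assms) simp
  also have "\<dots> \<le> (\<Sum>n<N. ((x n)\<^sup>2)\<^sup>2) / real N"
    by (rule mean_power2_le[OF assms])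
  finally show ?thesis by (simp flip: power_mult)
qed

lemma norm_power_le:
  fixes x :: "real^'d::finite"
  shows "norm x ^ r \<le> real CARD('d) ^ r * (\<Sum>k\<in>UNIV. \<bar>x $ k\<bar> ^ r)"
  using power_mono[OF norm_le_l1_cart[of x], of r] power_sum_le[of UNIV "\<lambda>k. \<bar>x $ k\<bar>" r]
  by auto

lemma antithetic_payoff_bound:
  fixes P :: "real^'d::finite \<Rightarrow> real"
  assumes "taylor_fun P" "lipschitz_fun P"
  shows "\<exists>K\<ge>0. \<forall>p q c. (1/2 * (P p + P q) - P c)\<^sup>2
    \<le> K * ((\<Sum>k\<in>UNIV. ((p - q) $ k) ^ 4) + (\<Sum>k\<in>UNIV. (((1/2) *\<^sub>R (p + q) - c) $ k) ^ 2))"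
proof -
  obtain L where L: "0 \<le> L" "\<And>p q. \<bar>(P p + P q) / 2 - P ((1/2) *\<^sub>R (p + q))\<bar> \<le> L * (norm (p - q))\<^sup>2"
    using taylor_fun_midpoint[OF assms(1)] by blast
  obtain L' where L': "0 \<le> L'" "\<And>x y. \<bar>P x - P y\<bar> \<le> L' * norm (x - y)"
    using assms(2) unfolding lipschitz_fun_def by blast
  let ?d = "real CARD('d)"
  \<comment> \<open>The factors 2 come from
    \<open>(x + y)\<^sup>2 \<le> 2 * x\<^sup>2 + 2 * y\<^sup>2\<close>, and the powers of the
    dimension from passing from norms to coordinates by \<open>norm_power_le\<close>.\<close>
  let ?K = "2 * L\<^sup>2 * ?d ^ 4 + 2 * L'\<^sup>2 * ?d ^ 2"
  show ?thesis
  proof (intro exI[of _ ?K] conjI allI)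
    show "0 \<le> ?K" by simp
    fix p q c :: "real^'d"
    let ?m = "(1/2) *\<^sub>R (p + q)"
    let ?A = "\<Sum>k\<in>UNIV. ((p - q) $ k) ^ 4" and ?B = "\<Sum>k\<in>UNIV. ((?m - c) $ k) ^ 2"
    have nn: "0 \<le> ?A" "0 \<le> ?B" by (auto intro!: sum_nonneg)
    have "((P p + P q) / 2 - P ?m)\<^sup>2 \<le> (L * (norm (p - q))\<^sup>2)\<^sup>2"
      using power_mono[OF L(2) abs_ge_zero, of p q 2] by simp
    also have "\<dots> = L\<^sup>2 * norm (p - q) ^ 4"
      by (simp add: power_mult_distrib flip: power_mult)
    also have "\<dots> \<le> L\<^sup>2 * (?d ^ 4 * ?A)"
      using norm_power_le[of "p - q" 4] by (intro mult_left_mono) auto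
    finally have 1: "((P p + P q) / 2 - P ?m)\<^sup>2 \<le> L\<^sup>2 * (?d ^ 4 * ?A)" .
    have "(P ?m - P c)\<^sup>2 \<le> (L' * norm (?m - c))\<^sup>2"
      using power_mono[OF L'(2) abs_ge_zero, of ?m c 2] by simp
    also have "\<dots> \<le> L'\<^sup>2 * (?d ^ 2 * ?B)"
      unfolding power_mult_distrib using norm_power_le[of "?m - c" 2] by (intro mult_left_mono) auto
    finally have 2: "(P ?m - P c)\<^sup>2 \<le> L'\<^sup>2 * (?d ^ 2 * ?B)" .
    have "1/2 * (P p + P q) - P c = ((P p + P q) / 2 - P ?m) + (P ?m - P c)"
      by simp
    moreover have "(x + y)\<^sup>2 \<le> 2 * x\<^sup>2 + 2 * y\<^sup>2" for x y :: real
      using zero_le_power2[of "x - y"] by (simp add: power2_eq_square algebra_simps)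
    ultimately have "(1/2 * (P p + P q) - P c)\<^sup>2 \<le> 2 * ((P p + P q) / 2 - P ?m)\<^sup>2 + 2 * (P ?m - P c)\<^sup>2"
      by presburger
    also have "\<dots> \<le> 2 * (L\<^sup>2 * (?d ^ 4 * ?A)) + 2 * (L'\<^sup>2 * (?d ^ 2 * ?B))"
      using 1 2 by (intro add_mono mult_left_mono) auto
    also have "\<dots> = (2 * L\<^sup>2 * ?d ^ 4) * ?A + (2 * L'\<^sup>2 * ?d ^ 2) * ?B"
      by simp
    also have "\<dots> \<le> ?K * ?A + ?K * ?B"
      using nn by (intro add_mono mult_right_mono) auto
    finally show "(1/2 * (P p + P q) - P c)\<^sup>2 \<le> ?K * (?A + ?B)"
      by (simp add: distrib_left)
  qed
qed

context coupled_paths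
begin

text \<open>The state after step \<open>n\<close> is \<open>zf (conf n \<omega>)\<close>, so each
  summand of the average becomes a function of a single configuration.\<close>

lemma Xf_ave_conf: "Xf_ave f g R x0 T N w \<omega> = (1 / real N) *\<^sub>R (\<Sum>n<N. (1/4) *\<^sub>R
    (xf (conf n \<omega>) + 2 *\<^sub>R yf (conf n \<omega>) + zf (conf n \<omega>)))"
  using eps_sq by (simp add: Xf_ave_def Let_def halved_ave_def halved_path_mid_def conf_def paths_def yf_def zf_def)

lemma Xa_ave_conf: "Xa_ave f g R x0 T N w \<omega> = (1 / real N) *\<^sub>R (\<Sum>n<N. (1/4) *\<^sub>R
    (xa (conf n \<omega>) + 2 *\<^sub>R yf (swap (conf n \<omega>)) + zf (swap (conf n \<omega>))))"
  using eps_sq by (simp add: Xa_ave_def Let_def halved_ave_def halved_path_mid_def conf_def paths_def yf_def zf_def)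

lemma Xc_ave_conf: "Xc_ave f g R x0 T N w \<omega> = (1 / real N) *\<^sub>R (\<Sum>n<N. (1/2) *\<^sub>R
    (xc (conf n \<omega>) + zc (conf n \<omega>)))"
proof -
  have "coarse_incr T N w \<omega> n = incr_a n \<omega> + incr_b n \<omega>" for n
    by (simp add: coarse_incr_def first_half_incr_def second_half_incr_def)
  then show ?thesis
    using eps_sq by (simp add: Xc_ave_def coarse_ave_def conf_def paths_def zc_def)
qed

lemma ave_diff_conf: "(Xf_ave f g R x0 T N w \<omega> - Xa_ave f g R x0 T N w \<omega>) $ k
    = (\<Sum>n<N. ave_diff k (conf n \<omega>)) / real N"
proof -
  have "(\<Sum>n<N. ave_diff k (conf n \<omega>)) = (\<Sum>n<N. (xf (conf n \<omega>) $ k + 2 * yf (conf n \<omega>) $ k + zf (conf n \<omega>) $ k) / 4)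
      - (\<Sum>n<N. (xa (conf n \<omega>) $ k + 2 * yf (swap (conf n \<omega>)) $ k + zf (swap (conf n \<omega>)) $ k) / 4)"
    unfolding sum_subtractf[symmetric] by (intro sum.cong refl) (simp add: ave_diff_def field_simps)
  then show ?thesis
    unfolding Xf_ave_conf Xa_ave_conf by (simp add: diff_divide_distrib)
qed

lemma ave_mean_conf: "((1/2) *\<^sub>R (Xf_ave f g R x0 T N w \<omega> + Xa_ave f g R x0 T N w \<omega>) - Xc_ave f g R x0 T N w \<omega>) $ k
    = (\<Sum>n<N. ave_mean k (conf n \<omega>)) / real N"
proof -
  have "(\<Sum>n<N. ave_mean k (conf n \<omega>)) = ((\<Sum>n<N. (xf (conf n \<omega>) $ k + 2 * yf (conf n \<omega>) $ k + zf (conf n \<omega>) $ k) / 4)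
      + (\<Sum>n<N. (xa (conf n \<omega>) $ k + 2 * yf (swap (conf n \<omega>)) $ k + zf (swap (conf n \<omega>)) $ k) / 4)) / 2
      - (\<Sum>n<N. (xc (conf n \<omega>) $ k + zc (conf n \<omega>) $ k) / 2)"
    unfolding sum_subtractf[symmetric] sum.distrib[symmetric] sum_divide_distrib
    by (intro sum.cong refl) (simp add: ave_mean_def mid_mean_def field_simps)
  then show ?thesis
    unfolding Xf_ave_conf Xa_ave_conf Xc_ave_conf by (simp add: diff_divide_distrib add_divide_distrib)
qed

lemma conf_measurable:
  assumes "cont_config \<phi>"
  shows "(\<lambda>\<omega>. \<phi> (conf n \<omega>)) \<in> borel_measurable M"
proof -
  have "(\<lambda>\<omega>. (paths n \<omega>, incr_a n \<omega>, incr_b n \<omega>)) \<in> borel_measurable M"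
    by (intro borel_measurable_Pair measurable_from_subalg[OF subalgebra_F(1) paths_measurable]
        measurable_from_subalg[OF subalgebra_F(1) incr_measurable(1)] measurable_from_subalg[OF subalgebra_F(1) incr_measurable(3)]
        time_order)
  from measurable_compose[OF this config_measurable[OF assms, of \<epsilon>]]
  show ?thesis by (simp add: conf_def)
qed

lemma borel_measurable_vecI:
  fixes X :: "'a \<Rightarrow> real^'n::finite"
  assumes "\<And>k. (\<lambda>\<omega>. X \<omega> $ k) \<in> borel_measurable M"
  shows "X \<in> borel_measurable M"
proof (rule borel_measurable_euclidean_space[THEN iffD2], intro ballI)
  fix b :: "real^'n" assume "b \<in> Basis"
  then obtain k where "b = axis k 1"
    unfolding Basis_vec_def by auto
  then show "(\<lambda>\<omega>. X \<omega> \<bullet> b) \<in> borel_measurable M"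
    using assms[of k] by (simp add: inner_axis)
qed

lemma averages_measurable:
  "Xf_ave f g R x0 T N w \<in> borel_measurable M" "Xa_ave f g R x0 T N w \<in> borel_measurable M"
  "Xc_ave f g R x0 T N w \<in> borel_measurable M"
proof -
  have [measurable]: "(\<lambda>\<omega>. xf (conf n \<omega>)) \<in> borel_measurable M" "(\<lambda>\<omega>. xa (conf n \<omega>)) \<in> borel_measurable M"
    "(\<lambda>\<omega>. xc (conf n \<omega>)) \<in> borel_measurable M" "(\<lambda>\<omega>. yf (conf n \<omega>)) \<in> borel_measurable M"
    "(\<lambda>\<omega>. zf (conf n \<omega>)) \<in> borel_measurable M" "(\<lambda>\<omega>. zc (conf n \<omega>)) \<in> borel_measurable M"
    "(\<lambda>\<omega>. yf (swap (conf n \<omega>))) \<in> borel_measurable M" "(\<lambda>\<omega>. zf (swap (conf n \<omega>))) \<in> borel_measurable M" for n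
    by (intro borel_measurable_vecI conf_measurable cont_config_scheme cont_config_swap[OF cont_config_yf]
        cont_config_swap[OF cont_config_zf])+
  show "Xf_ave f g R x0 T N w \<in> borel_measurable M" "Xa_ave f g R x0 T N w \<in> borel_measurable M"
    "Xc_ave f g R x0 T N w \<in> borel_measurable M"
    unfolding Xf_ave_conf[abs_def] Xa_ave_conf[abs_def] Xc_ave_conf[abs_def] by measurable
qed

lemma antithetic_correction_sq_le:
  assumes "\<And>p q c. (1/2 * (P p + P q) - P c)\<^sup>2
    \<le> K * ((\<Sum>k\<in>UNIV. ((p - q) $ k) ^ 4) + (\<Sum>k\<in>UNIV. (((1/2) *\<^sub>R (p + q) - c) $ k) ^ 2))" and "0 \<le> K"
  shows "(antithetic_correction P f g R x0 T N w \<omega>)\<^sup>2 \<le> K / real N * (\<Sum>n<N. ave_err (conf n \<omega>))"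
proof -
  have "(antithetic_correction P f g R x0 T N w \<omega>)\<^sup>2
      \<le> K * ((\<Sum>k\<in>UNIV. ((\<Sum>n<N. ave_diff k (conf n \<omega>)) / real N) ^ 4) + (\<Sum>k\<in>UNIV. ((\<Sum>n<N. ave_mean k (conf n \<omega>)) / real N) ^ 2))"
    unfolding antithetic_correction_def ave_diff_conf[symmetric] ave_mean_conf[symmetric] by (rule assms(1))
  also have "\<dots> \<le> K * ((\<Sum>k\<in>UNIV. (\<Sum>n<N. ave_diff k (conf n \<omega>) ^ 4) / real N) + (\<Sum>k\<in>UNIV. (\<Sum>n<N. (ave_mean k (conf n \<omega>))\<^sup>2) / real N))"
    by (intro mult_left_mono add_mono sum_mono mean_power4_le mean_power2_le N_pos assms(2))
  also have "\<dots> = K / real N * (\<Sum>n<N. ave_err (conf n \<omega>))"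
  proof -
    have "(\<Sum>n<N. \<Sum>k\<in>UNIV. ave_diff k (conf n \<omega>) ^ 4) = (\<Sum>k\<in>UNIV. \<Sum>n<N. ave_diff k (conf n \<omega>) ^ 4)"
      "(\<Sum>n<N. \<Sum>k\<in>UNIV. (ave_mean k (conf n \<omega>))\<^sup>2) = (\<Sum>k\<in>UNIV. \<Sum>n<N. (ave_mean k (conf n \<omega>))\<^sup>2)"
      by (rule sum.swap)+
    then show ?thesis
      unfolding ave_err_def sum.distrib sum_divide_distrib[symmetric]
      by (simp add: add_divide_distrib distrib_left)
  qed
  finally show ?thesis .
qed

text \<open>The second moment is first bounded as a nonnegative integral. Finiteness gives square
  integrability, hence integrability on a probability space, and only then may the variance be
  expanded.\<close>

lemma antithetic_correction_variance:
  assumes P: "continuous_on UNIV P"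
    and K: "\<And>p q c. (1/2 * (P p + P q) - P c)\<^sup>2
    \<le> K * ((\<Sum>k\<in>UNIV. ((p - q) $ k) ^ 4) + (\<Sum>k\<in>UNIV. (((1/2) *\<^sub>R (p + q) - c) $ k) ^ 2))" "0 \<le> K"
    and B: "\<And>n. n \<le> N \<Longrightarrow> (\<integral>\<^sup>+\<omega>. ennreal (ave_err (conf n \<omega>)) \<partial>M) \<le> ennreal B" "0 \<le> B"
  shows "antithetic_correction P f g R x0 T N w \<in> borel_measurable M"
    "integrable M (\<lambda>\<omega>. (antithetic_correction P f g R x0 T N w \<omega>)\<^sup>2)"
    "variance (antithetic_correction P f g R x0 T N w) \<le> K * B"
proof -
  let ?D = "antithetic_correction P f g R x0 T N w"
  have [measurable]: "P \<in> borel_measurable borel"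
    using P by (rule borel_measurable_continuous_onI)
  note averages_measurable[measurable]
  show m[measurable]: "?D \<in> borel_measurable M"
    unfolding antithetic_correction_def[abs_def] by measurable
  have [measurable]: "(\<lambda>\<omega>. ave_err (conf n \<omega>)) \<in> borel_measurable M" for n
    by (rule conf_measurable[OF cont_config_ave_err])
  have "(\<integral>\<^sup>+\<omega>. ennreal ((?D \<omega>)\<^sup>2) \<partial>M) \<le> (\<integral>\<^sup>+\<omega>. ennreal (K / real N) * (\<Sum>n<N. ennreal (ave_err (conf n \<omega>))) \<partial>M)"
  proof (rule nn_integral_mono)
    fix \<omega>
    have "ennreal ((?D \<omega>)\<^sup>2) \<le> ennreal (K / real N * (\<Sum>n<N. ave_err (conf n \<omega>)))"
      by (intro ennreal_leI antithetic_correction_sq_le K)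
    then show "ennreal ((?D \<omega>)\<^sup>2) \<le> ennreal (K / real N) * (\<Sum>n<N. ennreal (ave_err (conf n \<omega>)))"
      unfolding sum_ennreal[OF ave_err_nonneg] using K(2)
      by (subst ennreal_mult[symmetric]) (auto intro!: sum_nonneg ave_err_nonneg)
  qed
  also have "\<dots> = ennreal (K / real N) * (\<Sum>n<N. (\<integral>\<^sup>+\<omega>. ennreal (ave_err (conf n \<omega>)) \<partial>M))"
    by (simp add: nn_integral_cmult nn_integral_sum)
  also have "\<dots> \<le> ennreal (K / real N) * (\<Sum>n<N. ennreal B)"
    by (intro mult_left_mono sum_mono B) auto
  also have "\<dots> = ennreal (K / real N) * ennreal (real N * B)"
    using B(2) by (simp add: ennreal_of_nat_eq_real_of_nat ennreal_mult)
  also have "\<dots> = ennreal (K * B)"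
    using K(2) B(2) N_pos by (subst ennreal_mult[symmetric]) auto
  finally have le: "(\<integral>\<^sup>+\<omega>. ennreal ((?D \<omega>)\<^sup>2) \<partial>M) \<le> ennreal (K * B)" .
  show i: "integrable M (\<lambda>\<omega>. (?D \<omega>)\<^sup>2)"
    by (rule integrableI_nonneg) (use le in \<open>auto intro: le_less_trans\<close>)
  have "ennreal (\<integral>\<omega>. (?D \<omega>)\<^sup>2 \<partial>M) \<le> ennreal (K * B)"
    using le i by (simp add: nn_integral_eq_integral)
  then have e: "(\<integral>\<omega>. (?D \<omega>)\<^sup>2 \<partial>M) \<le> K * B"
    using K(2) B(2) by (subst (asm) ennreal_le_iff) auto
  have "variance ?D = expectation (\<lambda>\<omega>. (?D \<omega>)\<^sup>2) - (expectation ?D)\<^sup>2"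
    by (intro variance_eq i square_integrable_imp_integrable[OF m i])
  then show "variance ?D \<le> K * B"
    using e zero_le_power2[of "expectation ?D"] by linarith
qed

end

text \<open>Measurability and square integrability belong to the conclusion because the Bochner
  integral is 0 for non-integrable functions; a bound on \<open>variance\<close> alone could hold
  for that reason only.\<close>

theorem mainTheorem4:
  fixes M :: "'a measure" and F :: "real \<Rightarrow> 'a measure"
    and w :: "real \<Rightarrow> 'a \<Rightarrow> real^'m::finite" and \<Omega> :: "real^'m^'m"
    and f :: "real^'d::finite \<Rightarrow> real^'d" and g :: "real^'d \<Rightarrow> real^'m^'d"
    and P :: "real^'d \<Rightarrow> real" and x0 :: "real^'d" and T :: real
  assumes "prob_space M" and "complete_measure M"
    and "usual_filtration M F"
    and "correlated_brownian_motion M F \<Omega> w"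
    and "T > 0"
    and "\<And>i. C2_fun (\<lambda>x. f x $ i)"
    and "\<And>i j. C2_fun (\<lambda>x. g x $ i $ j)"
    and "bounded_derivs_R f g"
    and "C2_fun P"
    and "\<exists>K. \<forall>x. (\<forall>l. \<bar>partial l P x\<bar> \<le> K) \<and> (\<forall>l m. \<bar>partial m (partial l P) x\<bar> \<le> K)"
  shows "\<exists>C. \<forall>N\<ge>1.
      antithetic_correction P f g \<Omega> x0 T N w \<in> borel_measurable M \<and>
      integrable M (\<lambda>\<omega>. (antithetic_correction P f g \<Omega> x0 T N w \<omega>)\<^sup>2) \<and>
      prob_space.variance M (antithetic_correction P f g \<Omega> x0 T N w) \<le> C * (T / real N)\<^sup>2"
proof -
  interpret S: milstein_scheme f g \<Omega> T
    using assms by unfold_locales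
  \<comment> \<open>\<open>C\<close>, \<open>C'\<close> and \<open>K\<close> are all obtained before
    \<open>N\<close> is introduced, which makes the final constant uniform in the step size.\<close>
  obtain C where C: "0 \<le> C" "\<And>e S Q. 0 < e \<Longrightarrow> e\<^sup>2 \<le> T \<Longrightarrow> noise_pair \<Omega> e Q \<Longrightarrow>
     integrable Q (\<lambda>v. lyap e (S.step e S v)) \<and> (\<integral>v. lyap e (S.step e S v) \<partial>Q) \<le> (1 + C * e\<^sup>2) * lyap e S"
    using S.lyap_step by blast
  obtain C' where C': "0 \<le> C'" "\<And>e S Q. 0 < e \<Longrightarrow> e\<^sup>2 \<le> T \<Longrightarrow> noise_pair \<Omega> e Q \<Longrightarrow>
     integrable Q (\<lambda>v. S.ave_err (e, S, v)) \<and> (\<integral>v. S.ave_err (e, S, v) \<partial>Q) \<le> C' * (e ^ 4 * lyap e S)"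
    using S.ave_err_expectation by blast
  obtain B where B: "\<forall>x. (\<forall>l. \<bar>partial l P x\<bar> \<le> B) \<and> (\<forall>l m. \<bar>partial m (partial l P) x\<bar> \<le> B)"
    using assms(10) ..
  have lip: "lipschitz_fun P" "\<And>l. lipschitz_fun (partial l P)"
    using B by (auto intro!: lipschitz_fun_bounded_partials[where K = B] C2_fun_differentiable assms(9))
  have taylor: "taylor_fun P"
    by (intro taylor_fun_bounded_partials lip C2_fun_differentiable assms(9))
  obtain K where K: "0 \<le> K" "\<And>p q c. (1/2 * (P p + P q) - P c)\<^sup>2
    \<le> K * ((\<Sum>k\<in>UNIV. ((p - q) $ k) ^ 4) + (\<Sum>k\<in>UNIV. (((1/2) *\<^sub>R (p + q) - c) $ k) ^ 2))"
    using antithetic_payoff_bound[OF taylor lip(1)] by blast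
  let ?E = "exp (C * T) * lyap 1 (x0, x0, x0)"
  show ?thesis
  \<comment> \<open>\<open>K\<close> comes from the payoff, \<open>C'\<close> from the averaging
    error of one step, and \<open>?E\<close> is the Gronwall bound for the expected Lyapunov
    function up to time \<open>T\<close>.\<close>
  proof (intro exI[of _ "K * C' * ?E"] allI impI)
    fix N :: nat assume N: "1 \<le> N"
    interpret coupled_paths f g \<Omega> T M F w x0 N
      using assms N by (auto intro!: coupled_paths.intro coupled_paths_axioms.intro S.milstein_scheme_axioms)
    have B: "(\<integral>\<^sup>+\<omega>. ennreal (S.ave_err (conf n \<omega>)) \<partial>M) \<le> ennreal (C' * \<tau>\<^sup>2 * ?E)" if "n \<le> N" for n
      by (rule ave_err_bound) (fact C C' that)+
    have "0 \<le> C' * \<tau>\<^sup>2 * ?E"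
      using C'(1) by (intro mult_nonneg_nonneg) (auto simp: lyap_nonneg)
    from antithetic_correction_variance[OF lipschitz_fun_continuous[OF lip(1)] K(2,1) B this]
    show "antithetic_correction P f g \<Omega> x0 T N w \<in> borel_measurable M \<and>
      integrable M (\<lambda>\<omega>. (antithetic_correction P f g \<Omega> x0 T N w \<omega>)\<^sup>2) \<and>
      variance (antithetic_correction P f g \<Omega> x0 T N w) \<le> K * C' * ?E * (T / real N)\<^sup>2"
      by (simp add: mult_ac)
  qed
qed

end
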